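(* Consider the system $$v_t(t,x)=\varphi(t,x),\quad\varphi_t(t,x)=c^2v_{xx}(t,x)-\sigma\varphi(t,x)+\theta_1(t,x)K(x,y(t))+\delta(t,x),\quad v(t,0)=v(t,1)=0,$$ $$\dot y(t)=b(t)u(t)+\theta_2(t)L(w[t],y(t))+d(t),\qquad w[t]=(v[t],\varphi[t]),$$ with $x\in[0,1]$, in closed loop with $$u=-(\kappa+\exp(z))^7\left(P_1(y)+P_2(y)y^2+P_3(y)y^6\right)y,\qquad\dot z=\Gamma\exp(-z)\left(\tfrac12y^2-\varepsilon\right)^+,$$ where all objects are as described in the context. Suppose that for all $x\in[0,1]$, $y\in\mathbb{R}$, $v\in H^2(0,1)\cap H_0^1(0,1)$ and $\varphi\in H_0^1(0,1)$ $$|L((v,\varphi),y)|\le\sqrt{\|v_x\|_2^2+\|\varphi\|_2^2}+\phi(y)|y|,\qquad|K(x,y)|\le|y|.$$ Let $\varepsilon,\Gamma,\kappa,a,C>0$ be constants with $2\kappa>a$. Then every solution $(w,y,z)$ of the closed-loop system, where $w=(v,\varphi)\in C^0(\mathbb{R}_+;H_0^1(0,1)\times L^2(0,1))$ with $t\mapsto\Phi(w[t])$ locally absolutely continuous on $\mathbb{R}_+$ and $w\in L^1\left((0,T);(H^2(0,1)\cap H_0^1(0,1))\times H_0^1(0,1)\right)$ for each $T>0$, $z\in C^1(\mathbb{R}_+)$, and $y\in C^0(\mathbb{R}_+)$ is locally absolutely continuous, that corresponds to some $d\in L^\infty(\mathbb{R}_+)$, $\theta_1\in L^\infty(\mathbb{R}_+;L^2(0,1))$,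 $\theta_2\in L^\infty(\mathbb{R}_+)$, $\delta\in L^\infty(\mathbb{R}_+;L^2(0,1))$, $b\in L^\infty(\mathbb{R}_+;(0,+\infty))$ with $\inf_{t\ge0}(b(t))>0$ (i.e., for which the closed-loop equations hold for almost every $t\ge0$), satisfies for all $t\ge0$: $$2k_1\|w[t]\|^2+|y(t)|^2\le\exp(-\mu t)\left(2k_2\|w[0]\|^2+|y(0)|^2\right)+2\mu^{-1}Z,$$ $$z(0)\le z(t)\le\ln\left(\exp(z(0))+\frac{\Gamma}{4C}|y(0)|^2+aB\,\frac{2C(1+\exp(z(0)))+\varepsilon\Gamma}{4C^2\varepsilon\min(1,\kappa)(1+\exp(z(0)))}\right),$$ $$\limsup_{t\to+\infty}\|w[t]\|\le\sqrt{\frac{k_2}{k_1}\left(2\varepsilon R^2\Big(\limsup_{t\to+\infty}\|\theta_1[t]\|_2\Big)^2+G\Big(\limsup_{t\to+\infty}\|\delta[t]\|_2\Big)^2\right)},\qquad\limsup_{t\to+\infty}|y(t)|\le\sqrt{2\varepsilon},$$ where $$k_1=\frac1\sigma,\quad k_2=\frac1\sigma\max\left(c^2+1+\frac{2\sigma^2}{c^2\pi^2},\,1+\frac2{c^2}\right),\quad G=2\,\frac{(c^2+1)^2\pi^2+\sigma^2}{\sigma^2c^4\pi^2},\quad R=\sqrt{G},\quad\mu=\min\left(\frac{2\kappa-a}{2\kappa k_2},2C\right),$$ $$Z=G\|\delta\|_\infty^2+\frac{a}{\kappa+\exp(z(0))}\left(\|d\|_\infty^2+g(\|\theta_2\|_\infty,z(0))+g^2(\|\theta_2\|_\infty,z(0))+4\beta\,g(1/\beta,z(0))+g^2(R\|\theta_1\|_\infty,z(0))\right),$$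 $$B=\frac{1}{2k_1}\left(k_2\|w[0]\|^2+\frac12|y(0)|^2+\mu^{-1}Z\right)+g(\|\theta_2\|_\infty,z(0))+\|d\|_\infty^2+g^2(\|\theta_2\|_\infty,z(0))+2\beta\,g(1/\beta,z(0)),$$ with $\beta=\inf_{s\ge0}(b(s))$ and $g(s,l)=\left((s-\kappa-\exp(l))^+\right)^2$. Finally, if $\lim_{t\to+\infty}d(t)=0$, $\lim_{t\to+\infty}\delta[t]=0$ and $\liminf_{t\to+\infty}b(t)\ge1/\kappa$, then one of the following holds: either $\lim_{t\to+\infty}|y(t)|=\lim_{t\to+\infty}\|v_x[t]\|_2=\lim_{t\to+\infty}\|\varphi[t]\|_2=0$, or $$\kappa+\exp\Big(\lim_{s\to+\infty}z(s)\Big)<\limsup_{t\to+\infty}\left(\max\left(\sqrt{2\,\frac{(c^2+1)^2\pi^2+\sigma^2}{\sigma^2c^4\pi^2}}\,\|\theta_1[t]\|_2,\,|\theta_2(t)|\right)\right).$$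
   Context: Notation: $\mathbb{R}_+=[0,+\infty)$; $s^+=\max(s,0)$; $\|\cdot\|_2$ is the norm of $L^2(0,1)$; for $w=(v,\varphi)\in X=H_0^1(0,1)\times L^2(0,1)$, $\|w\|=\sqrt{\|v_x\|_2^2+\|\varphi\|_2^2}$; $\|\cdot\|_\infty$ is the essential supremum over $\mathbb{R}_+$ of the norm (absolute value or $L^2(0,1)$ norm) of the function; $v[t]$ denotes the profile $x\mapsto v(t,x)$ (similarly for other functions); $(v_t,\varphi_t)$ is the derivative of $t\mapsto w[t]=(v[t],\varphi[t])$ as an $X$-valued map. For $w=(v,\varphi)\in X$, $$\Phi(w)=\frac{c^2+1}{\sigma}\|v_x\|_2^2+\frac1\sigma\|\varphi\|_2^2+\frac{1}{\sigma c^2}\|\varphi+\sigma v\|_2^2.$$ Setting: $y(t)\in\mathbb{R}$, $v[t]$, $\varphi[t]$ are state components, $u(t)\in\mathbb{R}$ is the control input, $d(t)\in\mathbb{R}$ and $\delta[t]\in L^2(0,1)$ are disturbances, $\theta_1[t]\in L^2(0,1)$, $\theta_2(t)\in\mathbb{R}$, $b(t)>0$ are time-varying parameters, $c,\sigma>0$ are constants, $K:[0,1]\times\mathbb{R}\to\mathbb{R}$ is a function, $L:(H^2(0,1)\cap H_0^1(0,1))\times H_0^1(0,1)\times\mathbb{R}\to\mathbb{R}$ is a functional (written $L(w,y)$ with $w=(v,\varphi)$), and $\phi\in C^\infty(\mathbb{R};\mathbb{R}_+)$ (a function of $y$, not to be confused with the state $\varphi$). Controller functions: $P_1,P_2,P_3\in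 C^\infty(\mathbb{R})$ satisfy for all $y\in\mathbb{R}$ $$P_1(y)\ge\frac{1}{4a\kappa^6}\left(\kappa+4aC+4\kappa^3+4a\kappa\phi(y)+8a\kappa^2\right),$$ $$P_2(y)\ge\frac{1}{4a^3\kappa^5}\left(\frac{1}{16\kappa}\left(\kappa+4aC+4\kappa^3+4a\kappa\phi(y)\right)^2+\kappa^2+a^2\phi^2(y)+4a^2(\kappa^3+1)\right),$$ $$P_3(y)\ge\frac{1}{64a^7\kappa^4}\left(\left(\kappa^2+a^2\phi^2(y)\right)^2+16a^4\right).$$ *)

theory Defs
  imports "HOL-Analysis.Analysis" "HOL-Probability.Essential_Supremum"
begin

section \<open>The Lebesgue space \<open>L\<^sup>2(0,1)\<close>\<close>

abbreviation unit_leb :: "real measure" where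
  "unit_leb \<equiv> lebesgue_on {0<..<1}"

definition square_integrable :: "(real \<Rightarrow> real) \<Rightarrow> bool" where
  "square_integrable f \<longleftrightarrow> f \<in> borel_measurable unit_leb \<and> integrable unit_leb (\<lambda>x. (f x)\<^sup>2)"

lemma square_integrable_mult:
  assumes "square_integrable f" "square_integrable g"
  shows "integrable unit_leb (\<lambda>x. f x * g x)"
proof (rule Bochner_Integration.integrable_bound)
  show "integrable unit_leb (\<lambda>x. (f x)\<^sup>2 + (g x)\<^sup>2)"
    using assms by (auto simp: square_integrable_def)
  show "(\<lambda>x. f x * g x) \<in> borel_measurable unit_leb"
    using assms by (auto simp: square_integrable_def)
  have "\<bar>a * b\<bar> \<le> a\<^sup>2 + b\<^sup>2" for a b :: real
  proof -
    have "2 * \<bar>a\<bar> * \<bar>b\<bar> \<le> a\<^sup>2 + b\<^sup>2"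
      using sum_squares_bound[of "\<bar>a\<bar>" "\<bar>b\<bar>"] by simp
    moreover have "0 \<le> \<bar>a\<bar> * \<bar>b\<bar>" by simp
    ultimately show ?thesis unfolding abs_mult by linarith
  qed
  then show "AE x in unit_leb. norm (f x * g x) \<le> norm ((f x)\<^sup>2 + (g x)\<^sup>2)"
    by auto
qed

lemma square_integrable_add:
  assumes "square_integrable f" "square_integrable g"
  shows "square_integrable (\<lambda>x. f x + g x)"
proof -
  have "integrable unit_leb (\<lambda>x. (f x)\<^sup>2 + (g x)\<^sup>2 + 2 * (f x * g x))"
    using assms square_integrable_mult[OF assms] by (auto simp: square_integrable_def)
  then show ?thesis
    using assms by (auto simp: square_integrable_def power2_sum algebra_simps)
qed

lemma square_integrable_scale:
  "square_integrable f \<Longrightarrow> square_integrable (\<lambda>x. r * f x)"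
  by (auto simp: square_integrable_def power_mult_distrib)

quotient_type l2 = "real \<Rightarrow> real" / partial:
  "\<lambda>f g. square_integrable f \<and> square_integrable g \<and> (AE x in unit_leb. f x = g x)"
proof (rule part_equivpI)
  show "\<exists>f. square_integrable f \<and> square_integrable f \<and> (AE x in unit_leb. f x = f x)"
    by (rule exI[of _ "\<lambda>_. 0"]) (auto simp: square_integrable_def)
  show "symp (\<lambda>f g. square_integrable f \<and> square_integrable g \<and> (AE x in unit_leb. f x = g x))"
    by (auto simp: symp_def eq_commute)
  show "transp (\<lambda>f g. square_integrable f \<and> square_integrable g \<and> (AE x in unit_leb. f x = g x))"
    by (auto simp: transp_def elim: eventually_elim2)
qed

instantiation l2 :: real_inner
begin

lift_definition zero_l2 :: l2 is "\<lambda>_. 0"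
  by (auto simp: square_integrable_def)

lift_definition plus_l2 :: "l2 \<Rightarrow> l2 \<Rightarrow> l2" is "\<lambda>f g x. f x + g x"
  by (auto intro: square_integrable_add elim!: eventually_elim2)

lift_definition scaleR_l2 :: "real \<Rightarrow> l2 \<Rightarrow> l2" is "\<lambda>r f x. r * f x"
  by (auto intro: square_integrable_scale elim!: eventually_mono)

lift_definition inner_l2 :: "l2 \<Rightarrow> l2 \<Rightarrow> real" is "\<lambda>f g. \<integral>x. f x * g x \<partial>unit_leb"
proof -
  fix f f' g g' :: "real \<Rightarrow> real"
  assume "square_integrable f \<and> square_integrable f' \<and> (AE x in unit_leb. f x = f' x)"
    and "square_integrable g \<and> square_integrable g' \<and> (AE x in unit_leb. g x = g' x)"
  then show "(\<integral>x. f x * g x \<partial>unit_leb) = (\<integral>x. f' x * g' x \<partial>unit_leb)"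
    by (intro integral_cong_AE) (auto simp: square_integrable_def)
qed

definition uminus_l2 :: "l2 \<Rightarrow> l2" where "uminus_l2 f = (- 1) *\<^sub>R f"
definition minus_l2 :: "l2 \<Rightarrow> l2 \<Rightarrow> l2" where "minus_l2 f g = f + (- g)"
definition norm_l2 :: "l2 \<Rightarrow> real" where "norm_l2 f = sqrt (inner f f)"
definition dist_l2 :: "l2 \<Rightarrow> l2 \<Rightarrow> real" where "dist_l2 f g = norm (f - g)"
definition sgn_l2 :: "l2 \<Rightarrow> l2" where "sgn_l2 f = inverse (norm f) *\<^sub>R f"
definition uniformity_l2 :: "(l2 \<times> l2) filter" where
  "uniformity_l2 = (INF e\<in>{0<..}. principal {(x, y). dist x y < e})"
definition open_l2 :: "l2 set \<Rightarrow> bool" where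
  "open_l2 U = (\<forall>x\<in>U. \<forall>\<^sub>F (x', y) in uniformity. x' = x \<longrightarrow> y \<in> U)"

instance
proof
  fix a b c :: l2 and r s :: real
  show "a + b + c = a + (b + c)"
    by transfer (auto intro!: square_integrable_add simp: algebra_simps)
  show "a + b = b + a"
    by transfer (auto intro!: square_integrable_add simp: algebra_simps)
  show "0 + a = a"
    by transfer auto
  show "- a + a = 0"
    unfolding uminus_l2_def
    by transfer (auto simp: square_integrable_def)
  show "a - b = a + - b"
    by (rule minus_l2_def)
  show "r *\<^sub>R (a + b) = r *\<^sub>R a + r *\<^sub>R b"
    by transfer (auto intro!: square_integrable_add square_integrable_scale simp: algebra_simps)
  show "(r + s) *\<^sub>R a = r *\<^sub>R a + s *\<^sub>R a"
    by transfer
      (use square_integrable_add square_integrable_scale in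
        \<open>fastforce intro!: square_integrable_add square_integrable_scale simp: distrib_right\<close>)
  show "r *\<^sub>R s *\<^sub>R a = (r * s) *\<^sub>R a"
    by transfer (use square_integrable_scale in \<open>auto intro!: square_integrable_scale simp: mult.assoc\<close>)
  show "1 *\<^sub>R a = a"
    by transfer auto
  show "dist a b = norm (a - b)" by (rule dist_l2_def)
  show "sgn a = inverse (norm a) *\<^sub>R a" by (rule sgn_l2_def)
  show "uniformity = (INF e\<in>{0<..}. principal {(x, y :: l2). dist x y < e})"
    by (rule uniformity_l2_def)
  show "open U = (\<forall>x\<in>U. \<forall>\<^sub>F (x', y) in uniformity. x' = x \<longrightarrow> y \<in> U)" for U :: "l2 set"
    by (rule open_l2_def)
  show "inner a b = inner b a"
    by transfer (auto simp: mult.commute)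
  show "inner (a + b) c = inner a c + inner b c"
    by transfer (auto simp: distrib_right square_integrable_mult)
  show "inner (r *\<^sub>R a) b = r * inner a b"
    by transfer (auto simp: mult.assoc)
  show "0 \<le> inner a a"
    by transfer auto
  show "(inner a a = 0) = (a = 0)"
  proof transfer
    fix f assume *: "square_integrable f \<and> square_integrable f \<and> (AE x in unit_leb. f x = f x)"
    have "(\<integral>x. f x * f x \<partial>unit_leb) = 0 \<longleftrightarrow> (AE x in unit_leb. f x * f x = 0)"
      using * by (intro integral_nonneg_eq_0_iff_AE square_integrable_mult) auto
    then show "((\<integral>x. f x * f x \<partial>unit_leb) = 0) =
        (square_integrable f \<and> square_integrable (\<lambda>_. 0) \<and> (AE x in unit_leb. f x = 0))"
      using * by (auto simp: square_integrable_def)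
  qed
  show "norm a = sqrt (inner a a)" by (rule norm_l2_def)
qed

end


section \<open>Test functions and Sobolev spaces\<close>

definition smooth :: "(real \<Rightarrow> real) \<Rightarrow> bool" where
  "smooth f \<longleftrightarrow> (\<forall>k x. (deriv ^^ k) f field_differentiable at x)"

definition test_functions :: "(real \<Rightarrow> real) set" where
  "test_functions = {\<psi>. smooth \<psi> \<and> closure {x. \<psi> x \<noteq> 0} \<subseteq> {0<..<1}}"

lemma smooth_zero: "smooth (\<lambda>_. 0)"
proof -
  have "(deriv ^^ k) (\<lambda>_. 0 :: real) = (\<lambda>_. 0)" for k
    by (induction k) auto
  then show ?thesis by (auto simp: smooth_def)
qed

lemma higher_deriv_add_real:
  "smooth f \<Longrightarrow> smooth g \<Longrightarrow>
    (deriv ^^ k) (\<lambda>x. f x + g x) = (\<lambda>x. (deriv ^^ k) f x + (deriv ^^ k) g x)"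
proof (induction k)
  case (Suc k)
  then show ?case
    by (auto simp: smooth_def intro!: ext deriv_add)
qed auto

lemma higher_deriv_scale_real:
  "smooth f \<Longrightarrow> (deriv ^^ k) (\<lambda>x. r * f x) = (\<lambda>x. r * (deriv ^^ k) f x)"
proof (induction k)
  case (Suc k)
  then show ?case
    by (auto simp: smooth_def intro!: ext deriv_cmult)
qed auto

lemma smooth_add: "smooth f \<Longrightarrow> smooth g \<Longrightarrow> smooth (\<lambda>x. f x + g x)"
  unfolding smooth_def[of "\<lambda>x. f x + g x"]
  by (auto simp: higher_deriv_add_real smooth_def intro!: field_differentiable_add)

lemma smooth_scale: "smooth f \<Longrightarrow> smooth (\<lambda>x. r * f x)"
  unfolding smooth_def[of "\<lambda>x. r * f x"]
  by (auto simp: higher_deriv_scale_real smooth_def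
      intro!: field_differentiable_mult field_differentiable_const)

lemma smooth_D:
  assumes "smooth f"
  shows "(f has_field_derivative deriv f x) (at x)" "isCont f x" "isCont (deriv f) x"
proof -
  have "(deriv ^^ 0) f field_differentiable at x" "(deriv ^^ 1) f field_differentiable at x"
    using assms unfolding smooth_def by blast+
  then have 1: "f field_differentiable at x" "deriv f field_differentiable at x"
    by auto
  show "(f has_field_derivative deriv f x) (at x)"
    using 1 by (simp add: field_differentiable_derivI)
  show "isCont f x" "isCont (deriv f) x"
    using 1 field_differentiable_imp_continuous_at by blast+
qed

lemma smooth_square_integrable:
  assumes "\<And>x. isCont f x"
  shows "square_integrable f"
proof -
  have c: "continuous_on A f" for A
    using assms continuous_at_imp_continuous_on by blast
  have "integrable (lebesgue_on {0..1}) (\<lambda>x. (f x)\<^sup>2)"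
    by (intro continuous_imp_integrable_real continuous_intros c)
  then have "set_integrable lebesgue {0..1} (\<lambda>x. (f x)\<^sup>2)"
    by (simp add: integrable_restrict_space set_integrable_def)
  then have "set_integrable lebesgue {0<..<1} (\<lambda>x. (f x)\<^sup>2)"
    by (rule set_integrable_subset) auto
  then have "integrable unit_leb (\<lambda>x. (f x)\<^sup>2)"
    by (simp add: integrable_restrict_space set_integrable_def)
  then show ?thesis
    using c by (auto simp: square_integrable_def intro!: continuous_imp_measurable_on_sets_lebesgue)
qed

lemma test_functions_zero: "(\<lambda>_. 0) \<in> test_functions"
  by (auto simp: test_functions_def smooth_zero)

lemma test_functions_add:
  assumes "f \<in> test_functions" "g \<in> test_functions"
  shows "(\<lambda>x. f x + g x) \<in> test_functions"
proof -
  have "{x. f x + g x \<noteq> 0} \<subseteq> {x. f x \<noteq> 0} \<union> {x. g x \<noteq> 0}" by auto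
  then have "closure {x. f x + g x \<noteq> 0} \<subseteq> closure {x. f x \<noteq> 0} \<union> closure {x. g x \<noteq> 0}"
    by (metis closure_Un closure_mono)
  then show ?thesis
    using assms by (auto simp: test_functions_def smooth_add)
qed

lemma test_functions_scale:
  assumes "f \<in> test_functions"
  shows "(\<lambda>x. r * f x) \<in> test_functions"
proof -
  have "{x. r * f x \<noteq> 0} \<subseteq> {x. f x \<noteq> 0}" by auto
  then have "closure {x. r * f x \<noteq> 0} \<subseteq> closure {x. f x \<noteq> 0}"
    by (rule closure_mono)
  then show ?thesis
    using assms by (auto simp: test_functions_def smooth_scale)
qed

definition has_weak_deriv :: "l2 \<Rightarrow> l2 \<Rightarrow> bool" where
  "has_weak_deriv f g \<longleftrightarrow>
    (\<forall>\<psi>\<in>test_functions. inner f (abs_l2 (deriv \<psi>)) = - inner g (abs_l2 \<psi>))"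

text \<open>
  An element \<open>v\<close> of the space \<open>H\<^sup>1\<^sub>0(0,1)\<close>, the closure of the test functions in \<open>H\<^sup>1(0,1)\<close>, is
  represented by the pair \<open>(v, v\<^sub>x)\<close>; the second component is determined by the first one,
  because weak derivatives are unique.
\<close>

definition test_graph :: "(l2 \<times> l2) set" where
  "test_graph = (\<lambda>\<psi>. (abs_l2 \<psi>, abs_l2 (deriv \<psi>))) ` test_functions"

lemma abs_l2_add:
  "square_integrable f \<Longrightarrow> square_integrable g \<Longrightarrow> abs_l2 (\<lambda>x. f x + g x) = abs_l2 f + abs_l2 g"
  by (simp add: plus_l2.abs_eq)

lemma abs_l2_scale:
  "square_integrable f \<Longrightarrow> abs_l2 (\<lambda>x. r * f x) = r *\<^sub>R abs_l2 f"
  by (simp add: scaleR_l2.abs_eq)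

lemma test_functions_square_integrable:
  assumes "f \<in> test_functions"
  shows "square_integrable f" "square_integrable (deriv f)"
  using assms smooth_D by (auto simp: test_functions_def intro!: smooth_square_integrable)

lemma subspace_test_graph: "subspace test_graph"
proof (rule subspaceI)
  have "(0, 0) = (abs_l2 (\<lambda>_. 0), abs_l2 (deriv (\<lambda>_. 0)))"
    by (simp add: zero_l2_def)
  then show "0 \<in> test_graph"
    unfolding test_graph_def zero_prod_def using test_functions_zero by (rule image_eqI)
next
  fix p q assume "p \<in> test_graph" "q \<in> test_graph"
  then obtain f g where f: "f \<in> test_functions" "p = (abs_l2 f, abs_l2 (deriv f))"
    and g: "g \<in> test_functions" "q = (abs_l2 g, abs_l2 (deriv g))"
    by (auto simp: test_graph_def)
  have "deriv (\<lambda>x. f x + g x) = (\<lambda>x. deriv f x + deriv g x)"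
    using higher_deriv_add_real[of f g 1] f(1) g(1) by (simp add: test_functions_def)
  then have "p + q = (abs_l2 (\<lambda>x. f x + g x), abs_l2 (deriv (\<lambda>x. f x + g x)))"
    using f g by (simp add: abs_l2_add test_functions_square_integrable)
  then show "p + q \<in> test_graph"
    unfolding test_graph_def using test_functions_add[OF f(1) g(1)] by (rule image_eqI)
next
  fix c p assume "p \<in> test_graph"
  then obtain f where f: "f \<in> test_functions" "p = (abs_l2 f, abs_l2 (deriv f))"
    by (auto simp: test_graph_def)
  have "deriv (\<lambda>x. c * f x) = (\<lambda>x. c * deriv f x)"
    using higher_deriv_scale_real[of f 1 c] f(1) by (simp add: test_functions_def)
  then have "c *\<^sub>R p = (abs_l2 (\<lambda>x. c * f x), abs_l2 (deriv (\<lambda>x. c * f x)))"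
    using f by (simp add: abs_l2_scale test_functions_square_integrable)
  then show "c *\<^sub>R p \<in> test_graph"
    unfolding test_graph_def using test_functions_scale[OF f(1)] by (rule image_eqI)
qed

lemma subspace_closure_normed:
  fixes S :: "'a::real_normed_vector set"
  assumes "subspace S"
  shows "subspace (closure S)"
proof (rule subspaceI)
  show "0 \<in> closure S"
    using assms closure_subset subspace_0 by blast
next
  fix x y assume "x \<in> closure S" "y \<in> closure S"
  then obtain f g where "\<forall>n. f n \<in> S" "f \<longlonglongrightarrow> x" "\<forall>n. g n \<in> S" "g \<longlonglongrightarrow> y"
    by (auto simp: closure_sequential)
  then show "x + y \<in> closure S"
    unfolding closure_sequential
    by (intro exI[of _ "\<lambda>n. f n + g n"]) (auto intro: tendsto_add subspace_add assms)
next
  fix c x assume "x \<in> closure S"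
  then obtain f where "\<forall>n. f n \<in> S" "f \<longlonglongrightarrow> x"
    by (auto simp: closure_sequential)
  then show "c *\<^sub>R x \<in> closure S"
    unfolding closure_sequential
    by (intro exI[of _ "\<lambda>n. c *\<^sub>R f n"]) (auto intro: tendsto_scaleR subspace_scale assms)
qed

lemma subspace_H01: "subspace (closure test_graph)"
  by (rule subspace_closure_normed[OF subspace_test_graph])

lemma test_functions_boundary:
  assumes "f \<in> test_functions"
  shows "f 0 = 0" "f 1 = 0"
proof -
  have "{x. f x \<noteq> 0} \<subseteq> {0<..<1}"
    using assms closure_subset[of "{x. f x \<noteq> 0}"] unfolding test_functions_def by blast
  then have "\<not> f 0 \<noteq> 0" "\<not> f 1 \<noteq> 0"
    by fastforce+
  then show "f 0 = 0" "f 1 = 0" by simp_all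
qed

lemma test_function_bound:
  assumes "f \<in> test_functions" "x \<in> {0<..<1}"
  shows "\<bar>f x\<bar> \<le> norm (abs_l2 (deriv f))"
proof -
  let ?h = "indicator {0..x} :: real \<Rightarrow> real"
  have sm: "smooth f"
    using assms(1) by (simp add: test_functions_def)
  note f0 = test_functions_boundary(1)[OF assms(1)]
  have sq: "square_integrable (deriv f)"
    by (rule test_functions_square_integrable[OF assms(1)])
  have sqh: "square_integrable ?h"
    unfolding square_integrable_def
  proof
    show m: "?h \<in> borel_measurable unit_leb" by (intro measurable_restrict_space1 borel_measurable_indicator) simp
    show "integrable unit_leb (\<lambda>x. (?h x)\<^sup>2)"
      by (rule finite_measure.integrable_const_bound[OF finite_measure_lebesgue_on, of _ _ 1])
        (auto intro!: borel_measurable_power m simp: power_le_one_iff indicator_le_1)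
  qed
  have "(f has_vector_derivative deriv f y) (at y within {0..x})" for y
    using has_field_derivative_at_within[OF smooth_D(1)[OF sm]]
    unfolding has_real_derivative_iff_has_vector_derivative .
  then have "(deriv f has_integral (f x - f 0)) {0..x}"
    using assms(2) by (intro fundamental_theorem_of_calculus) simp_all
  moreover have "{0..x} - {0..x} \<inter> {0<..<1} \<subseteq> {0}"
    using assms(2) by auto
  then have "negligible ({0..x} - {0..x} \<inter> {0<..<1})"
    by (rule negligible_subset[OF negligible_sing])
  then have "negligible {y \<in> {0..x} - {0..x} \<inter> {0<..<1}. deriv f y \<noteq> 0}"
    by (rule negligible_subset) blast
  moreover have "{y \<in> {0..x} \<inter> {0<..<1} - {0..x}. deriv f y \<noteq> 0} = {}"
    by blast
  ultimately have "(deriv f has_integral f x) ({0..x} \<inter> {0<..<1})"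
    using has_integral_spike_set_eq[of "{0..x}" "{0..x} \<inter> {0<..<1}" "deriv f" "f x"] f0
    by (simp only: negligible_empty diff_zero simp_thms)
  then have "((\<lambda>y. if y \<in> {0..x} then deriv f y else 0) has_integral f x) {0<..<1}"
    by (simp only: has_integral_restrict_Int)
  moreover have "(\<lambda>y. if y \<in> {0..x} then deriv f y else 0) = (\<lambda>y. deriv f y * ?h y)"
    by auto
  moreover have "((\<lambda>y. deriv f y * ?h y) has_integral inner (abs_l2 (deriv f)) (abs_l2 ?h)) {0<..<1}"
    using has_integral_integral_lebesgue_on[OF square_integrable_mult[OF sq sqh]] sq sqh
    by (simp add: inner_l2.abs_eq)
  ultimately have "f x = inner (abs_l2 (deriv f)) (abs_l2 ?h)"
    by (metis has_integral_unique)
  also have "\<bar>\<dots>\<bar> \<le> norm (abs_l2 (deriv f)) * norm (abs_l2 ?h)"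
    by (rule Cauchy_Schwarz_ineq2)
  also have "\<dots> \<le> norm (abs_l2 (deriv f)) * 1"
  proof (rule mult_left_mono)
    have "(\<integral>y. ?h y * ?h y \<partial>unit_leb) \<le> (\<integral>y. 1 \<partial>unit_leb)"
      by (intro integral_mono square_integrable_mult sqh
          finite_measure.integrable_const[OF finite_measure_lebesgue_on]) (auto simp: indicator_def)
    also have "\<dots> = 1" by (simp add: measure_restrict_space)
    finally show "norm (abs_l2 ?h) \<le> 1"
      using sqh by (simp add: norm_l2_def inner_l2.abs_eq)
  qed simp
  finally show ?thesis by simp
qed

lemma test_function_norm_bound:
  assumes "f \<in> test_functions"
  shows "norm (abs_l2 f) \<le> norm (abs_l2 (deriv f))"
proof -
  let ?C = "norm (abs_l2 (deriv f))"
  have sq: "square_integrable f"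
    by (rule test_functions_square_integrable[OF assms])
  have "f x * f x \<le> ?C\<^sup>2" if "x \<in> {0<..<1}" for x
    using test_function_bound[OF assms that]
    using power_mono[of "\<bar>f x\<bar>" ?C 2] by (simp add: power2_eq_square)
  then have "(\<integral>x. f x * f x \<partial>unit_leb) \<le> (\<integral>x. ?C\<^sup>2 \<partial>unit_leb)"
    by (intro integral_mono square_integrable_mult sq
        finite_measure.integrable_const[OF finite_measure_lebesgue_on]) auto
  also have "\<dots> = ?C\<^sup>2" by (simp add: measure_restrict_space)
  finally have "(norm (abs_l2 f))\<^sup>2 \<le> ?C\<^sup>2"
    using sq by (simp add: power2_norm_eq_inner[of "abs_l2 f"] inner_l2.abs_eq)
  then show ?thesis
    by (rule power2_le_imp_le) simp
qed

lemma test_functions_parts: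
  assumes "f \<in> test_functions" "g \<in> test_functions"
  shows "inner (abs_l2 f) (abs_l2 (deriv g)) = - inner (abs_l2 (deriv f)) (abs_l2 g)"
proof -
  note sq = assms[THEN test_functions_square_integrable(1)]
    assms[THEN test_functions_square_integrable(2)]
  have sm: "smooth f" "smooth g"
    using assms by (auto simp: test_functions_def)
  have "((\<lambda>x. f x * g x) has_field_derivative f x * deriv g x + deriv f x * g x) (at x)" for x
    by (rule derivative_eq_intros smooth_D(1) sm refl | simp)+
  then have "((\<lambda>x. f x * g x) has_vector_derivative f x * deriv g x + deriv f x * g x)
      (at x within {0..1})" for x
    unfolding has_real_derivative_iff_has_vector_derivative[symmetric]
    by (rule has_field_derivative_at_within)
  then have "((\<lambda>x. f x * deriv g x + deriv f x * g x) has_integral f 1 * g 1 - f 0 * g 0) {0..1}"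
    by (intro fundamental_theorem_of_calculus) simp_all
  then have "((\<lambda>x. f x * deriv g x + deriv f x * g x) has_integral 0) {0<..<1}"
    using test_functions_boundary[OF assms(1)] by (simp add: has_integral_Icc_iff_Ioo)
  moreover have "((\<lambda>x. f x * deriv g x + deriv f x * g x) has_integral
      inner (abs_l2 f) (abs_l2 (deriv g)) + inner (abs_l2 (deriv f)) (abs_l2 g)) {0<..<1}"
    using has_integral_add[OF
        has_integral_integral_lebesgue_on[OF square_integrable_mult[OF sq(1) sq(4)]]
        has_integral_integral_lebesgue_on[OF square_integrable_mult[OF sq(3) sq(2)]]] sq
    by (simp add: inner_l2.abs_eq)
  ultimately have "inner (abs_l2 f) (abs_l2 (deriv g)) + inner (abs_l2 (deriv f)) (abs_l2 g) = 0"
    by (rule has_integral_unique[rotated])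
  then show ?thesis by linarith
qed

lemma H01_bound:
  assumes "p \<in> closure test_graph"
  shows "norm (fst p) \<le> norm (snd p)"
proof -
  have "closed {p :: l2 \<times> l2. norm (fst p) \<le> norm (snd p)}"
    by (intro closed_Collect_le continuous_intros)
  moreover have "test_graph \<subseteq> {p. norm (fst p) \<le> norm (snd p)}"
    by (auto simp: test_graph_def test_function_norm_bound)
  ultimately have "closure test_graph \<subseteq> {p. norm (fst p) \<le> norm (snd p)}"
    by (intro closure_minimal)
  then show ?thesis
    using assms by auto
qed

typedef h01 = "closure test_graph"
  using subspace_0[OF subspace_H01] by blast

definition h01_l2 :: "h01 \<Rightarrow> l2" where "h01_l2 v = fst (Rep_h01 v)"
definition h01_dx :: "h01 \<Rightarrow> l2" where "h01_dx v = snd (Rep_h01 v)"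

lemma h01_has_weak_deriv: "has_weak_deriv (h01_l2 v) (h01_dx v)"
  unfolding has_weak_deriv_def
proof
  fix \<psi> assume \<psi>: "\<psi> \<in> test_functions"
  let ?S = "{p. inner (fst p) (abs_l2 (deriv \<psi>)) = - inner (snd p) (abs_l2 \<psi>)}"
  have "closed ?S"
    by (intro closed_Collect_eq continuous_intros)
  moreover have "test_graph \<subseteq> ?S"
    by (auto simp: test_graph_def test_functions_parts[OF _ \<psi>])
  ultimately have "closure test_graph \<subseteq> ?S"
    by (intro closure_minimal)
  then show "inner (h01_l2 v) (abs_l2 (deriv \<psi>)) = - inner (h01_dx v) (abs_l2 \<psi>)"
    using Rep_h01[of v] by (auto simp: h01_l2_def h01_dx_def)
qed

instantiation h01 :: real_inner
begin

definition zero_h01 :: h01 where "zero_h01 = Abs_h01 0"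
definition plus_h01 :: "h01 \<Rightarrow> h01 \<Rightarrow> h01" where
  "plus_h01 u v = Abs_h01 (Rep_h01 u + Rep_h01 v)"
definition scaleR_h01 :: "real \<Rightarrow> h01 \<Rightarrow> h01" where
  "scaleR_h01 r v = Abs_h01 (r *\<^sub>R Rep_h01 v)"
definition inner_h01 :: "h01 \<Rightarrow> h01 \<Rightarrow> real" where
  "inner_h01 u v = inner (h01_dx u) (h01_dx v)"
definition uminus_h01 :: "h01 \<Rightarrow> h01" where "uminus_h01 u = (- 1) *\<^sub>R u"
definition minus_h01 :: "h01 \<Rightarrow> h01 \<Rightarrow> h01" where "minus_h01 u v = u + (- v)"
definition norm_h01 :: "h01 \<Rightarrow> real" where "norm_h01 u = sqrt (inner u u)"
definition dist_h01 :: "h01 \<Rightarrow> h01 \<Rightarrow> real" where "dist_h01 u v = norm (u - v)"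
definition sgn_h01 :: "h01 \<Rightarrow> h01" where "sgn_h01 u = inverse (norm u) *\<^sub>R u"
definition uniformity_h01 :: "(h01 \<times> h01) filter" where
  "uniformity_h01 = (INF e\<in>{0<..}. principal {(x, y). dist x y < e})"
definition open_h01 :: "h01 set \<Rightarrow> bool" where
  "open_h01 U = (\<forall>x\<in>U. \<forall>\<^sub>F (x', y) in uniformity. x' = x \<longrightarrow> y \<in> U)"

lemma Rep_h01_plus: "Rep_h01 (u + v) = Rep_h01 u + Rep_h01 v"
  unfolding plus_h01_def
  by (rule Abs_h01_inverse) (intro subspace_add[OF subspace_H01] Rep_h01)

lemma Rep_h01_scaleR: "Rep_h01 (r *\<^sub>R v) = r *\<^sub>R Rep_h01 v"
  unfolding scaleR_h01_def
  by (rule Abs_h01_inverse) (intro subspace_scale[OF subspace_H01] Rep_h01)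

lemma Rep_h01_zero: "Rep_h01 0 = 0"
  unfolding zero_h01_def
  by (rule Abs_h01_inverse) (rule subspace_0[OF subspace_H01])

instance
proof
  fix a b c :: h01 and r s :: real
  show "a + b + c = a + (b + c)" "a + b = b + a" "0 + a = a"
    by (simp_all add: Rep_h01_inject[symmetric] Rep_h01_plus Rep_h01_zero add_ac)
  show "- a + a = 0"
    by (simp add: uminus_h01_def Rep_h01_inject[symmetric] Rep_h01_plus Rep_h01_scaleR Rep_h01_zero)
  show "a - b = a + - b" by (rule minus_h01_def)
  show "r *\<^sub>R (a + b) = r *\<^sub>R a + r *\<^sub>R b" "(r + s) *\<^sub>R a = r *\<^sub>R a + s *\<^sub>R a"
    "r *\<^sub>R s *\<^sub>R a = (r * s) *\<^sub>R a" "1 *\<^sub>R a = a"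
    by (simp_all add: Rep_h01_inject[symmetric] Rep_h01_plus Rep_h01_scaleR algebra_simps)
  show "dist a b = norm (a - b)" by (rule dist_h01_def)
  show "sgn a = inverse (norm a) *\<^sub>R a" by (rule sgn_h01_def)
  show "uniformity = (INF e\<in>{0<..}. principal {(x, y :: h01). dist x y < e})"
    by (rule uniformity_h01_def)
  show "open U = (\<forall>x\<in>U. \<forall>\<^sub>F (x', y) in uniformity. x' = x \<longrightarrow> y \<in> U)" for U :: "h01 set"
    by (rule open_h01_def)
  show "inner a b = inner b a"
    by (simp add: inner_h01_def inner_commute)
  show "inner (a + b) c = inner a c + inner b c" "inner (r *\<^sub>R a) b = r * inner a b"
    "0 \<le> inner a a"
    by (simp_all add: inner_h01_def h01_dx_def Rep_h01_plus Rep_h01_scaleR inner_add_left)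
  show "(inner a a = 0) = (a = 0)"
    using H01_bound[OF Rep_h01[of a]]
    by (auto simp: inner_h01_def h01_dx_def Rep_h01_inject[symmetric] Rep_h01_zero prod_eq_iff)
  show "norm a = sqrt (inner a a)" by (rule norm_h01_def)
qed

end

lemma norm_h01_eq: "norm v = norm (h01_dx v)"
  by (simp add: norm_h01_def inner_h01_def norm_eq_sqrt_inner)

text \<open>The space \<open>H\<^sup>2(0,1) \<inter> H\<^sup>1\<^sub>0(0,1)\<close>: an element \<open>v\<close> is represented by the pair \<open>(v, v\<^sub>x\<^sub>x)\<close>.\<close>

typedef h2 = "{(v :: h01, g :: l2). has_weak_deriv (h01_dx v) g}"
proof
  show "(0, 0) \<in> {(v, g). has_weak_deriv (h01_dx v) g}"
    by (simp add: has_weak_deriv_def h01_dx_def Rep_h01_zero)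
qed

definition h2_h01 :: "h2 \<Rightarrow> h01" where "h2_h01 v = fst (Rep_h2 v)"
definition h2_dxx :: "h2 \<Rightarrow> l2" where "h2_dxx v = snd (Rep_h2 v)"

lemma subspace_H2: "subspace {(v :: h01, g :: l2). has_weak_deriv (h01_dx v) g}"
  by (rule subspaceI)
    (auto simp: has_weak_deriv_def h01_dx_def Rep_h01_zero Rep_h01_plus Rep_h01_scaleR
      inner_add_left zero_prod_def)

instantiation h2 :: real_inner
begin

definition zero_h2 :: h2 where "zero_h2 = Abs_h2 0"
definition plus_h2 :: "h2 \<Rightarrow> h2 \<Rightarrow> h2" where
  "plus_h2 u v = Abs_h2 (Rep_h2 u + Rep_h2 v)"
definition scaleR_h2 :: "real \<Rightarrow> h2 \<Rightarrow> h2" where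
  "scaleR_h2 r v = Abs_h2 (r *\<^sub>R Rep_h2 v)"
definition inner_h2 :: "h2 \<Rightarrow> h2 \<Rightarrow> real" where
  "inner_h2 u v = inner (h01_l2 (h2_h01 u)) (h01_l2 (h2_h01 v))
    + inner (h01_dx (h2_h01 u)) (h01_dx (h2_h01 v)) + inner (h2_dxx u) (h2_dxx v)"
definition uminus_h2 :: "h2 \<Rightarrow> h2" where "uminus_h2 u = (- 1) *\<^sub>R u"
definition minus_h2 :: "h2 \<Rightarrow> h2 \<Rightarrow> h2" where "minus_h2 u v = u + (- v)"
definition norm_h2 :: "h2 \<Rightarrow> real" where "norm_h2 u = sqrt (inner u u)"
definition dist_h2 :: "h2 \<Rightarrow> h2 \<Rightarrow> real" where "dist_h2 u v = norm (u - v)"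
definition sgn_h2 :: "h2 \<Rightarrow> h2" where "sgn_h2 u = inverse (norm u) *\<^sub>R u"
definition uniformity_h2 :: "(h2 \<times> h2) filter" where
  "uniformity_h2 = (INF e\<in>{0<..}. principal {(x, y). dist x y < e})"
definition open_h2 :: "h2 set \<Rightarrow> bool" where
  "open_h2 U = (\<forall>x\<in>U. \<forall>\<^sub>F (x', y) in uniformity. x' = x \<longrightarrow> y \<in> U)"

lemma Rep_h2_plus: "Rep_h2 (u + v) = Rep_h2 u + Rep_h2 v"
  unfolding plus_h2_def
  by (rule Abs_h2_inverse) (intro subspace_add[OF subspace_H2] Rep_h2)

lemma Rep_h2_scaleR: "Rep_h2 (r *\<^sub>R v) = r *\<^sub>R Rep_h2 v"
  unfolding scaleR_h2_def
  by (rule Abs_h2_inverse) (intro subspace_scale[OF subspace_H2] Rep_h2)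

lemma Rep_h2_zero: "Rep_h2 0 = 0"
  unfolding zero_h2_def
  by (rule Abs_h2_inverse) (rule subspace_0[OF subspace_H2])

instance
proof
  fix a b c :: h2 and r s :: real
  show "a + b + c = a + (b + c)" "a + b = b + a" "0 + a = a"
    by (simp_all add: Rep_h2_inject[symmetric] Rep_h2_plus Rep_h2_zero add_ac)
  show "- a + a = 0"
    by (simp add: uminus_h2_def Rep_h2_inject[symmetric] Rep_h2_plus Rep_h2_scaleR Rep_h2_zero)
  show "a - b = a + - b" by (rule minus_h2_def)
  show "r *\<^sub>R (a + b) = r *\<^sub>R a + r *\<^sub>R b" "(r + s) *\<^sub>R a = r *\<^sub>R a + s *\<^sub>R a"
    "r *\<^sub>R s *\<^sub>R a = (r * s) *\<^sub>R a" "1 *\<^sub>R a = a"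
    by (simp_all add: Rep_h2_inject[symmetric] Rep_h2_plus Rep_h2_scaleR algebra_simps)
  show "dist a b = norm (a - b)" by (rule dist_h2_def)
  show "sgn a = inverse (norm a) *\<^sub>R a" by (rule sgn_h2_def)
  show "uniformity = (INF e\<in>{0<..}. principal {(x, y :: h2). dist x y < e})"
    by (rule uniformity_h2_def)
  show "open U = (\<forall>x\<in>U. \<forall>\<^sub>F (x', y) in uniformity. x' = x \<longrightarrow> y \<in> U)" for U :: "h2 set"
    by (rule open_h2_def)
  show "inner a b = inner b a"
    by (simp add: inner_h2_def inner_commute)
  show "inner (a + b) c = inner a c + inner b c" "inner (r *\<^sub>R a) b = r * inner a b"
    "0 \<le> inner a a"
    by (simp_all add: inner_h2_def h01_dx_def h01_l2_def h2_h01_def h2_dxx_def Rep_h2_plus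
        Rep_h2_scaleR Rep_h01_plus Rep_h01_scaleR inner_add_left distrib_left)
  show "(inner a a = 0) = (a = 0)"
    by (auto simp: inner_h2_def h01_dx_def h01_l2_def h2_h01_def h2_dxx_def
        Rep_h2_inject[symmetric] Rep_h2_zero Rep_h01_inject[symmetric] Rep_h01_zero prod_eq_iff
        add_nonneg_eq_0_iff)
  show "norm a = sqrt (inner a a)" by (rule norm_h2_def)
qed

end

section \<open>Functions of time\<close>

abbreviation time_leb :: "real measure" where
  "time_leb \<equiv> lebesgue_on {0..}"

text \<open>
  The spaces \<open>l2\<close>, \<open>h01\<close> and \<open>h2\<close> are separable, so Borel measurability of functions with values
  in them (or in products of them) is strong measurability.
\<close>

definition L_infinity :: "(real \<Rightarrow> 'a::real_normed_vector) \<Rightarrow> bool" where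
  "L_infinity f \<longleftrightarrow>
    f \<in> borel_measurable time_leb \<and> esssup time_leb (\<lambda>t. ereal (norm (f t))) < \<infinity>"

definition L_infinity_norm :: "(real \<Rightarrow> 'a::real_normed_vector) \<Rightarrow> real" where
  "L_infinity_norm f = real_of_ereal (esssup time_leb (\<lambda>t. ereal (norm (f t))))"

text \<open>
  The functions of time to which the following real-valued infimum and limits are applied belong to
  \<open>L\<^sup>\<infinity>\<close>, so the extended real values are finite.
\<close>

definition ess_inf :: "(real \<Rightarrow> real) \<Rightarrow> real" where
  "ess_inf f = real_of_ereal (Liminf (ae_filter time_leb) (\<lambda>t. ereal (f t)))"

text \<open>
  The filter describing limits \<open>t \<rightarrow> \<infinity>\<close> of functions that are given only up to null sets.
\<close>

definition ess_at_top :: "real filter" where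
  "ess_at_top = inf at_top (ae_filter lebesgue)"

definition ess_limsup :: "(real \<Rightarrow> real) \<Rightarrow> real" where
  "ess_limsup f = real_of_ereal (Limsup ess_at_top (\<lambda>t. ereal (f t)))"

definition ess_liminf :: "(real \<Rightarrow> real) \<Rightarrow> real" where
  "ess_liminf f = real_of_ereal (Liminf ess_at_top (\<lambda>t. ereal (f t)))"

definition loc_integrable :: "(real \<Rightarrow> 'a::real_normed_vector) \<Rightarrow> bool" where
  "loc_integrable f \<longleftrightarrow> (\<forall>T>0. f \<in> borel_measurable (lebesgue_on {0<..<T}) \<and>
    integrable (lebesgue_on {0<..<T}) (\<lambda>t. norm (f t)))"

definition abs_continuous_on :: "real \<Rightarrow> real \<Rightarrow> (real \<Rightarrow> real) \<Rightarrow> bool" where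
  "abs_continuous_on a b f \<longleftrightarrow>
    (\<forall>e>0. \<exists>d>0. \<forall>n :: nat. \<forall>p q :: nat \<Rightarrow> real.
      (\<forall>i<n. a \<le> p i \<and> p i \<le> q i \<and> q i \<le> b) \<and>
      disjoint_family_on (\<lambda>i. {p i<..<q i}) {..<n} \<and>
      (\<Sum>i<n. q i - p i) < d \<longrightarrow> (\<Sum>i<n. \<bar>f (q i) - f (p i)\<bar>) < e)"

definition loc_abs_continuous :: "(real \<Rightarrow> real) \<Rightarrow> bool" where
  "loc_abs_continuous f \<longleftrightarrow> (\<forall>T>0. abs_continuous_on 0 T f)"

definition C1 :: "(real \<Rightarrow> real) \<Rightarrow> bool" where
  "C1 f \<longleftrightarrow> (\<exists>f'. continuous_on {0..} f' \<and>
    (\<forall>t\<ge>0. (f has_real_derivative f' t) (at t within {0..})))"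

section \<open>The closed-loop system\<close>

type_synonym state = "h01 \<times> l2"

text \<open>The norm of the product type is \<open>\<parallel>w\<parallel>\<^sup>2 = \<parallel>v\<^sub>x\<parallel>\<^sup>2 + \<parallel>\<phi>\<parallel>\<^sup>2\<close>.\<close>

lemma norm_state: "norm (v, \<phi>) = sqrt ((norm (h01_dx v))\<^sup>2 + (norm \<phi>)\<^sup>2)" for v :: h01 and \<phi> :: l2
  by (simp add: norm_Pair norm_h01_eq)

definition Phi :: "real \<Rightarrow> real \<Rightarrow> state \<Rightarrow> real" where
  "Phi c \<sigma> = (\<lambda>(v, \<phi>). (c\<^sup>2 + 1) / \<sigma> * (norm (h01_dx v))\<^sup>2 + 1 / \<sigma> * (norm \<phi>)\<^sup>2
    + 1 / (\<sigma> * c\<^sup>2) * (norm (\<phi> + \<sigma> *\<^sub>R h01_l2 v))\<^sup>2)"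

definition feedback ::
  "real \<Rightarrow> (real \<Rightarrow> real) \<Rightarrow> (real \<Rightarrow> real) \<Rightarrow> (real \<Rightarrow> real) \<Rightarrow> real \<Rightarrow> real \<Rightarrow> real" where
  "feedback \<kappa> P1 P2 P3 y z = - ((\<kappa> + exp z) ^ 7 * (P1 y + P2 y * y\<^sup>2 + P3 y * y ^ 6) * y)"

text \<open>
  The last argument \<open>(v', \<phi>')\<close> is the time derivative of the state. No measurability of \<open>K\<close> is
  assumed, so the second equation is stated for representatives.
\<close>

definition wave_equation ::
  "real \<Rightarrow> real \<Rightarrow> (real \<Rightarrow> real \<Rightarrow> real) \<Rightarrow> l2 \<Rightarrow> l2 \<Rightarrow> h2 \<Rightarrow> h01 \<Rightarrow> real \<Rightarrow> state \<Rightarrow> bool" where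
  "wave_equation c \<sigma> K \<theta>1 \<delta> v \<phi> y = (\<lambda>(v', \<phi>').
    h01_l2 v' = h01_l2 \<phi> \<and>
    (AE x in unit_leb. rep_l2 \<phi>' x =
      c\<^sup>2 * rep_l2 (h2_dxx v) x - \<sigma> * rep_l2 (h01_l2 \<phi>) x + rep_l2 \<theta>1 x * K x y + rep_l2 \<delta> x))"

text \<open>
  The function \<open>W\<close> below is \<open>w\<close> itself, regarded as a function into
  \<open>(H\<^sup>2(0,1) \<inter> H\<^sup>1\<^sub>0(0,1)) \<times> H\<^sup>1\<^sub>0(0,1)\<close> for almost every time. The boundary conditions are part of the
  type \<open>h01\<close>.
\<close>

definition closed_loop_solution ::
  "real \<Rightarrow> real \<Rightarrow> real \<Rightarrow> real \<Rightarrow> real \<Rightarrow>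
    (real \<Rightarrow> real) \<Rightarrow> (real \<Rightarrow> real) \<Rightarrow> (real \<Rightarrow> real) \<Rightarrow>
    (real \<Rightarrow> real \<Rightarrow> real) \<Rightarrow> (h2 \<times> h01 \<Rightarrow> real \<Rightarrow> real) \<Rightarrow>
    (real \<Rightarrow> real) \<Rightarrow> (real \<Rightarrow> real) \<Rightarrow> (real \<Rightarrow> l2) \<Rightarrow> (real \<Rightarrow> real) \<Rightarrow> (real \<Rightarrow> l2) \<Rightarrow>
    (real \<Rightarrow> state) \<Rightarrow> (real \<Rightarrow> real) \<Rightarrow> (real \<Rightarrow> real) \<Rightarrow> bool" where
  "closed_loop_solution c \<sigma> \<kappa> \<Gamma> \<epsilon> P1 P2 P3 K L b d \<theta>1 \<theta>2 \<delta> w y z \<longleftrightarrow>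
    continuous_on {0..} w \<and>
    loc_abs_continuous (\<lambda>t. Phi c \<sigma> (w t)) \<and>
    continuous_on {0..} y \<and> loc_abs_continuous y \<and>
    C1 z \<and>
    (\<exists>W :: real \<Rightarrow> h2 \<times> h01. loc_integrable W \<and>
      (AE t in time_leb. w t = (h2_h01 (fst (W t)), h01_l2 (snd (W t)))) \<and>
      (AE t in time_leb.
        (\<exists>w'. (w has_vector_derivative w') (at t within {0..}) \<and>
          wave_equation c \<sigma> K (\<theta>1 t) (\<delta> t) (fst (W t)) (snd (W t)) (y t) w') \<and>
        (y has_real_derivative
          b t * feedback \<kappa> P1 P2 P3 (y t) (z t) + \<theta>2 t * L (W t) (y t) + d t) (at t within {0..}) \<and>
        (z has_real_derivative
          \<Gamma> * exp (- z t) * max ((y t)\<^sup>2 / 2 - \<epsilon>) 0) (at t within {0..})))"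

end

theory Submission
  imports Defs "HOL-Real_Asymp.Real_Asymp"
begin

text \<open>
  The Lyapunov function is \<open>V = \<Phi>(w) + y\<^sup>2/2\<close>. Integration by parts and the Poincare inequality with
  constant \<open>1/\<pi>\<close> give \<open>d\<Phi>/dt \<le> - \<parallel>w\<parallel>\<^sup>2 + G \<parallel>\<theta>\<^sub>1\<parallel>\<^sup>2 y\<^sup>2 + G \<parallel>\<delta>\<parallel>\<^sup>2\<close>. With \<open>r = \<kappa> + exp z\<close>, write
  \<open>|\<theta>\<^sub>2| \<le> r + (|\<theta>\<^sub>2| - r)\<^sup>+\<close>, \<open>R \<parallel>\<theta>\<^sub>1\<parallel> \<le> r + (R \<parallel>\<theta>\<^sub>1\<parallel> - r)\<^sup>+\<close> and \<open>1 \<le> b r + b (1/b - r)\<^sup>+\<close>; by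
  Young's inequality the gains \<open>P\<^sub>1, P\<^sub>2, P\<^sub>3\<close> absorb everything except \<open>a/r\<close> times powers of the excess
  terms, so \<open>dV/dt \<le> - \<mu> V + Z\<close> almost everywhere, and Gronwall's inequality for absolutely
  continuous functions yields the first estimate. For \<open>E = y\<^sup>2/2\<close> one gets
  \<open>dE/dt \<le> - 2 C E + a B / r\<close> while \<open>d(exp z)/dt = \<Gamma> (E - \<epsilon>)\<^sup>+\<close>: once \<open>exp z\<close> is large, \<open>(E - \<epsilon>)\<^sup>+\<close> decays
  exponentially, so \<open>z\<close> is bounded and, being monotone, converges; Barbalat's argument then gives
  \<open>limsup E \<le> \<epsilon>\<close>. If the limit of \<open>r\<close> is at least the limsup of \<open>R \<parallel>\<theta>\<^sub>1\<parallel>\<close> and \<open>|\<theta>\<^sub>2|\<close>, the excess terms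
  tend to zero, and so does \<open>V\<close>.
\<close>

text \<open>The shape of the feedback comes from the unknown coefficient b: the control supplies the
  factor \<open>b r\<close>, which need not reach 1. A term m y^(2j) is bounded by
  \<open>b r\<close> times itself plus a defect, and Young's inequality with weight
  \<open>a / r\<close> turns the defect into \<open>b r\<close> times m^2 y^(4j) / (4a) plus an
  excess with factor \<open>a / r\<close>. So y^2 and y^4 create y^4 and y^8, which are the powers
  in y times the feedback, and the bound on \<open>P2\<close> contains the square of a part of the
  bound on \<open>P1\<close>. Of the seven factors r one belongs to \<open>b r\<close>; the other
  six compensate for gains that know only kappa, a lower bound of r.

  The order of the estimates is forced. The state w acts as a disturbance on y, so V is bounded
  first, with the excess terms frozen at time 0; only then does E obey an inequality with known
  constants from which z can be bounded.

  The functions Phi(w) and y are merely absolutely continuous, so their differential inequalities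
  are integrated by a monotonicity principle for derivatives whose sign is known almost everywhere.
  The right-hand side for z is continuous, so z can be treated with ordinary calculus.\<close>

section \<open>Absolutely continuous functions\<close>

text \<open>The definition lists intervals by an initial segment of the naturals, whereas a tagged
  division is a finite set of pairs. Enumerating the index set by a bijection transfers the
  condition.\<close>

lemma abs_continuous_on_indexed:
  fixes f :: "real \<Rightarrow> real"
  assumes "abs_continuous_on a b f" "0 < e"
  shows "\<exists>d>0. \<forall>(I :: 'i set) P Q. finite I \<longrightarrow> (\<forall>i\<in>I. a \<le> P i \<and> P i \<le> Q i \<and> Q i \<le> b) \<longrightarrow>
    disjoint_family_on (\<lambda>i. {P i<..<Q i}) I \<longrightarrow> (\<Sum>i\<in>I. Q i - P i) < d \<longrightarrow>
    (\<Sum>i\<in>I. \<bar>f (Q i) - f (P i)\<bar>) < e"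
proof -
  obtain d where "0 < d" and d: "\<forall>n. \<forall>p q :: nat \<Rightarrow> real.
      (\<forall>i<n. a \<le> p i \<and> p i \<le> q i \<and> q i \<le> b) \<and>
      disjoint_family_on (\<lambda>i. {p i<..<q i}) {..<n} \<and>
      (\<Sum>i<n. q i - p i) < d \<longrightarrow> (\<Sum>i<n. \<bar>f (q i) - f (p i)\<bar>) < e"
    using assms unfolding abs_continuous_on_def by blast
  show ?thesis
  proof (intro exI[of _ d] conjI allI impI \<open>0 < d\<close>)
    fix I :: "'i set" and P Q :: "'i \<Rightarrow> real"
    assume I: "finite I" "\<forall>i\<in>I. a \<le> P i \<and> P i \<le> Q i \<and> Q i \<le> b"
      "disjoint_family_on (\<lambda>i. {P i<..<Q i}) I" "(\<Sum>i\<in>I. Q i - P i) < d"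
    obtain h where h: "bij_betw h {..<card I} I"
      using ex_bij_betw_nat_finite[OF I(1)] by (auto simp: lessThan_atLeast0)
    have hI: "h i \<in> I" if "i < card I" for i
      using h that by (auto simp: bij_betw_def)
    have "disjoint_family_on (\<lambda>i. {P (h i)<..<Q (h i)}) {..<card I}"
      unfolding disjoint_family_on_def
    proof (intro ballI impI)
      fix m n assume mn: "m \<in> {..<card I}" "n \<in> {..<card I}" "m \<noteq> n"
      then have "h m \<noteq> h n"
        using h by (auto simp: bij_betw_def inj_on_def)
      then show "{P (h m)<..<Q (h m)} \<inter> {P (h n)<..<Q (h n)} = {}"
        using I(3) hI mn unfolding disjoint_family_on_def by blast
    qed
    moreover have "(\<Sum>i<card I. Q (h i) - P (h i)) < d"
      using sum.reindex_bij_betw[OF h, of "\<lambda>i. Q i - P i"] I(4) by simp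
    ultimately have "(\<Sum>i<card I. \<bar>f (Q (h i)) - f (P (h i))\<bar>) < e"
      using d[rule_format, of "card I" "\<lambda>i. P (h i)" "\<lambda>i. Q (h i)"] I(2) hI by auto
    then show "(\<Sum>i\<in>I. \<bar>f (Q i) - f (P i)\<bar>) < e"
      using sum.reindex_bij_betw[OF h, of "\<lambda>i. \<bar>f (Q i) - f (P i)\<bar>"] by simp
  qed
qed

text \<open>The straddle estimate: since x lies between u and v, the linearization errors e(x - u)
  and e(v - x) add up to e(v - u), and the slope contributes nothing positive.\<close>

lemma DERIV_nonpos_local_bound:
  assumes "(f has_real_derivative D) (at x)" "D \<le> 0" "0 < e"
  obtains r where "0 < r"
    "\<And>u v. u \<in> ball x r \<Longrightarrow> v \<in> ball x r \<Longrightarrow> u \<le> x \<Longrightarrow> x \<le> v \<Longrightarrow> f v - f u \<le> e * (v - u)"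
proof -
  have "(f has_derivative (\<lambda>h. h * D)) (at x)"
    using assms(1) by (simp add: has_field_derivative_def mult_commute_abs)
  then obtain r where "0 < r"
    and r: "\<And>y. norm (y - x) < r \<Longrightarrow> norm (f y - f x - (y - x) * D) \<le> e * norm (y - x)"
    using \<open>0 < e\<close> unfolding has_derivative_at_alt by blast
  show thesis
  proof (rule that[OF \<open>0 < r\<close>])
    fix u v assume uv: "u \<in> ball x r" "v \<in> ball x r" "u \<le> x" "x \<le> v"
    have "norm (u - x) < r" "norm (u - x) = x - u" "norm (v - x) < r" "norm (v - x) = v - x"
      using uv by (auto simp: dist_real_def)
    then have "\<bar>f u - f x - (u - x) * D\<bar> \<le> e * (x - u)" "\<bar>f v - f x - (v - x) * D\<bar> \<le> e * (v - x)"
      using r[of u] r[of v] by simp_all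
    moreover have "0 \<le> (u - x) * D" "(v - x) * D \<le> 0"
      using uv \<open>D \<le> 0\<close> by (auto intro: mult_nonpos_nonpos mult_nonneg_nonpos)
    ultimately show "f v - f u \<le> e * (v - u)"
      by (simp add: abs_le_iff algebra_simps)
  qed
qed

text \<open>
  A gauge argument: tags in the exceptional null set are confined to an open set of small measure,
  where absolute continuity controls the increments; at all other tags the derivative does.
\<close>

lemma abs_continuous_on_nonincreasing:
  fixes f :: "real \<Rightarrow> real"
  assumes ac: "abs_continuous_on a b f" and "a \<le> b"
    and ae: "AE x in lebesgue. x \<in> {a<..<b} \<longrightarrow> (\<exists>D\<le>0. (f has_real_derivative D) (at x))"
  shows "f b \<le> f a"
proof -
  have *: "f b - f a \<le> e * (b - a + 1)" if "0 < e" for e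
  proof -
    obtain d where "0 < d" and
      d: "\<forall>(I :: (real \<times> real set) set) P Q. finite I \<longrightarrow> (\<forall>i\<in>I. a \<le> P i \<and> P i \<le> Q i \<and> Q i \<le> b) \<longrightarrow>
        disjoint_family_on (\<lambda>i. {P i<..<Q i}) I \<longrightarrow> (\<Sum>i\<in>I. Q i - P i) < d \<longrightarrow>
        (\<Sum>i\<in>I. \<bar>f (Q i) - f (P i)\<bar>) < e"
      using abs_continuous_on_indexed[OF ac \<open>0 < e\<close>, where 'i = "real \<times> real set"] by (elim exE conjE)
    obtain N where N: "{x \<in> space lebesgue. \<not> (x \<in> {a<..<b} \<longrightarrow> (\<exists>D\<le>0. (f has_real_derivative D) (at x)))} \<subseteq> N"
      "emeasure lebesgue N = 0" "N \<in> sets lebesgue"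
      using AE_E[OF ae] by blast
    \<comment> \<open>The derivative is controlled on the open interval only. Adding the endpoints
      keeps the exceptional set null and makes every remaining tag interior.\<close>
    define E where "E = N \<union> {a, b}"
    have E: "E \<in> null_sets lebesgue"
      unfolding E_def
    proof (rule null_sets.Un)
      show "N \<in> null_sets lebesgue" using N by (simp only: null_sets_def mem_Collect_eq simp_thms)
      show "{a, b} \<in> null_sets lebesgue"
        using negligible_finite[of "{a, b}"] by (simp add: negligible_iff_null_sets)
    qed
    then have "E \<in> sets lebesgue" by (rule null_setsD2)
    obtain T where T: "open T" "E \<subseteq> T" "T - E \<in> lmeasurable" "emeasure lebesgue (T - E) < ennreal d"
      by (rule sets_lebesgue_outer_open[OF \<open>E \<in> sets lebesgue\<close> \<open>0 < d\<close>])
    \<comment> \<open>Because \<open>E\<close> is null, the open cover \<open>T\<close> has the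
      measure of \<open>T - E\<close>, which lies below the threshold \<open>d\<close> of absolute
      continuity.\<close>
    have TE: "emeasure lebesgue T = emeasure lebesgue (T - E)"
      using emeasure_Diff_null_set[OF E] T(1) by simp
    have Tm: "T \<in> lmeasurable"
      using TE T by (auto simp: fmeasurable_def)
    have mT: "measure lebesgue T < d"
    proof -
      have "ennreal (measure lebesgue T) < ennreal d"
        using T(4) Tm TE by (simp add: emeasure_eq_measure2)
      then show ?thesis using \<open>0 < d\<close> by (simp only: ennreal_less_iff measure_nonneg)
    qed
    have "\<exists>\<rho>>0. x \<notin> E \<longrightarrow> x \<in> {a..b} \<longrightarrow> (\<forall>u v. u \<in> ball x \<rho> \<longrightarrow> v \<in> ball x \<rho> \<longrightarrow> u \<le> x \<longrightarrow> x \<le> v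
        \<longrightarrow> f v - f u \<le> e * (v - u))" for x
    proof (cases "x \<notin> E \<and> x \<in> {a..b}")
      case True
      then have "x \<in> {a<..<b}" "x \<notin> N" by (auto simp: E_def)
      then obtain D where "D \<le> 0" "(f has_real_derivative D) (at x)"
        using N(1) by auto
      then obtain \<rho> where "0 < \<rho>" "\<And>u v. u \<in> ball x \<rho> \<Longrightarrow> v \<in> ball x \<rho> \<Longrightarrow> u \<le> x \<Longrightarrow> x \<le> v \<Longrightarrow> f v - f u \<le> e * (v - u)"
        using DERIV_nonpos_local_bound \<open>0 < e\<close> by blast
      then show ?thesis by blast
    qed (auto intro: exI[of _ 1])
    then obtain r where r0: "\<And>x. 0 < r x" and r1: "\<And>x. x \<notin> E \<longrightarrow> x \<in> {a..b} \<longrightarrow>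
        (\<forall>u v. u \<in> ball x (r x) \<longrightarrow> v \<in> ball x (r x) \<longrightarrow> u \<le> x \<longrightarrow> x \<le> v \<longrightarrow> f v - f u \<le> e * (v - u))"
      by metis
    define \<gamma> where "\<gamma> x = (if x \<in> E then T else ball x (r x))" for x
    have "gauge \<gamma>"
      using r0 T by (auto simp: gauge_def \<gamma>_def)
    then obtain p where p: "p tagged_division_of {a..b}" and fine: "\<gamma> fine p"
      by (rule fine_division_exists_real)
    have fin: "finite p" using p by auto
    define P Q :: "real \<times> real set \<Rightarrow> real" where "P i = Inf (snd i)" and "Q i = Sup (snd i)" for i
    have PQ: "snd i = {P i..Q i} \<and> a \<le> P i \<and> P i \<le> fst i \<and> fst i \<le> Q i \<and> Q i \<le> b \<and> {P i..Q i} \<subseteq> \<gamma> (fst i)" if "i \<in> p" for i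
    proof -
      obtain x k where i: "i = (x, k)" by (cases i)
      have xk: "(x, k) \<in> p" using that i by simp
      obtain u v where k: "k = {u..v}"
        using tagged_division_ofD(4)[OF p xk] by (metis cbox_interval)
      have "x \<in> k" "k \<subseteq> {a..b}" "k \<subseteq> \<gamma> x"
        using tagged_division_ofD(2,3)[OF p xk] fineD[OF fine xk] by auto
      moreover from this have "u \<le> v" "u \<in> {a..b}" "v \<in> {a..b}" using k by auto
      ultimately show ?thesis using i k by (simp add: P_def Q_def)
    qed
    have disj: "disjoint_family_on (\<lambda>i. {P i<..<Q i}) p"
      unfolding disjoint_family_on_def
    proof (intro ballI impI)
      fix i j assume ij: "i \<in> p" "j \<in> p" "i \<noteq> j"
      then have "interior (snd i) \<inter> interior (snd j) = {}"
        using tagged_division_ofD(5)[OF p, of "fst i" "snd i" "fst j" "snd j"] by simp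
      moreover have "interior (snd i) = {P i<..<Q i}" "interior (snd j) = {P j<..<Q j}"
        using PQ[OF ij(1)] PQ[OF ij(2)] by (metis interior_atLeastAtMost_real)+
      ultimately show "{P i<..<Q i} \<inter> {P j<..<Q j} = {}"
        by simp
    qed
    define I where "I = {i \<in> p. fst i \<in> E}"
    have I: "I \<subseteq> p" "finite I" using fin by (auto simp: I_def)
    have "(\<Sum>i\<in>I. Q i - P i) = (\<Sum>i\<in>I. measure lebesgue {P i<..<Q i})"
      using PQ I by (intro sum.cong refl) force
    also have "\<dots> = measure lebesgue (\<Union>i\<in>I. {P i<..<Q i})"
    proof (rule measure_finite_Union[symmetric])
      show "disjoint_family_on (\<lambda>i. {P i<..<Q i}) I"
        using disj I disjoint_family_on_mono by blast
      show "emeasure lebesgue {P i<..<Q i} \<noteq> \<infinity>" if "i \<in> I" for i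
        by (cases "P i \<le> Q i") auto
    qed (use I in auto)
    also have "\<dots> \<le> measure lebesgue T"
    proof (rule measure_mono_fmeasurable[OF _ _ Tm])
      show "(\<Union>i\<in>I. {P i<..<Q i}) \<subseteq> T"
      proof (rule UN_least)
        fix i assume "i \<in> I"
        then have "{P i..Q i} \<subseteq> T"
          using PQ[of i] by (auto simp: I_def \<gamma>_def)
        then show "{P i<..<Q i} \<subseteq> T"
          using greaterThanLessThan_subseteq_atLeastAtMost_iff by blast
      qed
    qed (use I in auto)
    finally have "(\<Sum>i\<in>I. Q i - P i) < d" using mT by linarith
    then have "(\<Sum>i\<in>I. \<bar>f (Q i) - f (P i)\<bar>) < e"
      using PQ I disjoint_family_on_mono[OF I(1) disj]
      by (intro d[rule_format]) force+
    moreover have "(\<Sum>i\<in>I. f (Q i) - f (P i)) \<le> (\<Sum>i\<in>I. \<bar>f (Q i) - f (P i)\<bar>)"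
      by (rule sum_mono) simp
    ultimately have 1: "(\<Sum>i\<in>I. f (Q i) - f (P i)) \<le> e" by linarith
    have "(\<Sum>i\<in>p - I. f (Q i) - f (P i)) \<le> (\<Sum>i\<in>p - I. e * (Q i - P i))"
    proof (rule sum_mono)
      fix i assume i: "i \<in> p - I"
      then have "fst i \<notin> E" by (simp add: I_def)
      with i PQ[of i] have "{P i..Q i} \<subseteq> ball (fst i) (r (fst i))" "P i \<le> fst i" "fst i \<le> Q i"
        "fst i \<in> {a..b}"
        by (auto simp: \<gamma>_def)
      moreover from this have "P i \<in> {P i..Q i}" "Q i \<in> {P i..Q i}" by simp_all
      ultimately have "P i \<in> ball (fst i) (r (fst i))" "Q i \<in> ball (fst i) (r (fst i))"
        "P i \<le> fst i" "fst i \<le> Q i" "fst i \<in> {a..b}"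
        by blast+
      then show "f (Q i) - f (P i) \<le> e * (Q i - P i)"
        using \<open>fst i \<notin> E\<close> by (intro r1[rule_format, of "fst i"]) auto
    qed
    also have "\<dots> \<le> (\<Sum>i\<in>p. e * (Q i - P i))"
    proof (rule sum_mono2[OF fin])
      fix i assume "i \<in> p - (p - I)"
      then have "P i \<le> fst i \<and> fst i \<le> Q i" using PQ by blast
      then show "0 \<le> e * (Q i - P i)" using \<open>0 < e\<close> by simp
    qed auto
    also have "\<dots> = e * (b - a)"
      using additive_tagged_division_1[OF \<open>a \<le> b\<close> p, of "\<lambda>x. x"]
      by (simp add: sum_distrib_left[symmetric] P_def Q_def case_prod_beta)
    finally have 2: "(\<Sum>i\<in>p - I. f (Q i) - f (P i)) \<le> e * (b - a)" .
    have "f b - f a = (\<Sum>i\<in>p. f (Q i) - f (P i))"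
      using additive_tagged_division_1[OF \<open>a \<le> b\<close> p, of f]
      by (simp add: P_def Q_def case_prod_beta)
    also have "\<dots> = (\<Sum>i\<in>p - I. f (Q i) - f (P i)) + (\<Sum>i\<in>I. f (Q i) - f (P i))"
      by (rule sum.subset_diff[OF I(1) fin])
    finally show ?thesis using 1 2 by (simp add: algebra_simps)
  qed
  \<comment> \<open>Tags in \<open>E\<close> cost at most e and all other tags at most e(b - a);
    both vanish in the limit.\<close>
  have "((\<lambda>e. e * (b - a + 1)) \<longlongrightarrow> 0 * (b - a + 1)) (at_right 0)"
    by (intro tendsto_intros)
  moreover have "\<forall>\<^sub>F e in at_right 0. f b - f a \<le> e * (b - a + 1)"
    using eventually_at_right_less[of "0 :: real"] by eventually_elim (rule *)
  ultimately have "f b - f a \<le> 0 * (b - a + 1)"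
    by (intro tendsto_lowerbound) auto
  then show ?thesis by simp
qed

section \<open>Closure properties of absolute continuity\<close>

lemma abs_continuous_on_subinterval:
  assumes "abs_continuous_on a b f" "a \<le> c" "d \<le> b"
  shows "abs_continuous_on c d f"
  unfolding abs_continuous_on_def
proof (intro allI impI)
  fix e :: real assume "0 < e"
  then obtain D where "D > 0" and D: "\<forall>n. \<forall>p q :: nat \<Rightarrow> real.
      (\<forall>i<n. a \<le> p i \<and> p i \<le> q i \<and> q i \<le> b) \<and>
      disjoint_family_on (\<lambda>i. {p i<..<q i}) {..<n} \<and>
      (\<Sum>i<n. q i - p i) < D \<longrightarrow> (\<Sum>i<n. \<bar>f (q i) - f (p i)\<bar>) < e"
    using assms(1) unfolding abs_continuous_on_def by blast
  show "\<exists>D>0. \<forall>n. \<forall>p q :: nat \<Rightarrow> real.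
      (\<forall>i<n. c \<le> p i \<and> p i \<le> q i \<and> q i \<le> d) \<and>
      disjoint_family_on (\<lambda>i. {p i<..<q i}) {..<n} \<and>
      (\<Sum>i<n. q i - p i) < D \<longrightarrow> (\<Sum>i<n. \<bar>f (q i) - f (p i)\<bar>) < e"
  proof (intro exI[of _ D] conjI allI impI \<open>D > 0\<close>)
    fix n and p q :: "nat \<Rightarrow> real"
    assume "(\<forall>i<n. c \<le> p i \<and> p i \<le> q i \<and> q i \<le> d) \<and>
      disjoint_family_on (\<lambda>i. {p i<..<q i}) {..<n} \<and> (\<Sum>i<n. q i - p i) < D"
    then show "(\<Sum>i<n. \<bar>f (q i) - f (p i)\<bar>) < e"
      using D[rule_format, of n p q] assms(2,3) by (meson order_trans)
  qed
qed

text \<open>The common source of the closure properties: sums, products and functions with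
  continuous derivative are all handled by a pointwise bound on increments.\<close>

lemma abs_continuous_on_dominated:
  assumes f: "abs_continuous_on a b f" and g: "abs_continuous_on a b g" and "0 < M"
    and h: "\<And>p q. a \<le> p \<Longrightarrow> p \<le> q \<Longrightarrow> q \<le> b \<Longrightarrow>
      \<bar>h q - h p\<bar> \<le> M * (\<bar>f q - f p\<bar> + \<bar>g q - g p\<bar>)"
  shows "abs_continuous_on a b h"
  unfolding abs_continuous_on_def
proof (intro allI impI)
  fix e :: real assume "0 < e"
  then have e: "0 < e / (2 * M)" using \<open>0 < M\<close> by simp
  obtain d1 where "d1 > 0" and d1: "\<forall>n. \<forall>p q :: nat \<Rightarrow> real.
      (\<forall>i<n. a \<le> p i \<and> p i \<le> q i \<and> q i \<le> b) \<and>
      disjoint_family_on (\<lambda>i. {p i<..<q i}) {..<n} \<and>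
      (\<Sum>i<n. q i - p i) < d1 \<longrightarrow> (\<Sum>i<n. \<bar>f (q i) - f (p i)\<bar>) < e / (2 * M)"
    using f e unfolding abs_continuous_on_def by blast
  obtain d2 where "d2 > 0" and d2: "\<forall>n. \<forall>p q :: nat \<Rightarrow> real.
      (\<forall>i<n. a \<le> p i \<and> p i \<le> q i \<and> q i \<le> b) \<and>
      disjoint_family_on (\<lambda>i. {p i<..<q i}) {..<n} \<and>
      (\<Sum>i<n. q i - p i) < d2 \<longrightarrow> (\<Sum>i<n. \<bar>g (q i) - g (p i)\<bar>) < e / (2 * M)"
    using g e unfolding abs_continuous_on_def by blast
  show "\<exists>D>0. \<forall>n. \<forall>p q :: nat \<Rightarrow> real.
      (\<forall>i<n. a \<le> p i \<and> p i \<le> q i \<and> q i \<le> b) \<and>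
      disjoint_family_on (\<lambda>i. {p i<..<q i}) {..<n} \<and>
      (\<Sum>i<n. q i - p i) < D \<longrightarrow> (\<Sum>i<n. \<bar>h (q i) - h (p i)\<bar>) < e"
  proof (intro exI[of _ "min d1 d2"] conjI allI impI)
    fix n and p q :: "nat \<Rightarrow> real"
    assume *: "(\<forall>i<n. a \<le> p i \<and> p i \<le> q i \<and> q i \<le> b) \<and>
      disjoint_family_on (\<lambda>i. {p i<..<q i}) {..<n} \<and> (\<Sum>i<n. q i - p i) < min d1 d2"
    have "(\<Sum>i<n. \<bar>h (q i) - h (p i)\<bar>) \<le> (\<Sum>i<n. M * (\<bar>f (q i) - f (p i)\<bar> + \<bar>g (q i) - g (p i)\<bar>))"
      using * by (intro sum_mono h) auto
    also have "\<dots> = M * ((\<Sum>i<n. \<bar>f (q i) - f (p i)\<bar>) + (\<Sum>i<n. \<bar>g (q i) - g (p i)\<bar>))"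
      by (simp only: sum_distrib_left[symmetric] sum.distrib)
    also have "\<dots> < M * (e / (2 * M) + e / (2 * M))"
      using * d1[rule_format, of n p q] d2[rule_format, of n p q] \<open>0 < M\<close>
      by (intro mult_strict_left_mono add_strict_mono) auto
    also have "\<dots> = e" using \<open>0 < M\<close> by simp
    finally show "(\<Sum>i<n. \<bar>h (q i) - h (p i)\<bar>) < e" .
  qed (use \<open>d1 > 0\<close> \<open>d2 > 0\<close> in auto)
qed

lemma abs_continuous_on_ident: "abs_continuous_on a b (\<lambda>x. x)"
  unfolding abs_continuous_on_def
proof (intro allI impI)
  fix e :: real assume "0 < e"
  moreover have "(\<Sum>i<n. \<bar>q i - p i\<bar>) = (\<Sum>i<n. q i - p i)" if "\<forall>i<n. p i \<le> q i"
    for n and p q :: "nat \<Rightarrow> real"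
    using that by (intro sum.cong) auto
  ultimately show "\<exists>D>0. \<forall>n. \<forall>p q :: nat \<Rightarrow> real.
      (\<forall>i<n. a \<le> p i \<and> p i \<le> q i \<and> q i \<le> b) \<and>
      disjoint_family_on (\<lambda>i. {p i<..<q i}) {..<n} \<and>
      (\<Sum>i<n. q i - p i) < D \<longrightarrow> (\<Sum>i<n. \<bar>q i - p i\<bar>) < e"
    by (intro exI[of _ e]) auto
qed

lemma abs_continuous_on_add:
  assumes "abs_continuous_on a b f" "abs_continuous_on a b g"
  shows "abs_continuous_on a b (\<lambda>x. f x + g x)"
  by (rule abs_continuous_on_dominated[OF assms, of 1]) auto

lemma abs_continuous_on_imp_continuous_on:
  assumes "abs_continuous_on a b f"
  shows "continuous_on {a..b} f"
  unfolding continuous_on_iff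
proof (intro ballI allI impI)
  fix x e :: real assume x: "x \<in> {a..b}" and "0 < e"
  then obtain d where "d > 0" and d: "\<forall>n. \<forall>p q :: nat \<Rightarrow> real.
      (\<forall>i<n. a \<le> p i \<and> p i \<le> q i \<and> q i \<le> b) \<and>
      disjoint_family_on (\<lambda>i. {p i<..<q i}) {..<n} \<and>
      (\<Sum>i<n. q i - p i) < d \<longrightarrow> (\<Sum>i<n. \<bar>f (q i) - f (p i)\<bar>) < e"
    using assms unfolding abs_continuous_on_def by blast
  have "dist (f x') (f x) < e" if x': "x' \<in> {a..b}" "dist x' x < d" for x'
  proof -
    have "\<bar>f (max x x') - f (min x x')\<bar> < e"
      using d[rule_format, of 1 "\<lambda>_. min x x'" "\<lambda>_. max x x'"] x x'
      by (auto simp: disjoint_family_on_def dist_real_def max_def min_def split: if_splits)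
    then show ?thesis by (auto simp: dist_real_def max_def min_def split: if_splits)
  qed
  then show "\<exists>d>0. \<forall>x'\<in>{a..b}. dist x' x < d \<longrightarrow> dist (f x') (f x) < e"
    using \<open>d > 0\<close> by blast
qed

lemma abs_continuous_on_mult:
  assumes f: "abs_continuous_on a b f" and g: "abs_continuous_on a b g"
  shows "abs_continuous_on a b (\<lambda>x. f x * g x)"
proof -
  have "bounded (f ` {a..b})" "bounded (g ` {a..b})"
    using f g by (auto intro!: compact_imp_bounded compact_continuous_image
        abs_continuous_on_imp_continuous_on)
  then obtain M N where M: "\<forall>x\<in>{a..b}. \<bar>f x\<bar> \<le> M" and N: "\<forall>x\<in>{a..b}. \<bar>g x\<bar> \<le> N"
    by (auto simp: bounded_iff)
  show ?thesis
  proof (rule abs_continuous_on_dominated[OF f g, of "\<bar>M\<bar> + \<bar>N\<bar> + 1"])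
    fix p q assume "a \<le> p" "p \<le> q" "q \<le> b"
    then have "\<bar>f q\<bar> \<le> M" "\<bar>g p\<bar> \<le> N"
      using M N by simp_all
    then have "\<bar>f q\<bar> \<le> \<bar>M\<bar> + \<bar>N\<bar> + 1" "\<bar>g p\<bar> \<le> \<bar>M\<bar> + \<bar>N\<bar> + 1"
      by linarith+
    then have "\<bar>g p\<bar> * \<bar>f q - f p\<bar> + \<bar>f q\<bar> * \<bar>g q - g p\<bar>
        \<le> (\<bar>M\<bar> + \<bar>N\<bar> + 1) * (\<bar>f q - f p\<bar> + \<bar>g q - g p\<bar>)"
      unfolding distrib_left by (intro add_mono mult_right_mono) auto
    moreover have "f q * g q - f p * g p = g p * (f q - f p) + f q * (g q - g p)"
      by (simp add: algebra_simps)
    ultimately show "\<bar>f q * g q - f p * g p\<bar> \<le> (\<bar>M\<bar> + \<bar>N\<bar> + 1) * (\<bar>f q - f p\<bar> + \<bar>g q - g p\<bar>)"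
      using abs_triangle_ineq[of "g p * (f q - f p)" "f q * (g q - g p)"] by (simp add: abs_mult)
  qed auto
qed

lemma abs_continuous_on_DERIV:
  fixes f :: "real \<Rightarrow> real"
  assumes "\<And>x. (f has_real_derivative f' x) (at x)" "continuous_on {a..b} f'"
  shows "abs_continuous_on a b f"
proof -
  have "bounded (f' ` {a..b})"
    using assms(2) by (intro compact_imp_bounded compact_continuous_image) auto
  then obtain M where M: "\<forall>x\<in>{a..b}. \<bar>f' x\<bar> \<le> M" by (auto simp: bounded_iff)
  show ?thesis
  proof (rule abs_continuous_on_dominated[OF abs_continuous_on_ident abs_continuous_on_ident])
    fix p q :: real assume pq: "a \<le> p" "p \<le> q" "q \<le> b"
    have "norm (f q - f p) \<le> M * norm (q - p)"
    proof (rule field_differentiable_bound[of "{a..b}" f f' M])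
      show "(f has_field_derivative f' x) (at x within {a..b})" for x
        by (rule has_field_derivative_at_within[OF assms(1)])
    qed (use M pq in auto)
    also have "\<dots> \<le> (\<bar>M\<bar> + 1) * (\<bar>q - p\<bar> + \<bar>q - p\<bar>)"
      by (intro mult_mono) auto
    finally show "\<bar>f q - f p\<bar> \<le> (\<bar>M\<bar> + 1) * (\<bar>q - p\<bar> + \<bar>q - p\<bar>)" by simp
  qed auto
qed

lemma abs_continuous_on_const: "abs_continuous_on a b (\<lambda>x. c)"
  by (rule abs_continuous_on_DERIV[where f' = "\<lambda>x. 0"]) auto

section \<open>Gronwall inequalities\<close>

text \<open>With the integrating factor, exp(\<mu>(x - s)) (V - h/\<mu>) has derivative exp(\<mu>(x
  - s)) (D - (h - \<mu> V)), which is nonpositive almost everywhere.\<close>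

lemma gronwall_abs_continuous:
  fixes V :: "real \<Rightarrow> real"
  assumes V: "abs_continuous_on s t V" and "s \<le> t" "0 < \<mu>"
    and ae: "AE x in lebesgue. x \<in> {s<..<t} \<longrightarrow>
      (\<exists>D. (V has_real_derivative D) (at x) \<and> D \<le> h - \<mu> * V x)"
  shows "V t \<le> exp (- \<mu> * (t - s)) * (V s - h / \<mu>) + h / \<mu>"
proof -
  define U where "U x = exp (\<mu> * (x - s)) * (V x + - (h / \<mu>))" for x
  have ac: "abs_continuous_on s t U"
    unfolding U_def
  proof (intro abs_continuous_on_mult abs_continuous_on_add V abs_continuous_on_const)
    show "abs_continuous_on s t (\<lambda>x. exp (\<mu> * (x - s)))"
      by (rule abs_continuous_on_DERIV[where f' = "\<lambda>x. exp (\<mu> * (x - s)) * \<mu>"])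
        (auto intro!: derivative_eq_intros continuous_intros)
  qed
  have "U t \<le> U s"
  proof (rule abs_continuous_on_nonincreasing[OF ac \<open>s \<le> t\<close>])
    show "AE x in lebesgue. x \<in> {s<..<t} \<longrightarrow> (\<exists>D\<le>0. (U has_real_derivative D) (at x))"
      using ae
    proof (eventually_elim, intro impI)
      fix x assume "x \<in> {s<..<t} \<longrightarrow>
        (\<exists>D. (V has_real_derivative D) (at x) \<and> D \<le> h - \<mu> * V x)" and "x \<in> {s<..<t}"
      then obtain D where D: "(V has_real_derivative D) (at x)" "D \<le> h - \<mu> * V x" by blast
      have "(U has_real_derivative exp (\<mu> * (x - s)) * (D - (h - \<mu> * V x))) (at x)"
        unfolding U_def using D(1) \<open>0 < \<mu>\<close>
        by (auto intro!: derivative_eq_intros simp: algebra_simps)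
      moreover have "exp (\<mu> * (x - s)) * (D - (h - \<mu> * V x)) \<le> 0"
        using D(2) by (intro mult_nonneg_nonpos) auto
      ultimately show "\<exists>D\<le>0. (U has_real_derivative D) (at x)" by blast
    qed
  qed
  then have "exp (- \<mu> * (t - s)) * U t \<le> exp (- \<mu> * (t - s)) * (V s - h / \<mu>)"
    by (intro mult_left_mono) (auto simp: U_def)
  moreover have "exp (- \<mu> * (t - s)) * U t = V t - h / \<mu>"
    by (simp add: U_def mult.assoc[symmetric] exp_add[symmetric])
  ultimately show ?thesis by linarith
qed

lemma loc_abs_continuousD:
  "loc_abs_continuous f \<Longrightarrow> 0 \<le> a \<Longrightarrow> abs_continuous_on a b f"
  unfolding loc_abs_continuous_def
  by (rule abs_continuous_on_subinterval[of 0 "max b 1"]) auto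

lemma loc_abs_continuous_add:
  "loc_abs_continuous f \<Longrightarrow> loc_abs_continuous g \<Longrightarrow> loc_abs_continuous (\<lambda>x. f x + g x)"
  by (auto simp: loc_abs_continuous_def intro: abs_continuous_on_add)

lemma loc_abs_continuous_mult:
  "loc_abs_continuous f \<Longrightarrow> loc_abs_continuous g \<Longrightarrow> loc_abs_continuous (\<lambda>x. f x * g x)"
  by (auto simp: loc_abs_continuous_def intro: abs_continuous_on_mult)

lemma loc_abs_continuous_cmult: "loc_abs_continuous f \<Longrightarrow> loc_abs_continuous (\<lambda>x. c * f x)"
  unfolding loc_abs_continuous_def
  by (intro allI impI abs_continuous_on_mult abs_continuous_on_const) auto

text \<open>The asymptotic form: the initial value is forgotten exponentially, so an inequality that
  holds only up to a small error after a late time still bounds the limsup of \<open>V\<close> by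
  h/\<mu>.\<close>

lemma gronwall_eventually:
  fixes V :: "real \<Rightarrow> real"
  assumes V: "loc_abs_continuous V" and "0 < \<mu>"
    and ae: "\<And>e. 0 < e \<Longrightarrow> \<exists>T\<ge>0. AE x in lebesgue. T < x \<longrightarrow>
      (\<exists>D. (V has_real_derivative D) (at x) \<and> D \<le> h + e - \<mu> * V x)"
    and "0 < e"
  shows "\<forall>\<^sub>F t in at_top. V t \<le> h / \<mu> + e"
proof -
  \<comment> \<open>Half of the tolerance is spent on the error in the inequality, which Gronwall
    divides by \<open>\<mu>\<close>, and half on the decaying exponential.\<close>
  have "0 < \<mu> * (e / 2)" using \<open>0 < \<mu>\<close> \<open>0 < e\<close> by simp
  then obtain T where "0 \<le> T" and T: "AE x in lebesgue. T < x \<longrightarrow>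
      (\<exists>D. (V has_real_derivative D) (at x) \<and> D \<le> h + \<mu> * (e / 2) - \<mu> * V x)"
    using ae by blast
  define A where "A = V T - (h + \<mu> * (e / 2)) / \<mu>"
  have le: "V t \<le> exp (- \<mu> * (t - T)) * A + (h + \<mu> * (e / 2)) / \<mu>" if "T \<le> t" for t
    unfolding A_def
  proof (rule gronwall_abs_continuous[OF loc_abs_continuousD[OF V \<open>0 \<le> T\<close>] that \<open>0 < \<mu>\<close>])
    show "AE x in lebesgue. x \<in> {T<..<t} \<longrightarrow>
      (\<exists>D. (V has_real_derivative D) (at x) \<and> D \<le> h + \<mu> * (e / 2) - \<mu> * V x)"
      using T by eventually_elim auto
  qed
  have "((\<lambda>t. exp (- \<mu> * (t - T)) * A) \<longlongrightarrow> 0) at_top"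
    using \<open>0 < \<mu>\<close> by real_asymp
  then have "\<forall>\<^sub>F t in at_top. exp (- \<mu> * (t - T)) * A < e / 2"
    using \<open>0 < e\<close> by (intro order_tendstoD(2)) auto
  then show ?thesis
    using eventually_ge_at_top[of T]
  proof eventually_elim
    case (elim t)
    have "(h + \<mu> * (e / 2)) / \<mu> = h / \<mu> + e / 2" using \<open>0 < \<mu>\<close> by (simp add: field_simps)
    then show ?case using le[of t] elim by linarith
  qed
qed

section \<open>Sobolev spaces\<close>

lemma test_functions_deriv:
  assumes "f \<in> test_functions"
  shows "deriv f \<in> test_functions"
proof -
  have "smooth (deriv f)"
    unfolding smooth_def
  proof (intro allI)
    fix k x
    have "(deriv ^^ Suc k) f field_differentiable at x"
      using assms unfolding test_functions_def smooth_def by blast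
    then show "(deriv ^^ k) (deriv f) field_differentiable at x"
      by (simp add: funpow_swap1)
  qed
  moreover have "deriv f x = 0" if "x \<notin> closure {x. f x \<noteq> 0}" for x
  proof -
    have "((\<lambda>x. 0) has_field_derivative 0) (at x)" by simp
    then have "(f has_field_derivative 0) (at x)"
      by (rule has_field_derivative_transform_within_open[where S = "- closure {x. f x \<noteq> 0}"])
        (use that closure_subset[of "{x. f x \<noteq> 0}"] in auto)
    then show ?thesis by (rule DERIV_imp_deriv)
  qed
  then have "closure {x. deriv f x \<noteq> 0} \<subseteq> closure {x. f x \<noteq> 0}"
    by (intro closure_minimal) auto
  ultimately show ?thesis using assms by (auto simp: test_functions_def)
qed

text \<open>
  With \<open>F x = \<pi> cot(\<pi> x) f(x)\<^sup>2\<close>, which vanishes near the endpoints, one has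
  \<open>(f' - \<pi> cot(\<pi> x) f)\<^sup>2 = f'\<^sup>2 - F' - \<pi>\<^sup>2 f\<^sup>2\<close>; integrating gives the optimal constant.
\<close>

lemma test_function_poincare:
  assumes "f \<in> test_functions"
  shows "pi * norm (abs_l2 f) \<le> norm (abs_l2 (deriv f))"
proof -
  have sm: "smooth f" and supp: "closure {x. f x \<noteq> 0} \<subseteq> {0<..<1}"
    using assms by (auto simp: test_functions_def)
  have sq: "square_integrable f" "square_integrable (deriv f)"
    using test_functions_square_integrable[OF assms] by auto
  have f01: "f 0 = 0" "f 1 = 0" using test_functions_boundary[OF assms] by auto
  define F where "F x = pi * cot (pi * x) * (f x)\<^sup>2" for x
  define F' where "F' x = 2 * pi * cot (pi * x) * f x * deriv f x - pi\<^sup>2 / (sin (pi * x))\<^sup>2 * (f x)\<^sup>2" for x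
  have F01: "F x = 0" "F' x = 0" if "x \<in> {0, 1}" for x
    using f01 that by (auto simp: F_def F'_def)
  have F_deriv: "(F has_real_derivative F' x) (at x)" if "x \<in> {0..1}" for x
  proof (cases "x \<in> {0<..<1}")
    case True
    then have s: "sin (pi * x) \<noteq> 0" using sin_gt_zero[of "pi * x"] by simp
    have "((\<lambda>x. pi * x) has_real_derivative pi) (at x)"
      by (auto intro!: derivative_eq_intros)
    then have cot: "((\<lambda>x. cot (pi * x)) has_real_derivative - inverse ((sin (pi * x))\<^sup>2) * pi) (at x)"
      by (rule DERIV_chain2[where f = cot and g = "\<lambda>x. pi * x" and x = x, OF DERIV_cot[OF s]])
    show ?thesis
      using DERIV_mult[OF DERIV_cmult[OF cot, of pi] DERIV_power[where n = 2, OF smooth_D(1)[OF sm]]]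
      unfolding F_def[abs_def]
      by (rule DERIV_cong) (use s in \<open>simp add: F'_def field_simps power2_eq_square\<close>)
  next
    \<comment> \<open>At an endpoint \<open>F\<close> vanishes on a whole neighbourhood, the
      complement of the closed support of f, so the pole of cot there is harmless.\<close>
    case False
    then have x: "x \<in> {0, 1}" using that by auto
    have "((\<lambda>x. 0) has_field_derivative 0) (at x)" by simp
    then have "(F has_field_derivative 0) (at x)"
    proof (rule has_field_derivative_transform_within_open[where S = "- closure {x. f x \<noteq> 0}"])
      show "0 = F y" if "y \<in> - closure {x. f x \<noteq> 0}" for y
        using that closure_subset[of "{x. f x \<noteq> 0}"] by (auto simp: F_def)
    qed (use False supp in auto)
    then show ?thesis using F01[OF x] by simp
  qed
  have "(F has_vector_derivative F' x) (at x within {0..1})" if "x \<in> {0..1}" for x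
    using has_field_derivative_at_within[OF F_deriv[OF that]]
    unfolding has_real_derivative_iff_has_vector_derivative .
  then have "(F' has_integral F 1 - F 0) {0..1}"
    by (rule fundamental_theorem_of_calculus[OF zero_le_one])
  moreover have "F 1 - F 0 = 0" using F01(1) by simp
  ultimately have F'_int: "(F' has_integral 0) {0..1}" by simp
  have int: "((\<lambda>x. g x * g x) has_integral (norm (abs_l2 g))\<^sup>2) {0..1}" if "square_integrable g" for g
    using has_integral_integral_lebesgue_on[OF square_integrable_mult[OF that that]] that
    by (simp add: has_integral_Icc_iff_Ioo inner_l2.abs_eq power2_norm_eq_inner)
  have "((\<lambda>x. deriv f x * deriv f x - F' x - pi\<^sup>2 * (f x * f x)) has_integral
      (norm (abs_l2 (deriv f)))\<^sup>2 - 0 - pi\<^sup>2 * (norm (abs_l2 f))\<^sup>2) {0..1}"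
    by (intro has_integral_diff has_integral_mult_right int sq F'_int)
  then have "0 \<le> (norm (abs_l2 (deriv f)))\<^sup>2 - 0 - pi\<^sup>2 * (norm (abs_l2 f))\<^sup>2"
  proof (rule has_integral_nonneg)
    fix x :: real assume x: "x \<in> {0..1}"
    show "0 \<le> deriv f x * deriv f x - F' x - pi\<^sup>2 * (f x * f x)"
    \<comment> \<open>In the unit interval sin(\<pi> x) vanishes only at the endpoints, where the
      integrand reduces to the square of f'; elsewhere it is the square announced above.\<close>
    proof (cases "sin (pi * x) = 0")
      case True
      then have "\<not> (0 < x \<and> x < 1)" using sin_gt_zero[of "pi * x"] by auto
      then have "x \<in> {0, 1}" using x by auto
      then have "F' x = 0" "f x = 0" using F01(2) f01 by auto
      then show ?thesis by simp
    next
      case False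
      have "(cos (pi * x))\<^sup>2 = 1 - (sin (pi * x))\<^sup>2" by (rule cos_squared_eq)
      then have "1 / (sin (pi * x))\<^sup>2 = 1 + (cot (pi * x))\<^sup>2"
        using False by (simp add: cot_def power_divide diff_divide_distrib)
      then have "pi\<^sup>2 / (sin (pi * x))\<^sup>2 = pi\<^sup>2 * (1 + (cot (pi * x))\<^sup>2)"
        using times_divide_eq_right[of "pi\<^sup>2" 1 "(sin (pi * x))\<^sup>2"] by (simp only: mult_1_right)
      then have F': "F' x = 2 * pi * cot (pi * x) * f x * deriv f x - pi\<^sup>2 * (1 + (cot (pi * x))\<^sup>2) * (f x)\<^sup>2"
        by (simp only: F'_def)
      then have "deriv f x * deriv f x - F' x - pi\<^sup>2 * (f x * f x)
          = (deriv f x - pi * cot (pi * x) * f x)\<^sup>2"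
        unfolding F' by (simp add: power2_eq_square algebra_simps)
      then show ?thesis by simp
    qed
  qed
  then have "(pi * norm (abs_l2 f))\<^sup>2 \<le> (norm (abs_l2 (deriv f)))\<^sup>2"
    by (simp add: power_mult_distrib)
  then show ?thesis by (rule power2_le_imp_le) simp
qed

text \<open>Both sides depend continuously on the pair (v, v_x), so the inequality passes from test
  functions to the closure of their graph.\<close>

lemma h01_poincare: "pi * norm (h01_l2 v) \<le> norm (h01_dx v)"
proof -
  have "closed {p :: l2 \<times> l2. pi * norm (fst p) \<le> norm (snd p)}"
    by (intro closed_Collect_le continuous_intros)
  moreover have "test_graph \<subseteq> {p. pi * norm (fst p) \<le> norm (snd p)}"
    by (auto simp: test_graph_def test_function_poincare)
  ultimately have "closure test_graph \<subseteq> {p. pi * norm (fst p) \<le> norm (snd p)}"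
    by (intro closure_minimal)
  then show ?thesis
    using Rep_h01[of v] by (auto simp: h01_l2_def h01_dx_def)
qed

text \<open>The weak derivative of v_x is tested against test functions only. Both sides are
  continuous in the pair (u, u_x), which extends the identity to all u in the closure.\<close>

lemma h2_parts: "inner (h01_l2 u) (h2_dxx v) = - inner (h01_dx u) (h01_dx (h2_h01 v))"
proof -
  have v: "has_weak_deriv (h01_dx (h2_h01 v)) (h2_dxx v)"
    using Rep_h2[of v] by (auto simp: h2_h01_def h2_dxx_def)
  let ?S = "{p. inner (fst p) (h2_dxx v) = - inner (snd p) (h01_dx (h2_h01 v))}"
  have "closed ?S"
    by (intro closed_Collect_eq continuous_intros)
  moreover have "test_graph \<subseteq> ?S"
    using v by (auto simp: test_graph_def has_weak_deriv_def inner_commute)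
  ultimately have "closure test_graph \<subseteq> ?S"
    by (intro closure_minimal)
  then show ?thesis
    using Rep_h01[of u] by (auto simp: h01_l2_def h01_dx_def)
qed

lemma h01_l2_add: "h01_l2 (u + v) = h01_l2 u + h01_l2 v"
  and h01_dx_add: "h01_dx (u + v) = h01_dx u + h01_dx v"
  and h01_l2_scaleR: "h01_l2 (r *\<^sub>R v) = r *\<^sub>R h01_l2 v"
  and h01_dx_scaleR: "h01_dx (r *\<^sub>R v) = r *\<^sub>R h01_dx v"
  by (simp_all add: h01_l2_def h01_dx_def Rep_h01_plus Rep_h01_scaleR)

lemma bounded_linear_h01_dx: "bounded_linear h01_dx"
  by (rule bounded_linear_intro[where K = 1]) (auto simp: h01_dx_add h01_dx_scaleR norm_h01_eq)

lemma bounded_linear_h01_l2: "bounded_linear h01_l2"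
  using H01_bound[OF Rep_h01]
  by (intro bounded_linear_intro[where K = 1])
    (auto simp: h01_l2_add h01_l2_scaleR norm_h01_eq h01_l2_def[symmetric] h01_dx_def[symmetric])

text \<open>The equation v_t = \<phi> is an identity in L^2; this lifts it to \<open>h01\<close>, so
  that v_t may be differentiated in x. The difference has weak derivative g with zero underlying
  function, so g is orthogonal to derivatives of test functions (themselves test functions), hence
  to their limits, and g is such a limit.\<close>

lemma h01_l2_inject:
  assumes "h01_l2 u = h01_l2 v"
  shows "u = v"
proof -
  interpret l2: bounded_linear h01_l2 by (rule bounded_linear_h01_l2)
  let ?g = "h01_dx (u - v)"
  have "has_weak_deriv 0 ?g"
    using h01_has_weak_deriv[of "u - v"] assms by (simp add: l2.diff)
  then have "test_graph \<subseteq> {p. inner ?g (snd p) = 0}"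
    by (auto simp: test_graph_def has_weak_deriv_def dest: test_functions_deriv)
  moreover have "closed {p :: l2 \<times> l2. inner ?g (snd p) = 0}"
    by (intro closed_Collect_eq continuous_intros)
  ultimately have "closure test_graph \<subseteq> {p. inner ?g (snd p) = 0}"
    by (intro closure_minimal)
  then have "inner ?g ?g = 0"
    using Rep_h01[of "u - v"] by (auto simp: h01_dx_def)
  then have "norm (u - v) = 0" by (simp add: norm_h01_eq)
  then show ?thesis by simp
qed

section \<open>Representatives of L^2 classes\<close>

lemma square_integrable_rep_l2: "square_integrable (rep_l2 f)"
  using Quotient3_rep_reflp[OF Quotient3_l2] by blast

lemma abs_rep_l2: "abs_l2 (rep_l2 f) = f"
  by (rule Quotient3_abs_rep[OF Quotient3_l2])

lemma rep_abs_l2: "square_integrable f \<Longrightarrow> AE x in unit_leb. rep_l2 (abs_l2 f) x = f x"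
  using Quotient3_rep_abs[OF Quotient3_l2, of f] by simp

lemma norm_l2_eq_integral: "(norm f)\<^sup>2 = (\<integral>x. (rep_l2 f x)\<^sup>2 \<partial>unit_leb)"
proof -
  have "inner (abs_l2 (rep_l2 f)) (abs_l2 (rep_l2 f)) = (\<integral>x. rep_l2 f x * rep_l2 f x \<partial>unit_leb)"
    by (rule inner_l2.abs_eq) (auto simp: square_integrable_rep_l2)
  then show ?thesis by (simp add: abs_rep_l2 power2_norm_eq_inner flip: power2_eq_square)
qed

lemma rep_l2_linear:
  "AE x in unit_leb. rep_l2 (f + r *\<^sub>R g + s *\<^sub>R h) x = rep_l2 f x + r * rep_l2 g x + s * rep_l2 h x"
proof -
  note sq = square_integrable_add square_integrable_scale square_integrable_rep_l2
  have "f + r *\<^sub>R g + s *\<^sub>R h = abs_l2 (\<lambda>x. rep_l2 f x + r * rep_l2 g x + s * rep_l2 h x)"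
    by (simp add: abs_l2_add abs_l2_scale sq abs_rep_l2)
  then show ?thesis
    using rep_abs_l2[of "\<lambda>x. rep_l2 f x + r * rep_l2 g x + s * rep_l2 h x"] sq by simp
qed

text \<open>Since \<open>k\<close> is not assumed measurable, the norm of its product with
  \<open>\<theta>\<close> is avoided: (p + q)^2 is bounded by 2 p^2 + 2 q^2 pointwise,
  \<open>k\<close> is replaced by its bound, and only then is the inequality integrated.\<close>

lemma norm_l2_forcing_bound:
  assumes f: "AE x in unit_leb. rep_l2 f x = rep_l2 \<theta> x * k x + rep_l2 \<delta> x"
    and k: "\<And>x. x \<in> {0..1} \<Longrightarrow> \<bar>k x\<bar> \<le> \<bar>y\<bar>"
  shows "(norm f)\<^sup>2 \<le> 2 * y\<^sup>2 * (norm \<theta>)\<^sup>2 + 2 * (norm \<delta>)\<^sup>2"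
proof -
  have sq: "integrable unit_leb (\<lambda>x. (rep_l2 g x)\<^sup>2)" for g
    using square_integrable_rep_l2[of g] by (simp add: square_integrable_def)
  have "AE x in unit_leb. x \<in> {0<..<1}" by (rule AE_I2) simp
  with f have "AE x in unit_leb. (rep_l2 f x)\<^sup>2 \<le> 2 * y\<^sup>2 * (rep_l2 \<theta> x)\<^sup>2 + 2 * (rep_l2 \<delta> x)\<^sup>2"
  proof eventually_elim
    case (elim x)
    let ?p = "rep_l2 \<theta> x * k x" and ?q = "rep_l2 \<delta> x"
    have "(rep_l2 f x)\<^sup>2 \<le> 2 * ?p\<^sup>2 + 2 * ?q\<^sup>2"
      using elim(1) sum_squares_bound[of ?p ?q] by (simp add: power2_sum)
    moreover have "(k x)\<^sup>2 \<le> y\<^sup>2"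
      using k[of x] elim(2) by (simp add: abs_le_square_iff)
    then have "?p\<^sup>2 \<le> y\<^sup>2 * (rep_l2 \<theta> x)\<^sup>2"
      by (simp add: power_mult_distrib mult.commute mult_right_mono)
    ultimately show ?case by linarith
  qed
  then have "(\<integral>x. (rep_l2 f x)\<^sup>2 \<partial>unit_leb)
      \<le> (\<integral>x. 2 * y\<^sup>2 * (rep_l2 \<theta> x)\<^sup>2 + 2 * (rep_l2 \<delta> x)\<^sup>2 \<partial>unit_leb)"
    by (intro integral_mono_AE Bochner_Integration.integrable_add integrable_mult_right sq)
  also have "\<dots> = 2 * y\<^sup>2 * (norm \<theta>)\<^sup>2 + 2 * (norm \<delta>)\<^sup>2"
    using sq by (simp add: norm_l2_eq_integral)
  finally show ?thesis by (simp add: norm_l2_eq_integral)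
qed

section \<open>Dissipation of the wave energy\<close>

lemma has_real_derivative_norm_power2:
  fixes X :: "real \<Rightarrow> 'a::real_inner"
  assumes "(X has_vector_derivative X') (at t)"
  shows "((\<lambda>t. (norm (X t))\<^sup>2) has_real_derivative 2 * inner (X t) X') (at t)"
proof -
  have "((\<lambda>t. inner (X t) (X t)) has_vector_derivative (inner (X t) X' + inner X' (X t))) (at t)"
    by (rule bounded_bilinear.has_vector_derivative[OF bounded_bilinear_inner assms assms])
  then show ?thesis
    by (simp add: power2_norm_eq_inner inner_commute has_real_derivative_iff_has_vector_derivative)
qed

text \<open>This is \<open>G\<close>, that is, twice the sum of the squares of (c^2 + 1)/(\<sigma>
  c^2) and 1/(c^2 \<pi>), the two coefficients of the forcing in \<open>wave_cross_terms\<close>.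
  The factor 2 pays for separating the forcing into its \<open>\<theta>1\<close> and
  \<open>\<delta>\<close> parts.\<close>

definition wave_gain :: "real \<Rightarrow> real \<Rightarrow> real" where
  "wave_gain c \<sigma> = 2 * (((c\<^sup>2 + 1)\<^sup>2 * pi\<^sup>2 + \<sigma>\<^sup>2) / (\<sigma>\<^sup>2 * c ^ 4 * pi\<^sup>2))"

lemma Phi_lower:
  assumes "0 < \<sigma>"
  shows "1 / \<sigma> * (norm w)\<^sup>2 \<le> Phi c \<sigma> w"
proof -
  obtain v \<phi> where w: "w = (v, \<phi>)" by (cases w)
  have "1 / \<sigma> * (norm (h01_dx v))\<^sup>2 \<le> (c\<^sup>2 + 1) / \<sigma> * (norm (h01_dx v))\<^sup>2"
    using assms by (intro mult_right_mono divide_right_mono) auto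
  moreover have "0 \<le> 1 / (\<sigma> * c\<^sup>2) * (norm (\<phi> + \<sigma> *\<^sub>R h01_l2 v))\<^sup>2"
    using assms by simp
  ultimately show ?thesis
    by (simp add: w Phi_def norm_state add_divide_distrib)
qed

text \<open>The origin of \<open>k2\<close>: expand the last square as at most twice the sum of
  squares and use the Poincare inequality; the two entries of the maximum are the resulting
  coefficients of the two squared norms.\<close>

lemma Phi_upper:
  assumes "0 < \<sigma>" "0 < c"
  shows "Phi c \<sigma> w \<le> 1 / \<sigma> * max (c\<^sup>2 + 1 + 2 * \<sigma>\<^sup>2 / (c\<^sup>2 * pi\<^sup>2)) (1 + 2 / c\<^sup>2) * (norm w)\<^sup>2"
proof -
  obtain v \<phi> where w: "w = (v, \<phi>)" by (cases w)
  let ?n = "(norm (h01_dx v))\<^sup>2" and ?m = "(norm \<phi>)\<^sup>2"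
  let ?M = "max (c\<^sup>2 + 1 + 2 * \<sigma>\<^sup>2 / (c\<^sup>2 * pi\<^sup>2)) (1 + 2 / c\<^sup>2)"
  have "(pi * norm (h01_l2 v))\<^sup>2 \<le> ?n"
    by (intro power_mono h01_poincare) auto
  then have p: "(norm (h01_l2 v))\<^sup>2 \<le> ?n / pi\<^sup>2"
    by (simp add: field_simps power_mult_distrib)
  have "(norm (\<phi> + \<sigma> *\<^sub>R h01_l2 v))\<^sup>2 \<le> (norm \<phi> + \<sigma> * norm (h01_l2 v))\<^sup>2"
    using norm_triangle_ineq[of \<phi> "\<sigma> *\<^sub>R h01_l2 v"] assms by (intro power_mono) auto
  also have "\<dots> \<le> 2 * ?m + 2 * (\<sigma>\<^sup>2 * (norm (h01_l2 v))\<^sup>2)"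
    using sum_squares_bound[of "norm \<phi>" "\<sigma> * norm (h01_l2 v)"]
    by (simp add: power2_sum power_mult_distrib)
  also have "\<dots> \<le> 2 * ?m + 2 * (\<sigma>\<^sup>2 * (?n / pi\<^sup>2))"
    by (intro add_left_mono mult_left_mono p) auto
  finally have "1 / (\<sigma> * c\<^sup>2) * (norm (\<phi> + \<sigma> *\<^sub>R h01_l2 v))\<^sup>2
      \<le> 1 / (\<sigma> * c\<^sup>2) * (2 * ?m + 2 * (\<sigma>\<^sup>2 * (?n / pi\<^sup>2)))"
    using assms by (intro mult_left_mono) auto
  then have "Phi c \<sigma> w \<le> (c\<^sup>2 + 1) / \<sigma> * ?n + 1 / \<sigma> * ?m + 1 / (\<sigma> * c\<^sup>2) * (2 * ?m + 2 * (\<sigma>\<^sup>2 * (?n / pi\<^sup>2)))"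
    by (simp add: w Phi_def)
  also have "\<dots> = 1 / \<sigma> * ((c\<^sup>2 + 1 + 2 * \<sigma>\<^sup>2 / (c\<^sup>2 * pi\<^sup>2)) * ?n + (1 + 2 / c\<^sup>2) * ?m)"
    using assms by (simp add: field_simps)
  also have "\<dots> \<le> 1 / \<sigma> * (?M * ?n + ?M * ?m)"
    using assms by (intro mult_left_mono add_mono mult_right_mono) auto
  also have "\<dots> = 1 / \<sigma> * ?M * (norm w)\<^sup>2"
    by (simp add: w norm_state distrib_left mult.assoc)
  finally show ?thesis .
qed

text \<open>The letters stand for norms, n for that of v_x. The Young weights are such that the
  cross terms consume one of the two copies of \<phi>^2 + n^2 that the energy dissipates.\<close>

lemma wave_cross_terms:
  fixes v \<phi> f n c \<sigma> :: real
  assumes "0 < \<sigma>" "0 < c" "pi * v \<le> n" "0 \<le> v" "0 \<le> f"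
  shows "2 * (c\<^sup>2 + 1) / (\<sigma> * c\<^sup>2) * (\<phi> * f) + 2 / c\<^sup>2 * (v * f)
    \<le> \<phi>\<^sup>2 + n\<^sup>2 + wave_gain c \<sigma> / 2 * f\<^sup>2"
proof -
  have yg: "2 * (p * q) \<le> p\<^sup>2 + q\<^sup>2" for p q :: real
    using sum_squares_bound[of p q] by simp
  have "2 * (\<phi> * ((c\<^sup>2 + 1) / (\<sigma> * c\<^sup>2) * f)) \<le> \<phi>\<^sup>2 + ((c\<^sup>2 + 1) / (\<sigma> * c\<^sup>2) * f)\<^sup>2"
    by (rule yg)
  moreover have "2 / c\<^sup>2 * (v * f) \<le> 2 * (n * (1 / (c\<^sup>2 * pi) * f))"
  proof -
    have "2 / (c\<^sup>2 * pi) * f * (pi * v) \<le> 2 / (c\<^sup>2 * pi) * f * n"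
      using assms by (intro mult_left_mono) auto
    then show ?thesis by (simp add: mult_ac)
  qed
  moreover have "2 * (n * (1 / (c\<^sup>2 * pi) * f)) \<le> n\<^sup>2 + (1 / (c\<^sup>2 * pi) * f)\<^sup>2"
    by (rule yg)
  moreover have "((c\<^sup>2 + 1) / (\<sigma> * c\<^sup>2) * f)\<^sup>2 + (1 / (c\<^sup>2 * pi) * f)\<^sup>2 = wave_gain c \<sigma> / 2 * f\<^sup>2"
  proof -
    have "(k / (\<sigma> * c\<^sup>2) * f)\<^sup>2 + (1 / (c\<^sup>2 * pi) * f)\<^sup>2
        = 2 * ((k\<^sup>2 * pi\<^sup>2 + \<sigma>\<^sup>2) / (\<sigma>\<^sup>2 * c ^ 4 * pi\<^sup>2)) / 2 * f\<^sup>2" for k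
      using assms by (simp add: power_mult_distrib power_divide field_simps)
    then show ?thesis unfolding wave_gain_def .
  qed
  ultimately show ?thesis by (simp add: mult_ac)
qed

text \<open>The coefficients of Phi make the products of v_x and \<phi>_x cancel: they sum to 2(c^2
  + 1)/\<sigma> - 2c^2/\<sigma> - 2/\<sigma> = 0. The damping yields - 2 |\<phi>|^2, and the mixed
  term \<phi> + \<sigma> v yields the missing - 2 |v_x|^2.\<close>

lemma Phi_dissipation:
  fixes w :: "real \<Rightarrow> state"
  assumes pos: "0 < \<sigma>" "0 < c"
    and w: "w t = (h2_h01 v, h01_l2 \<phi>)"
    and deriv: "(w has_vector_derivative w') (at t)"
    and eq: "wave_equation c \<sigma> K \<theta> \<delta> v \<phi> y w'"
    and K: "\<And>x. x \<in> {0..1} \<Longrightarrow> \<bar>K x y\<bar> \<le> \<bar>y\<bar>"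
  shows "\<exists>D. ((\<lambda>t. Phi c \<sigma> (w t)) has_real_derivative D) (at t) \<and>
    D \<le> - (norm (w t))\<^sup>2 + wave_gain c \<sigma> * (norm \<theta>)\<^sup>2 * y\<^sup>2 + wave_gain c \<sigma> * (norm \<delta>)\<^sup>2"
proof -
  obtain v' \<phi>' where w': "w' = (v', \<phi>')" by (cases w')
  have "h01_l2 v' = h01_l2 \<phi>"
    using eq by (simp add: wave_equation_def w')
  then have v': "v' = \<phi>" by (rule h01_l2_inject)
  \<comment> \<open>The forcing, obtained as the residual of the equation, so that it is an element
    of \<open>l2\<close> from the start.\<close>
  define f where "f = \<phi>' + (- c\<^sup>2) *\<^sub>R h2_dxx v + \<sigma> *\<^sub>R h01_l2 \<phi>"
  have \<phi>': "\<phi>' = c\<^sup>2 *\<^sub>R h2_dxx v - \<sigma> *\<^sub>R h01_l2 \<phi> + f" by (simp add: f_def)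
  have "AE x in unit_leb. rep_l2 \<phi>' x = c\<^sup>2 * rep_l2 (h2_dxx v) x - \<sigma> * rep_l2 (h01_l2 \<phi>) x
      + rep_l2 \<theta> x * K x y + rep_l2 \<delta> x"
    using eq by (simp add: wave_equation_def w')
  then have "AE x in unit_leb. rep_l2 f x = rep_l2 \<theta> x * K x y + rep_l2 \<delta> x"
    using rep_l2_linear[of \<phi>' "- c\<^sup>2" "h2_dxx v" \<sigma> "h01_l2 \<phi>"]
    unfolding f_def by eventually_elim simp
  then have nf: "(norm f)\<^sup>2 \<le> 2 * y\<^sup>2 * (norm \<theta>)\<^sup>2 + 2 * (norm \<delta>)\<^sup>2"
    using K by (rule norm_l2_forcing_bound)
  have dv: "((\<lambda>t. fst (w t)) has_vector_derivative \<phi>) (at t)"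
    and dp: "((\<lambda>t. snd (w t)) has_vector_derivative \<phi>') (at t)"
    using bounded_linear.has_vector_derivative[OF bounded_linear_fst deriv]
      bounded_linear.has_vector_derivative[OF bounded_linear_snd deriv]
    by (simp_all add: w' v')
  let ?vx = "h01_dx (h2_h01 v)" and ?\<phi> = "h01_l2 \<phi>" and ?v = "h01_l2 (h2_h01 v)"
  have d1: "((\<lambda>t. (norm (h01_dx (fst (w t))))\<^sup>2) has_real_derivative 2 * inner ?vx (h01_dx \<phi>)) (at t)"
    using has_real_derivative_norm_power2[OF bounded_linear.has_vector_derivative[OF bounded_linear_h01_dx dv]]
    by (simp add: w)
  have d2: "((\<lambda>t. (norm (snd (w t)))\<^sup>2) has_real_derivative 2 * inner ?\<phi> \<phi>') (at t)"
    using has_real_derivative_norm_power2[OF dp] by (simp add: w)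
  have "((\<lambda>t. snd (w t) + \<sigma> *\<^sub>R h01_l2 (fst (w t))) has_vector_derivative \<phi>' + \<sigma> *\<^sub>R ?\<phi>) (at t)"
    by (intro has_vector_derivative_add dp
        bounded_linear.has_vector_derivative[OF bounded_linear_scaleR_right]
        bounded_linear.has_vector_derivative[OF bounded_linear_h01_l2 dv])
  then have d3: "((\<lambda>t. (norm (snd (w t) + \<sigma> *\<^sub>R h01_l2 (fst (w t))))\<^sup>2) has_real_derivative
      2 * inner (?\<phi> + \<sigma> *\<^sub>R ?v) (\<phi>' + \<sigma> *\<^sub>R ?\<phi>)) (at t)"
    using has_real_derivative_norm_power2 by (force simp: w)
  define D where "D = (c\<^sup>2 + 1) / \<sigma> * (2 * inner ?vx (h01_dx \<phi>)) + 1 / \<sigma> * (2 * inner ?\<phi> \<phi>')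
      + 1 / (\<sigma> * c\<^sup>2) * (2 * inner (?\<phi> + \<sigma> *\<^sub>R ?v) (\<phi>' + \<sigma> *\<^sub>R ?\<phi>))"
  have "((\<lambda>t. Phi c \<sigma> (w t)) has_real_derivative D) (at t)"
    unfolding D_def Phi_def case_prod_beta
    by (intro DERIV_add DERIV_cmult d1 d2 d3)
  moreover have "D \<le> - (norm (w t))\<^sup>2 + wave_gain c \<sigma> * (norm \<theta>)\<^sup>2 * y\<^sup>2 + wave_gain c \<sigma> * (norm \<delta>)\<^sup>2"
  proof -
    have parts: "inner ?\<phi> (h2_dxx v) = - inner ?vx (h01_dx \<phi>)" "inner ?v (h2_dxx v) = - (norm ?vx)\<^sup>2"
      by (simp_all only: h2_parts power2_norm_eq_inner inner_commute[of ?vx "h01_dx \<phi>"])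
    have e1: "inner ?\<phi> \<phi>' = - c\<^sup>2 * inner ?vx (h01_dx \<phi>) - \<sigma> * (norm ?\<phi>)\<^sup>2 + inner ?\<phi> f"
      by (simp add: \<phi>' inner_add_right inner_diff_right parts power2_norm_eq_inner)
    \<comment> \<open>The damping drops out of the derivative of \<phi> + \<sigma> v, which is why
      this combination occurs in Phi.\<close>
    have "\<phi>' + \<sigma> *\<^sub>R ?\<phi> = c\<^sup>2 *\<^sub>R h2_dxx v + f" by (simp add: \<phi>')
    then have e2: "inner (?\<phi> + \<sigma> *\<^sub>R ?v) (\<phi>' + \<sigma> *\<^sub>R ?\<phi>)
        = - c\<^sup>2 * inner ?vx (h01_dx \<phi>) - \<sigma> * c\<^sup>2 * (norm ?vx)\<^sup>2 + inner ?\<phi> f + \<sigma> * inner ?v f"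
      by (simp add: inner_add_right inner_add_left parts algebra_simps)
    have "D = - 2 * (norm ?\<phi>)\<^sup>2 - 2 * (norm ?vx)\<^sup>2
        + (2 * (c\<^sup>2 + 1) / (\<sigma> * c\<^sup>2) * inner ?\<phi> f + 2 / c\<^sup>2 * inner ?v f)"
      unfolding D_def e1 e2 using pos by (simp add: field_simps)
    also have "\<dots> \<le> - 2 * (norm ?\<phi>)\<^sup>2 - 2 * (norm ?vx)\<^sup>2
        + (2 * (c\<^sup>2 + 1) / (\<sigma> * c\<^sup>2) * (norm ?\<phi> * norm f) + 2 / c\<^sup>2 * (norm ?v * norm f))"
      using pos by (intro add_left_mono add_mono mult_left_mono norm_cauchy_schwarz) auto
    also have "\<dots> \<le> - 2 * (norm ?\<phi>)\<^sup>2 - 2 * (norm ?vx)\<^sup>2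
        + ((norm ?\<phi>)\<^sup>2 + (norm ?vx)\<^sup>2 + wave_gain c \<sigma> / 2 * (norm f)\<^sup>2)"
      using pos by (intro add_left_mono wave_cross_terms h01_poincare) auto
    also have "\<dots> = - (norm (w t))\<^sup>2 + wave_gain c \<sigma> / 2 * (norm f)\<^sup>2"
      by (simp add: w norm_state)
    also have "\<dots> \<le> - (norm (w t))\<^sup>2 + wave_gain c \<sigma> / 2 * (2 * y\<^sup>2 * (norm \<theta>)\<^sup>2 + 2 * (norm \<delta>)\<^sup>2)"
      using nf pos by (intro add_left_mono mult_left_mono) (auto simp: wave_gain_def)
    also have "\<dots> = - (norm (w t))\<^sup>2 + wave_gain c \<sigma> * (norm \<theta>)\<^sup>2 * y\<^sup>2 + wave_gain c \<sigma> * (norm \<delta>)\<^sup>2"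
      by (simp add: algebra_simps)
    finally show ?thesis .
  qed
  ultimately show ?thesis by blast
qed

section \<open>Domination by the feedback gain\<close>

lemma young_weighted:
  fixes u v s :: real
  assumes "0 < s"
  shows "u * v \<le> s * u\<^sup>2 + v\<^sup>2 / (4 * s)"
proof -
  have "0 \<le> (2 * s * u - v)\<^sup>2" by simp
  then have "4 * s * (u * v) \<le> 4 * s * (s * u\<^sup>2 + v\<^sup>2 / (4 * s))"
    using assms by (simp add: power2_eq_square algebra_simps)
  then show ?thesis using assms by (simp del: distrib_left_numeral)
qed

text \<open>The right-hand side is max(1, b r). It splits a unit coefficient into what the control
  supplies and a defect that vanishes once r reaches 1/b.\<close>

lemma gain_defect:
  fixes b r :: real
  assumes "0 < b"
  shows "1 \<le> b * r + b * max (1 / b - r) 0"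
  using assms by (auto simp: max_def field_simps)

text \<open>The cost of dominating a monomial \<open>m * t\<close> by a control of unknown strength:
  the defect is split by Young's inequality with weight \<open>a / r\<close>, so the square of the
  monomial has to be dominated too.\<close>

lemma gain_term:
  fixes a r b q m t :: real
  assumes "0 < a" "0 < r" "0 < b" "1 \<le> b * r + b * q" "0 \<le> m" "0 \<le> t"
  shows "m * t \<le> b * r * (m * t + m\<^sup>2 * t\<^sup>2 / (4 * a)) + a / r * (b * q\<^sup>2)"
proof -
  have "m * t \<le> (b * r + b * q) * (m * t)"
    using assms mult_right_mono[of 1 "b * r + b * q" "m * t"] by simp
  moreover have "b * (q * (m * t)) \<le> b * (a / r * q\<^sup>2 + (m * t)\<^sup>2 / (4 * (a / r)))"
    using assms by (intro mult_left_mono young_weighted) auto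
  moreover have "b * ((m * t)\<^sup>2 / (4 * (a / r))) = b * r * (m\<^sup>2 * t\<^sup>2 / (4 * a))"
    by (simp add: power_mult_distrib)
  ultimately show ?thesis by (simp add: algebra_simps)
qed

text \<open>Raises lower powers of r to a common power at the price of powers of
  \<open>\<kappa>\<close>. Thus gains computed with \<open>\<kappa>\<close> in place of r suffice
  for every larger r.\<close>

lemma power_ratio:
  fixes \<kappa> r x y :: real
  assumes "0 < \<kappa>" "\<kappa> \<le> r" "0 \<le> x" "j \<le> n"
  shows "x * r ^ j * \<kappa> ^ (n - j) \<le> x * r ^ n"
proof -
  have "r ^ j * \<kappa> ^ (n - j) \<le> r ^ j * r ^ (n - j)"
    using assms by (intro mult_left_mono power_mono) auto
  also have "\<dots> = r ^ n" using assms by (simp flip: power_add)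
  finally show ?thesis using assms by (simp add: mult.assoc mult_left_mono)
qed

lemma cross_multiply_le:
  fixes c k x y R :: real
  assumes "0 < c" "0 < k" "k * x \<le> R * y"
  shows "x / c \<le> R * (1 / (c * k) * y)"
  using assms by (simp add: field_simps)

text \<open>Comparison of the coefficients of y^2 in \<open>feedback_dominates\<close>. The summand
  \<open>2 * r\<^sup>2\<close> comes from the coupling with the wave and accounts for the term 8 a
  \<kappa>^2.\<close>

lemma gain_bound_1:
  fixes a C \<kappa> r \<phi> p :: real
  assumes "0 < a" "0 < C" "0 < \<kappa>" "\<kappa> \<le> r" "0 \<le> \<phi>"
    and p: "p \<ge> 1 / (4 * a * \<kappa> ^ 6) *
        (\<kappa> + 4 * a * C + 4 * \<kappa> ^ 3 + 4 * a * \<kappa> * \<phi> + 8 * a * \<kappa>\<^sup>2)"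
  shows "(r + 4 * a * C + 4 * r ^ 3 + 4 * a * r * \<phi>) / (4 * a) + 2 * r\<^sup>2 \<le> r ^ 6 * p"
proof -
  note R = power_ratio[OF \<open>0 < \<kappa>\<close> \<open>\<kappa> \<le> r\<close>, where n = 6]
  have "\<kappa> ^ 6 * (r + 4 * a * C + 4 * r ^ 3 + 4 * a * r * \<phi> + 8 * a * r\<^sup>2)
      \<le> r ^ 6 * (\<kappa> + 4 * a * C + 4 * \<kappa> ^ 3 + 4 * a * \<kappa> * \<phi> + 8 * a * \<kappa>\<^sup>2)"
  proof -
    have "\<kappa> * r ^ 1 * \<kappa> ^ (6 - 1) + 4 * a * C * r ^ 0 * \<kappa> ^ (6 - 0) + 4 * \<kappa> ^ 3 * r ^ 3 * \<kappa> ^ (6 - 3)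
        + 4 * a * \<kappa> * \<phi> * r ^ 1 * \<kappa> ^ (6 - 1) + 8 * a * \<kappa>\<^sup>2 * r ^ 2 * \<kappa> ^ (6 - 2)
        \<le> \<kappa> * r ^ 6 + 4 * a * C * r ^ 6 + 4 * \<kappa> ^ 3 * r ^ 6 + 4 * a * \<kappa> * \<phi> * r ^ 6 + 8 * a * \<kappa>\<^sup>2 * r ^ 6"
      using assms by (intro add_mono R) auto
    then show ?thesis
      by (simp add: algebra_simps eval_nat_numeral)
  qed
  then have "(r + 4 * a * C + 4 * r ^ 3 + 4 * a * r * \<phi> + 8 * a * r\<^sup>2) / (4 * a)
      \<le> r ^ 6 * (1 / (4 * a * \<kappa> ^ 6) *
        (\<kappa> + 4 * a * C + 4 * \<kappa> ^ 3 + 4 * a * \<kappa> * \<phi> + 8 * a * \<kappa>\<^sup>2))"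
    using assms by (intro cross_multiply_le) auto
  also have "\<dots> \<le> r ^ 6 * p"
    using assms by (intro mult_left_mono p) auto
  finally show ?thesis
    using \<open>0 < a\<close> by (simp add: add_divide_distrib)
qed

text \<open>Coefficients of y^4: the squares that \<open>gain_term\<close> creates from the two y^2
  terms, together with the original y^4 terms.\<close>

lemma gain_bound_2:
  fixes a C \<kappa> r \<phi> p :: real
  assumes "0 < a" "0 < C" "0 < \<kappa>" "\<kappa> \<le> r" "0 \<le> \<phi>"
    and p: "p \<ge> 1 / (4 * a ^ 3 * \<kappa> ^ 5) *
        (1 / (16 * \<kappa>) * (\<kappa> + 4 * a * C + 4 * \<kappa> ^ 3 + 4 * a * \<kappa> * \<phi>)\<^sup>2
          + \<kappa>\<^sup>2 + a\<^sup>2 * \<phi>\<^sup>2 + 4 * a\<^sup>2 * (\<kappa> ^ 3 + 1))"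
  shows "((r + 4 * a * C + 4 * r ^ 3 + 4 * a * r * \<phi>) / (4 * a))\<^sup>2 / (4 * a)
      + (r * (r\<^sup>2 + a\<^sup>2 * \<phi>\<^sup>2) / (4 * a ^ 3) + (2 * r\<^sup>2)\<^sup>2 / (4 * a) + r / a) \<le> r ^ 6 * p"
proof -
  note R = power_ratio[OF \<open>0 < \<kappa>\<close> \<open>\<kappa> \<le> r\<close>]
  have "\<kappa> ^ 3 * (r + 4 * a * C + 4 * r ^ 3 + 4 * a * r * \<phi>)
      \<le> r ^ 3 * (\<kappa> + 4 * a * C + 4 * \<kappa> ^ 3 + 4 * a * \<kappa> * \<phi>)"
  proof -
    have "\<kappa> * r ^ 1 * \<kappa> ^ (3 - 1) + 4 * a * C * r ^ 0 * \<kappa> ^ (3 - 0) + 4 * \<kappa> ^ 3 * r ^ 3 * \<kappa> ^ (3 - 3)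
        + 4 * a * \<kappa> * \<phi> * r ^ 1 * \<kappa> ^ (3 - 1)
        \<le> \<kappa> * r ^ 3 + 4 * a * C * r ^ 3 + 4 * \<kappa> ^ 3 * r ^ 3 + 4 * a * \<kappa> * \<phi> * r ^ 3"
      using assms by (intro add_mono R) auto
    then show ?thesis
      by (simp add: algebra_simps eval_nat_numeral)
  qed
  then have "(\<kappa> ^ 3 * (r + 4 * a * C + 4 * r ^ 3 + 4 * a * r * \<phi>))\<^sup>2
      \<le> (r ^ 3 * (\<kappa> + 4 * a * C + 4 * \<kappa> ^ 3 + 4 * a * \<kappa> * \<phi>))\<^sup>2"
    using assms by (intro power_mono) auto
  then have 1: "((r + 4 * a * C + 4 * r ^ 3 + 4 * a * r * \<phi>) / (4 * a))\<^sup>2 / (4 * a)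
      \<le> r ^ 6 * (1 / (4 * a ^ 3 * \<kappa> ^ 5) *
        (1 / (16 * \<kappa>) * (\<kappa> + 4 * a * C + 4 * \<kappa> ^ 3 + 4 * a * \<kappa> * \<phi>)\<^sup>2))"
    using assms by (simp add: power_mult_distrib power_divide divide_simps) (simp add: eval_nat_numeral mult_ac)
  have "\<kappa> ^ 5 * (r * (r\<^sup>2 + a\<^sup>2 * \<phi>\<^sup>2) + 4 * a\<^sup>2 * r ^ 4 + 4 * a\<^sup>2 * r)
      \<le> r ^ 6 * (\<kappa>\<^sup>2 + a\<^sup>2 * \<phi>\<^sup>2 + 4 * a\<^sup>2 * (\<kappa> ^ 3 + 1))"
  proof -
    have "\<kappa>\<^sup>2 * r ^ 3 * \<kappa> ^ (6 - 3) + a\<^sup>2 * \<phi>\<^sup>2 * r ^ 1 * \<kappa> ^ (6 - 1)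
        + 4 * a\<^sup>2 * \<kappa> ^ 3 * r ^ 4 * \<kappa> ^ (6 - 4) + 4 * a\<^sup>2 * r ^ 1 * \<kappa> ^ (6 - 1)
        \<le> \<kappa>\<^sup>2 * r ^ 6 + a\<^sup>2 * \<phi>\<^sup>2 * r ^ 6 + 4 * a\<^sup>2 * \<kappa> ^ 3 * r ^ 6 + 4 * a\<^sup>2 * r ^ 6"
      using assms by (intro add_mono R) auto
    then show ?thesis
      by (simp add: algebra_simps eval_nat_numeral)
  qed
  then have "(r * (r\<^sup>2 + a\<^sup>2 * \<phi>\<^sup>2) + 4 * a\<^sup>2 * r ^ 4 + 4 * a\<^sup>2 * r) / (4 * a ^ 3)
      \<le> r ^ 6 * (1 / (4 * a ^ 3 * \<kappa> ^ 5) * (\<kappa>\<^sup>2 + a\<^sup>2 * \<phi>\<^sup>2 + 4 * a\<^sup>2 * (\<kappa> ^ 3 + 1)))"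
    using assms by (intro cross_multiply_le) auto
  moreover have "(r * (r\<^sup>2 + a\<^sup>2 * \<phi>\<^sup>2) + 4 * a\<^sup>2 * r ^ 4 + 4 * a\<^sup>2 * r) / (4 * a ^ 3)
      = r * (r\<^sup>2 + a\<^sup>2 * \<phi>\<^sup>2) / (4 * a ^ 3) + (2 * r\<^sup>2)\<^sup>2 / (4 * a) + r / a"
    using assms by (simp add: field_simps eval_nat_numeral)
  ultimately have "((r + 4 * a * C + 4 * r ^ 3 + 4 * a * r * \<phi>) / (4 * a))\<^sup>2 / (4 * a)
      + (r * (r\<^sup>2 + a\<^sup>2 * \<phi>\<^sup>2) / (4 * a ^ 3) + (2 * r\<^sup>2)\<^sup>2 / (4 * a) + r / a)
    \<le> r ^ 6 * (1 / (4 * a ^ 3 * \<kappa> ^ 5) *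
        (1 / (16 * \<kappa>) * (\<kappa> + 4 * a * C + 4 * \<kappa> ^ 3 + 4 * a * \<kappa> * \<phi>)\<^sup>2
          + \<kappa>\<^sup>2 + a\<^sup>2 * \<phi>\<^sup>2 + 4 * a\<^sup>2 * (\<kappa> ^ 3 + 1)))"
    using 1 by (simp only: distrib_left add.assoc)
  also have "\<dots> \<le> r ^ 6 * p"
    using assms by (intro mult_left_mono p) auto
  finally show ?thesis .
qed

text \<open>Coefficients of y^8: only the squares that \<open>gain_term\<close> creates from the two
  y^4 terms.\<close>

lemma gain_bound_3:
  fixes a \<kappa> r \<phi> p :: real
  assumes "0 < a" "0 < \<kappa>" "\<kappa> \<le> r"
    and p: "p \<ge> 1 / (64 * a ^ 7 * \<kappa> ^ 4) * ((\<kappa>\<^sup>2 + a\<^sup>2 * \<phi>\<^sup>2)\<^sup>2 + 16 * a ^ 4)"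
  shows "(r * (r\<^sup>2 + a\<^sup>2 * \<phi>\<^sup>2) / (4 * a ^ 3))\<^sup>2 / (4 * a) + (r / a)\<^sup>2 / (4 * a) \<le> r ^ 6 * p"
proof -
  note R = power_ratio[OF \<open>0 < \<kappa>\<close> \<open>\<kappa> \<le> r\<close>]
  have "\<kappa>\<^sup>2 * (r * (r\<^sup>2 + a\<^sup>2 * \<phi>\<^sup>2)) \<le> r ^ 3 * (\<kappa>\<^sup>2 + a\<^sup>2 * \<phi>\<^sup>2)"
  proof -
    have "\<kappa>\<^sup>2 * r ^ 3 * \<kappa> ^ (3 - 3) + a\<^sup>2 * \<phi>\<^sup>2 * r ^ 1 * \<kappa> ^ (3 - 1)
        \<le> \<kappa>\<^sup>2 * r ^ 3 + a\<^sup>2 * \<phi>\<^sup>2 * r ^ 3"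
      using assms by (intro add_mono R) auto
    then show ?thesis
      by (simp add: algebra_simps eval_nat_numeral)
  qed
  then have "(\<kappa>\<^sup>2 * (r * (r\<^sup>2 + a\<^sup>2 * \<phi>\<^sup>2)))\<^sup>2 \<le> (r ^ 3 * (\<kappa>\<^sup>2 + a\<^sup>2 * \<phi>\<^sup>2))\<^sup>2"
    using assms by (intro power_mono) auto
  then have "\<kappa> ^ 4 * (r * (r\<^sup>2 + a\<^sup>2 * \<phi>\<^sup>2))\<^sup>2 \<le> r ^ 6 * (\<kappa>\<^sup>2 + a\<^sup>2 * \<phi>\<^sup>2)\<^sup>2"
    unfolding power_mult_distrib[of "\<kappa>\<^sup>2"] power_mult_distrib[of "r ^ 3"] by simp
  moreover have "16 * a ^ 4 * r\<^sup>2 * \<kappa> ^ 4 \<le> 16 * a ^ 4 * r ^ 6"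
    using assms R[of "16 * a ^ 4" 2 6] by simp
  ultimately have "\<kappa> ^ 4 * ((r * (r\<^sup>2 + a\<^sup>2 * \<phi>\<^sup>2))\<^sup>2 + 16 * a ^ 4 * r\<^sup>2)
      \<le> r ^ 6 * ((\<kappa>\<^sup>2 + a\<^sup>2 * \<phi>\<^sup>2)\<^sup>2 + 16 * a ^ 4)"
    by (simp only: distrib_left) (simp add: mult_ac)
  then have "((r * (r\<^sup>2 + a\<^sup>2 * \<phi>\<^sup>2))\<^sup>2 + 16 * a ^ 4 * r\<^sup>2) / (64 * a ^ 7)
      \<le> r ^ 6 * (1 / (64 * a ^ 7 * \<kappa> ^ 4) * ((\<kappa>\<^sup>2 + a\<^sup>2 * \<phi>\<^sup>2)\<^sup>2 + 16 * a ^ 4))"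
    using assms by (intro cross_multiply_le) auto
  moreover have "((r * (r\<^sup>2 + a\<^sup>2 * \<phi>\<^sup>2))\<^sup>2 + 16 * a ^ 4 * r\<^sup>2) / (64 * a ^ 7)
      = (r * (r\<^sup>2 + a\<^sup>2 * \<phi>\<^sup>2) / (4 * a ^ 3))\<^sup>2 / (4 * a) + (r / a)\<^sup>2 / (4 * a)"
    using assms by (simp add: power_divide add_divide_distrib eval_nat_numeral)
  ultimately have "(r * (r\<^sup>2 + a\<^sup>2 * \<phi>\<^sup>2) / (4 * a ^ 3))\<^sup>2 / (4 * a) + (r / a)\<^sup>2 / (4 * a)
    \<le> r ^ 6 * (1 / (64 * a ^ 7 * \<kappa> ^ 4) * ((\<kappa>\<^sup>2 + a\<^sup>2 * \<phi>\<^sup>2)\<^sup>2 + 16 * a ^ 4))"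
    by linarith
  also have "\<dots> \<le> r ^ 6 * p"
    using assms by (intro mult_left_mono p) auto
  finally show ?thesis .
qed

text \<open>\<open>M\<close> is what the y-equation alone requires and \<open>M'\<close> what the
  coupling with the wave adds. Each consists of two monomials, and every monomial costs one defect
  \<open>b * q\<^sup>2\<close>; this explains the factor 2 in \<open>B\<close> and the factor 4 in
  \<open>Z\<close>.\<close>

lemma feedback_dominates:
  fixes a C \<kappa> r \<phi> p1 p2 p3 b y :: real
  assumes "0 < a" "0 < C" "0 < \<kappa>" "\<kappa> \<le> r" "0 \<le> \<phi>" "0 < b"
    and p1: "p1 \<ge> 1 / (4 * a * \<kappa> ^ 6) *
        (\<kappa> + 4 * a * C + 4 * \<kappa> ^ 3 + 4 * a * \<kappa> * \<phi> + 8 * a * \<kappa>\<^sup>2)"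
    and p2: "p2 \<ge> 1 / (4 * a ^ 3 * \<kappa> ^ 5) *
        (1 / (16 * \<kappa>) * (\<kappa> + 4 * a * C + 4 * \<kappa> ^ 3 + 4 * a * \<kappa> * \<phi>)\<^sup>2
          + \<kappa>\<^sup>2 + a\<^sup>2 * \<phi>\<^sup>2 + 4 * a\<^sup>2 * (\<kappa> ^ 3 + 1))"
    and p3: "p3 \<ge> 1 / (64 * a ^ 7 * \<kappa> ^ 4) * ((\<kappa>\<^sup>2 + a\<^sup>2 * \<phi>\<^sup>2)\<^sup>2 + 16 * a ^ 4)"
  defines "q \<equiv> max (1 / b - r) 0"
  defines "F \<equiv> b * r ^ 7 * (p1 + p2 * y\<^sup>2 + p3 * y ^ 6) * y\<^sup>2"
    and "M \<equiv> (r + 4 * a * C + 4 * r ^ 3 + 4 * a * r * \<phi>) / (4 * a) * y\<^sup>2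
      + r * (r\<^sup>2 + a\<^sup>2 * \<phi>\<^sup>2) / (4 * a ^ 3) * y ^ 4"
    and "M' \<equiv> 2 * r\<^sup>2 * y\<^sup>2 + r / a * y ^ 4"
  shows "M \<le> F + a / r * (2 * b * q\<^sup>2)" "M + M' \<le> F + a / r * (4 * b * q\<^sup>2)"
proof -
  have "0 < r" using assms by linarith
  define m1 where "m1 = (r + 4 * a * C + 4 * r ^ 3 + 4 * a * r * \<phi>) / (4 * a)"
  define m2 where "m2 = r * (r\<^sup>2 + a\<^sup>2 * \<phi>\<^sup>2) / (4 * a ^ 3)"
  define m3 where "m3 = 2 * r\<^sup>2"
  define m4 where "m4 = r / a"
  have nn: "0 \<le> m1" "0 \<le> m2" "0 \<le> m3" "0 \<le> m4"
    using assms \<open>0 < r\<close> by (auto simp: m1_def m2_def m3_def m4_def)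
  have q: "1 \<le> b * r + b * q"
    unfolding q_def by (rule gain_defect[OF \<open>0 < b\<close>])
  note T = gain_term[OF \<open>0 < a\<close> \<open>0 < r\<close> \<open>0 < b\<close> q]
  define n1 where "n1 = b * r * (m1 * y\<^sup>2 + m1\<^sup>2 / (4 * a) * y ^ 4)"
  define n2 where "n2 = b * r * (m2 * y ^ 4 + m2\<^sup>2 / (4 * a) * y ^ 8)"
  define n3 where "n3 = b * r * (m3 * y\<^sup>2 + m3\<^sup>2 / (4 * a) * y ^ 4)"
  define n4 where "n4 = b * r * (m4 * y ^ 4 + m4\<^sup>2 / (4 * a) * y ^ 8)"
  define Q where "Q = a / r * (b * q\<^sup>2)"
  have T1: "m1 * y\<^sup>2 \<le> n1 + Q"
    and T3: "m3 * y\<^sup>2 \<le> n3 + Q"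
    using T[of m1 "y\<^sup>2"] T[of m3 "y\<^sup>2"] nn by (simp_all add: n1_def n2_def n3_def n4_def Q_def)
  have T2: "m2 * y ^ 4 \<le> n2 + Q"
    and T4: "m4 * y ^ 4 \<le> n4 + Q"
    using T[of m2 "y ^ 4"] T[of m4 "y ^ 4"] nn by (simp_all add: n1_def n2_def n3_def n4_def Q_def)
  have e: "y ^ 6 * y\<^sup>2 = y ^ 8" "y\<^sup>2 * y\<^sup>2 = y ^ 4" by (simp_all flip: power_add)
  have "(m1 + m3) * y\<^sup>2 + (m1\<^sup>2 / (4 * a) + (m2 + m3\<^sup>2 / (4 * a) + m4)) * y ^ 4
      + (m2\<^sup>2 / (4 * a) + m4\<^sup>2 / (4 * a)) * y ^ 8
      \<le> r ^ 6 * p1 * y\<^sup>2 + r ^ 6 * p2 * y ^ 4 + r ^ 6 * p3 * y ^ 8"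
    using gain_bound_1[OF assms(1-5) p1] gain_bound_2[OF assms(1-5) p2]
      gain_bound_3[OF assms(1,3,4) p3]
    by (intro add_mono mult_right_mono) (simp_all add: m1_def m2_def m3_def m4_def)
  then have "b * r * ((m1 + m3) * y\<^sup>2 + (m1\<^sup>2 / (4 * a) + (m2 + m3\<^sup>2 / (4 * a) + m4)) * y ^ 4
      + (m2\<^sup>2 / (4 * a) + m4\<^sup>2 / (4 * a)) * y ^ 8)
      \<le> b * r * (r ^ 6 * p1 * y\<^sup>2 + r ^ 6 * p2 * y ^ 4 + r ^ 6 * p3 * y ^ 8)"
    using \<open>0 < b\<close> \<open>0 < r\<close> by (intro mult_left_mono) auto
  also have "\<dots> = F"
    unfolding F_def e[symmetric] by (simp add: algebra_simps eval_nat_numeral)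
  finally have F: "n1 + n2 + (n3 + n4) \<le> F"
    by (simp add: n1_def n2_def n3_def n4_def algebra_simps)
  have M: "M = m1 * y\<^sup>2 + m2 * y ^ 4" "M' = m3 * y\<^sup>2 + m4 * y ^ 4"
    by (simp_all add: M_def M'_def m1_def m2_def m3_def m4_def)
  have n: "0 \<le> n3" "0 \<le> n4"
    using nn \<open>0 < b\<close> \<open>0 < r\<close> \<open>0 < a\<close> by (auto simp: n3_def n4_def)
  have Q: "a / r * (2 * b * q\<^sup>2) = 2 * Q" "a / r * (4 * b * q\<^sup>2) = 4 * Q"
    by (simp_all add: Q_def)
  show "M \<le> F + a / r * (2 * b * q\<^sup>2)"
    using F T1 T2 n unfolding M Q by linarith
  show "M + M' \<le> F + a / r * (4 * b * q\<^sup>2)"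
    using F T1 T2 T3 T4 unfolding M Q by linarith
qed

lemma square_le_twice_squares:
  fixes x r u :: real
  assumes "0 \<le> x" "x \<le> r + u"
  shows "x\<^sup>2 \<le> 2 * r\<^sup>2 + 2 * u\<^sup>2"
proof -
  have "x\<^sup>2 \<le> (r + u)\<^sup>2" using assms by (intro power_mono) auto
  also have "\<dots> \<le> 2 * r\<^sup>2 + 2 * u\<^sup>2"
    using sum_squares_bound[of r u] by (simp add: power2_sum)
  finally show ?thesis .
qed

text \<open>Young's inequality is applied with weights proportional to \<open>a / r\<close>, so
  whatever is not absorbed by powers of y carries a factor that shrinks as z grows. Here s stands
  for |\<theta>2|, D for |d| and p for the excess of s over r.\<close>

lemma disturbances_dominated:
  fixes a C r \<phi> s W D y :: real
  assumes "0 < a" "0 < r" "0 \<le> \<phi>" "0 \<le> s"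
  defines "p \<equiv> max (s - r) 0"
    and "M \<equiv> (r + 4 * a * C + 4 * r ^ 3 + 4 * a * r * \<phi>) / (4 * a) * y\<^sup>2
      + r * (r\<^sup>2 + a\<^sup>2 * \<phi>\<^sup>2) / (4 * a ^ 3) * y ^ 4"
  shows "s * \<bar>y\<bar> * (W + \<phi> * \<bar>y\<bar>) + D * \<bar>y\<bar>
      \<le> M - C * y\<^sup>2 + a / r * (W\<^sup>2 / 2 + D\<^sup>2 + p\<^sup>2 + (p\<^sup>2)\<^sup>2)"
proof -
  have p: "0 \<le> p" "s \<le> r + p" by (auto simp: p_def)
  have ar: "0 < a / r" using assms by simp
  \<comment> \<open>Half the usual weight, so that W^2 keeps the coefficient a/(2r), which is less
    than 1 in the application because a < 2 \<kappa>.\<close>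
  have 1: "W * (s * \<bar>y\<bar>) \<le> a / (2 * r) * W\<^sup>2 + (s * \<bar>y\<bar>)\<^sup>2 / (4 * (a / (2 * r)))"
    using assms by (intro young_weighted) auto
  have 2: "p\<^sup>2 * (r / a * y\<^sup>2) \<le> a / r * (p\<^sup>2)\<^sup>2 + (r / a * y\<^sup>2)\<^sup>2 / (4 * (a / r))"
    by (rule young_weighted[OF ar])
  have 3: "p * (\<phi> * y\<^sup>2) \<le> a / r * p\<^sup>2 + (\<phi> * y\<^sup>2)\<^sup>2 / (4 * (a / r))"
    by (rule young_weighted[OF ar])
  have 4: "D * \<bar>y\<bar> \<le> a / r * D\<^sup>2 + \<bar>y\<bar>\<^sup>2 / (4 * (a / r))"
    by (rule young_weighted[OF ar])
  have 5: "s * (\<phi> * y\<^sup>2) \<le> (r + p) * (\<phi> * y\<^sup>2)"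
    using p assms by (intro mult_right_mono) auto
  \<comment> \<open>The r^2 part of the square is absorbed into \<open>M\<close> directly; the
    remaining p^2 y^2 is what the second Young inequality above treats.\<close>
  have "r / (2 * a) * (s\<^sup>2 * y\<^sup>2) \<le> r / (2 * a) * ((2 * r\<^sup>2 + 2 * p\<^sup>2) * y\<^sup>2)"
    using square_le_twice_squares[OF assms(4) p(2)] assms by (intro mult_left_mono mult_right_mono) auto
  moreover have "(s * \<bar>y\<bar>)\<^sup>2 / (4 * (a / (2 * r))) = r / (2 * a) * (s\<^sup>2 * y\<^sup>2)"
    using assms by (simp add: power_mult_distrib field_simps)
  moreover have "r / (2 * a) * ((2 * r\<^sup>2 + 2 * p\<^sup>2) * y\<^sup>2) = 4 * r ^ 3 / (4 * a) * y\<^sup>2 + p\<^sup>2 * (r / a * y\<^sup>2)"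
    using assms by (simp add: field_simps eval_nat_numeral)
  moreover have "(r / a * y\<^sup>2)\<^sup>2 / (4 * (a / r)) + (\<phi> * y\<^sup>2)\<^sup>2 / (4 * (a / r))
      = r * (r\<^sup>2 + a\<^sup>2 * \<phi>\<^sup>2) / (4 * a ^ 3) * y ^ 4"
    using assms by (simp add: field_simps eval_nat_numeral)
  moreover have "M = C * y\<^sup>2 + \<bar>y\<bar>\<^sup>2 / (4 * (a / r)) + 4 * r ^ 3 / (4 * a) * y\<^sup>2 + r * (\<phi> * y\<^sup>2)
      + r * (r\<^sup>2 + a\<^sup>2 * \<phi>\<^sup>2) / (4 * a ^ 3) * y ^ 4"
    unfolding M_def using assms by (simp add: add_divide_distrib distrib_right)
  moreover have "a / r * (W\<^sup>2 / 2) = a / (2 * r) * W\<^sup>2" by simp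
  moreover have "s * \<bar>y\<bar> * (W + \<phi> * \<bar>y\<bar>) = W * (s * \<bar>y\<bar>) + s * (\<phi> * y\<^sup>2)"
    by (simp add: algebra_simps flip: power2_eq_square)
  ultimately show ?thesis using 1 2 3 4 5 by (simp only: distrib_left distrib_right)
qed

text \<open>For T = R |\<theta>1| the left side is the destabilizing term in the wave dissipation.
  The powers of y on the right are exactly \<open>M'\<close> of
  \<open>feedback_dominates\<close>.\<close>

lemma coupling_dominated:
  fixes a r T y :: real
  assumes "0 < a" "0 < r" "0 \<le> T"
  shows "T\<^sup>2 * y\<^sup>2 \<le> 2 * r\<^sup>2 * y\<^sup>2 + r / a * y ^ 4 + a / r * ((max (T - r) 0)\<^sup>2)\<^sup>2"
proof -
  define \<tau> where "\<tau> = max (T - r) 0"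
  have "T\<^sup>2 * y\<^sup>2 \<le> (2 * r\<^sup>2 + 2 * \<tau>\<^sup>2) * y\<^sup>2"
    by (intro mult_right_mono square_le_twice_squares assms) (auto simp: \<tau>_def)
  moreover have "\<tau>\<^sup>2 * (2 * y\<^sup>2) \<le> a / r * (\<tau>\<^sup>2)\<^sup>2 + (2 * y\<^sup>2)\<^sup>2 / (4 * (a / r))"
    using assms by (intro young_weighted) simp
  moreover have "(2 * y\<^sup>2)\<^sup>2 / (4 * (a / r)) = r / a * y ^ 4"
    by (simp add: power_mult_distrib)
  ultimately show ?thesis unfolding \<tau>_def[symmetric] by (simp add: algebra_simps)
qed

text \<open>The first bound serves E alone. The second reserves T^2 y^2 to compensate the wave and
  is added to the dissipation of Phi.\<close>

lemma plant_estimate: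
  fixes a C \<kappa> b y z \<theta> d T W \<phi> l :: real
  assumes pos: "0 < a" "0 < C" "0 < \<kappa>" "0 < b" "0 \<le> \<phi>" "0 \<le> T"
    and P1: "P1 y \<ge> 1 / (4 * a * \<kappa> ^ 6) *
        (\<kappa> + 4 * a * C + 4 * \<kappa> ^ 3 + 4 * a * \<kappa> * \<phi> + 8 * a * \<kappa>\<^sup>2)"
    and P2: "P2 y \<ge> 1 / (4 * a ^ 3 * \<kappa> ^ 5) *
        (1 / (16 * \<kappa>) * (\<kappa> + 4 * a * C + 4 * \<kappa> ^ 3 + 4 * a * \<kappa> * \<phi>)\<^sup>2
          + \<kappa>\<^sup>2 + a\<^sup>2 * \<phi>\<^sup>2 + 4 * a\<^sup>2 * (\<kappa> ^ 3 + 1))"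
    and P3: "P3 y \<ge> 1 / (64 * a ^ 7 * \<kappa> ^ 4) * ((\<kappa>\<^sup>2 + a\<^sup>2 * \<phi>\<^sup>2)\<^sup>2 + 16 * a ^ 4)"
    and l: "\<bar>l\<bar> \<le> W + \<phi> * \<bar>y\<bar>"
  defines "D \<equiv> b * feedback \<kappa> P1 P2 P3 y z + \<theta> * l + d"
  shows "y * D \<le> - C * y\<^sup>2 + a / (\<kappa> + exp z) * (W\<^sup>2 / 2 + d\<^sup>2
        + (max (\<bar>\<theta>\<bar> - \<kappa> - exp z) 0)\<^sup>2 + ((max (\<bar>\<theta>\<bar> - \<kappa> - exp z) 0)\<^sup>2)\<^sup>2
        + 2 * b * (max (1 / b - \<kappa> - exp z) 0)\<^sup>2)"
    and "y * D + T\<^sup>2 * y\<^sup>2 \<le> - C * y\<^sup>2 + a / (\<kappa> + exp z) * (W\<^sup>2 / 2 + d\<^sup>2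
        + (max (\<bar>\<theta>\<bar> - \<kappa> - exp z) 0)\<^sup>2 + ((max (\<bar>\<theta>\<bar> - \<kappa> - exp z) 0)\<^sup>2)\<^sup>2
        + 4 * b * (max (1 / b - \<kappa> - exp z) 0)\<^sup>2 + ((max (T - \<kappa> - exp z) 0)\<^sup>2)\<^sup>2)"
proof -
  define r where "r = \<kappa> + exp z"
  have r: "0 < r" "\<kappa> \<le> r" using pos exp_gt_zero[of z] by (auto simp: r_def add_pos_pos)
  define F where "F = b * r ^ 7 * (P1 y + P2 y * y\<^sup>2 + P3 y * y ^ 6) * y\<^sup>2"
  have "\<theta> * (l * y) \<le> \<bar>\<theta>\<bar> * \<bar>y\<bar> * (W + \<phi> * \<bar>y\<bar>)"
  proof -
    have "\<theta> * (l * y) \<le> \<bar>\<theta>\<bar> * \<bar>y\<bar> * \<bar>l\<bar>"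
      using abs_ge_self[of "\<theta> * (l * y)"] by (simp add: abs_mult mult_ac)
    also have "\<dots> \<le> \<bar>\<theta>\<bar> * \<bar>y\<bar> * (W + \<phi> * \<bar>y\<bar>)"
      using l by (intro mult_left_mono) auto
    finally show ?thesis .
  qed
  moreover have "d * y \<le> \<bar>d\<bar> * \<bar>y\<bar>"
    by (metis abs_ge_self abs_mult)
  moreover have "y * D = - F + \<theta> * (l * y) + d * y"
    by (simp add: D_def F_def feedback_def r_def power2_eq_square algebra_simps)
  ultimately have yD: "y * D \<le> - F + (\<bar>\<theta>\<bar> * \<bar>y\<bar> * (W + \<phi> * \<bar>y\<bar>) + \<bar>d\<bar> * \<bar>y\<bar>)"
    by linarith
  note fb = feedback_dominates[OF pos(1-3) r(2) pos(5,4) P1 P2 P3, of y, folded F_def]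
  note db = disturbances_dominated[where C = C and s = "\<bar>\<theta>\<bar>" and W = W and D = "\<bar>d\<bar>" and y = y,
      OF pos(1) r(1) pos(5) abs_ge_zero]
    coupling_dominated[where y = y, OF pos(1) r(1) pos(6)]
  have eq: "\<bar>\<theta>\<bar> - \<kappa> - exp z = \<bar>\<theta>\<bar> - r" "1 / b - \<kappa> - exp z = 1 / b - r" "T - \<kappa> - exp z = T - r"
    by (simp_all add: r_def)
  show "y * D \<le> - C * y\<^sup>2 + a / (\<kappa> + exp z) * (W\<^sup>2 / 2 + d\<^sup>2
        + (max (\<bar>\<theta>\<bar> - \<kappa> - exp z) 0)\<^sup>2 + ((max (\<bar>\<theta>\<bar> - \<kappa> - exp z) 0)\<^sup>2)\<^sup>2
        + 2 * b * (max (1 / b - \<kappa> - exp z) 0)\<^sup>2)"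
    using yD fb(1) db(1) unfolding eq r_def[symmetric] distrib_left[of "a / r"] power2_abs
    by linarith
  show "y * D + T\<^sup>2 * y\<^sup>2 \<le> - C * y\<^sup>2 + a / (\<kappa> + exp z) * (W\<^sup>2 / 2 + d\<^sup>2
        + (max (\<bar>\<theta>\<bar> - \<kappa> - exp z) 0)\<^sup>2 + ((max (\<bar>\<theta>\<bar> - \<kappa> - exp z) 0)\<^sup>2)\<^sup>2
        + 4 * b * (max (1 / b - \<kappa> - exp z) 0)\<^sup>2 + ((max (T - \<kappa> - exp z) 0)\<^sup>2)\<^sup>2)"
    using yD fb(2) db(1) db(2) unfolding eq r_def[symmetric] distrib_left[of "a / r"] power2_abs
    by linarith
qed

section \<open>The scalar differential inequalities\<close>

lemma abs_continuous_on_increment_le: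
  fixes f :: "real \<Rightarrow> real"
  assumes f: "abs_continuous_on s t f" and "s \<le> t"
    and ae: "AE x in lebesgue. x \<in> {s<..<t} \<longrightarrow> (\<exists>D. (f has_real_derivative D) (at x) \<and> D \<le> A)"
  shows "f t - f s \<le> A * (t - s)"
proof -
  have "f t + - A * t \<le> f s + - A * s"
  proof (rule abs_continuous_on_nonincreasing[OF _ \<open>s \<le> t\<close>])
    show "abs_continuous_on s t (\<lambda>x. f x + - A * x)"
      by (intro abs_continuous_on_add abs_continuous_on_mult f abs_continuous_on_const
          abs_continuous_on_ident)
    show "AE x in lebesgue. x \<in> {s<..<t} \<longrightarrow>
        (\<exists>D\<le>0. ((\<lambda>x. f x + - A * x) has_real_derivative D) (at x))"
      using ae
    proof (eventually_elim, intro impI)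
      fix x assume "x \<in> {s<..<t} \<longrightarrow> (\<exists>D. (f has_real_derivative D) (at x) \<and> D \<le> A)" "x \<in> {s<..<t}"
      then obtain D where D: "(f has_real_derivative D) (at x)" "D \<le> A" by blast
      have "((\<lambda>x. f x + - A * x) has_real_derivative D + - A * 1) (at x)"
        by (intro DERIV_add D(1) DERIV_cmult DERIV_ident)
      then show "\<exists>D\<le>0. ((\<lambda>x. f x + - A * x) has_real_derivative D) (at x)"
        using D(2) by (intro exI[of _ "D - A"]) simp
    qed
  qed
  then show ?thesis by (simp add: algebra_simps)
qed

lemma Limsup_at_top_le_ereal:
  fixes f :: "real \<Rightarrow> real"
  assumes "\<And>e. 0 < e \<Longrightarrow> \<forall>\<^sub>F t in at_top. f t \<le> l + e"
  shows "Limsup at_top (\<lambda>t. ereal (f t)) \<le> ereal l"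
proof (rule ereal_le_epsilon2)
  fix e :: real assume "0 < e"
  then have "\<forall>\<^sub>F t in at_top. ereal (f t) \<le> ereal l + ereal e"
    using assms[of e] by simp
  then show "Limsup at_top (\<lambda>t. ereal (f t)) \<le> ereal l + ereal e"
    by (rule Limsup_bounded)
qed

text \<open>In the nontrivial case b (1/b - r)^2 is the product of 1 - b r and 1/b - r, both
  nonnegative and both decreasing in b and in r.\<close>

lemma gain_gap_antimono:
  fixes b \<beta> r r' :: real
  assumes "0 < \<beta>" "\<beta> \<le> b" "r' \<le> r" "0 \<le> r'"
  shows "b * (max (1 / b - r) 0)\<^sup>2 \<le> \<beta> * (max (1 / \<beta> - r') 0)\<^sup>2"
proof (cases "1 / b \<le> r")
  case False
  have "0 < b" using assms by linarith
  have "1 / b \<le> 1 / \<beta>" using assms by (simp add: frac_le)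
  then have le: "1 / b - r \<le> 1 / \<beta> - r'" "0 \<le> 1 / b - r" using False assms by auto
  have br: "\<beta> * r' \<le> b * r" using assms by (intro mult_mono) auto
  have "b * (1 / b - r) = 1 - b * r" "\<beta> * (1 / \<beta> - r') = 1 - \<beta> * r'"
    using \<open>0 < b\<close> \<open>0 < \<beta>\<close> by (simp_all add: field_simps)
  with br have "b * (1 / b - r) \<le> \<beta> * (1 / \<beta> - r')" by linarith
  then have "b * (1 / b - r) * (1 / b - r) \<le> \<beta> * (1 / \<beta> - r') * (1 / \<beta> - r')"
    using le \<open>0 < b\<close> \<open>0 < \<beta>\<close> by (intro mult_mono[of "b * (1 / b - r)"]) auto
  moreover have "max (1 / b - r) 0 = 1 / b - r" "max (1 / \<beta> - r') 0 = 1 / \<beta> - r'"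
    using le by auto
  ultimately show ?thesis by (simp only: power2_eq_square mult.assoc)
qed (use assms in simp)

lemma abs_le_imp_power2_le: "\<bar>x\<bar> \<le> n \<Longrightarrow> x\<^sup>2 \<le> n\<^sup>2" for x n :: real
  by (metis abs_ge_zero power2_abs power_mono)

text \<open>Selects a positive tolerance x for which an error bound polynomial in x stays close to
  its value at 0.\<close>

lemma isCont_positive_argument_less:
  fixes f :: "real \<Rightarrow> real"
  assumes "isCont f 0" "f 0 < c"
  obtains x where "0 < x" "f x < c"
proof -
  have "(f \<longlongrightarrow> f 0) (at_right 0)"
    using assms(1) unfolding isCont_def by (rule tendsto_within_subset) simp
  then have "\<forall>\<^sub>F x in at_right 0. f x < c"
    using assms(2) by (rule order_tendstoD)
  then have "\<forall>\<^sub>F x in at_right 0. 0 < x \<and> f x < c"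
    using eventually_at_right_less[of "0 :: real"] by eventually_elim simp
  then show thesis
    using that eventually_happens' trivial_limit_at_right_real by blast
qed

lemma sqrt_add_square_le:
  fixes S e :: real
  assumes "0 \<le> S" "0 \<le> e" "0 \<le> x" "x\<^sup>2 \<le> S + e\<^sup>2"
  shows "x \<le> sqrt S + e"
proof (rule power2_le_imp_le)
  have "(sqrt S + e)\<^sup>2 = S + e\<^sup>2 + 2 * sqrt S * e"
    using assms by (simp add: power2_sum)
  moreover have "0 \<le> 2 * sqrt S * e" using assms by simp
  ultimately show "x\<^sup>2 \<le> (sqrt S + e)\<^sup>2" using assms by linarith
qed (use assms in simp)

text \<open>The scalar skeleton of the system: \<open>W\<close> is the norm of w, \<open>P\<close>
  is Phi(w), \<open>\<theta>1\<close> and \<open>\<delta>\<close> are the L^2 norms of the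
  distributed terms, and \<open>nd\<close>, \<open>n1\<close>, \<open>n2\<close>,
  \<open>n\<delta>\<close> are essential suprema. The infinite-dimensional part enters only through
  \<open>P_bounds\<close> and \<open>wave\<close>.\<close>

locale closed_loop_estimates =
  fixes \<kappa> a C \<epsilon> \<Gamma> k1 k2 G R \<mu> \<beta> :: real
    and nd n1 n2 n\<delta> :: real
    and W P y z d b \<theta>1 \<theta>2 \<delta> :: "real \<Rightarrow> real"
  assumes pos: "0 < \<kappa>" "0 < a" "0 < C" "0 < \<epsilon>" "0 < \<Gamma>" "0 < k1" "0 < k2" "0 \<le> G" "a < 2 * \<kappa>"
    and R: "R = sqrt G"
    and \<mu>: "\<mu> = min ((2 * \<kappa> - a) / (2 * \<kappa> * k2)) (2 * C)"
    and P_bounds: "k1 * (W t)\<^sup>2 \<le> P t" "P t \<le> k2 * (W t)\<^sup>2"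
    and nonneg: "0 \<le> W t" "0 \<le> \<theta>1 t" "0 \<le> \<delta> t"
    and P_ac: "loc_abs_continuous P" and y_ac: "loc_abs_continuous y"
    and z_cont: "continuous_on {0..} z"
    and z_deriv: "0 < t \<Longrightarrow> (z has_real_derivative \<Gamma> * exp (- z t) * max ((y t)\<^sup>2 / 2 - \<epsilon>) 0) (at t)"
    and wave: "AE t in lebesgue. 0 < t \<longrightarrow> (\<exists>D. (P has_real_derivative D) (at t) \<and>
      D \<le> - (W t)\<^sup>2 + G * (\<theta>1 t)\<^sup>2 * (y t)\<^sup>2 + G * (\<delta> t)\<^sup>2)"
    and plant: "AE t in lebesgue. 0 < t \<longrightarrow> (\<exists>D. (y has_real_derivative D) (at t) \<and>
      y t * D \<le> - C * (y t)\<^sup>2 + a / (\<kappa> + exp (z t)) * ((W t)\<^sup>2 / 2 + (d t)\<^sup>2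
        + (max (\<bar>\<theta>2 t\<bar> - \<kappa> - exp (z t)) 0)\<^sup>2 + ((max (\<bar>\<theta>2 t\<bar> - \<kappa> - exp (z t)) 0)\<^sup>2)\<^sup>2
        + 2 * b t * (max (1 / b t - \<kappa> - exp (z t)) 0)\<^sup>2) \<and>
      y t * D + (R * \<theta>1 t)\<^sup>2 * (y t)\<^sup>2 \<le> - C * (y t)\<^sup>2 + a / (\<kappa> + exp (z t)) * ((W t)\<^sup>2 / 2 + (d t)\<^sup>2
        + (max (\<bar>\<theta>2 t\<bar> - \<kappa> - exp (z t)) 0)\<^sup>2 + ((max (\<bar>\<theta>2 t\<bar> - \<kappa> - exp (z t)) 0)\<^sup>2)\<^sup>2
        + 4 * b t * (max (1 / b t - \<kappa> - exp (z t)) 0)\<^sup>2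
        + ((max (R * \<theta>1 t - \<kappa> - exp (z t)) 0)\<^sup>2)\<^sup>2))"
    and bounds: "AE t in lebesgue. 0 < t \<longrightarrow> \<bar>d t\<bar> \<le> nd \<and> \<theta>1 t \<le> n1 \<and> \<bar>\<theta>2 t\<bar> \<le> n2 \<and> \<delta> t \<le> n\<delta> \<and>
      \<beta> \<le> b t"
    and \<beta>: "0 < \<beta>"
begin

definition gap :: "real \<Rightarrow> real \<Rightarrow> real" where
  "gap s l = (max (s - \<kappa> - exp l) 0)\<^sup>2"

definition E :: "real \<Rightarrow> real" where "E t = (y t)\<^sup>2 / 2"
definition V :: "real \<Rightarrow> real" where "V t = P t + E t"

definition Z :: real where
  "Z = G * n\<delta>\<^sup>2 + a / (\<kappa> + exp (z 0)) * (nd\<^sup>2 + gap n2 (z 0) + (gap n2 (z 0))\<^sup>2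
      + 4 * \<beta> * gap (1 / \<beta>) (z 0) + (gap (R * n1) (z 0))\<^sup>2)"

definition B :: real where
  "B = 1 / (2 * k1) * (k2 * (W 0)\<^sup>2 + 1 / 2 * \<bar>y 0\<bar>\<^sup>2 + 1 / \<mu> * Z)
      + gap n2 (z 0) + nd\<^sup>2 + (gap n2 (z 0))\<^sup>2 + 2 * \<beta> * gap (1 / \<beta>) (z 0)"

lemma \<mu>_pos: "0 < \<mu>"
  using pos by (simp add: \<mu>)

lemma r_pos: "0 < \<kappa> + exp l"
  using pos(1) exp_gt_zero[of l] by linarith

lemma R_nonneg: "0 \<le> R" and R_square: "R\<^sup>2 = G"
  using pos by (simp_all add: R)

lemma gap_nonneg: "0 \<le> gap s l"
  by (simp add: gap_def)

lemma gap_mono: "s \<le> s' \<Longrightarrow> l' \<le> l \<Longrightarrow> gap s l \<le> gap s' l'"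
  unfolding gap_def by (intro power_mono max.mono diff_mono) auto

lemma gap_le: "0 \<le> e \<Longrightarrow> s - \<kappa> - exp l \<le> e \<Longrightarrow> gap s l \<le> e\<^sup>2"
  unfolding gap_def by (intro power_mono) auto

lemma gain_gap_mono:
  assumes "\<beta>' \<le> b'" "l' \<le> l" "0 < \<beta>'"
  shows "b' * gap (1 / b') l \<le> \<beta>' * gap (1 / \<beta>') l'"
  using gain_gap_antimono[OF assms(3,1), of "\<kappa> + exp l'" "\<kappa> + exp l"] assms pos
  by (simp add: gap_def diff_diff_eq add_nonneg_nonneg)

lemma E_nonneg: "0 \<le> E t" and P_nonneg: "0 \<le> P t"
  using P_bounds(1)[of t] pos by (auto simp: E_def intro: order_trans[rotated])

lemma Z_nonneg: "0 \<le> Z"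
  using pos \<beta> gap_nonneg by (auto simp: Z_def intro!: add_nonneg_nonneg mult_nonneg_nonneg)

lemma B_nonneg: "0 \<le> B"
  using pos \<beta> gap_nonneg Z_nonneg \<mu>_pos
  by (auto simp: B_def intro!: add_nonneg_nonneg mult_nonneg_nonneg)

lemma E_ac: "loc_abs_continuous E"
  using loc_abs_continuous_cmult[OF loc_abs_continuous_mult[OF y_ac y_ac], of "1 / 2"]
  by (simp add: E_def[abs_def] power2_eq_square)

lemma V_ac: "loc_abs_continuous V"
  unfolding V_def[abs_def] by (intro loc_abs_continuous_add P_ac E_ac)

lemma z_mono:
  assumes "0 \<le> s" "s \<le> t"
  shows "z s \<le> z t"
proof (rule DERIV_nonneg_imp_increasing_open[OF assms(2)])
  show "\<exists>D. (z has_real_derivative D) (at x) \<and> 0 \<le> D" if "s < x" "x < t" for x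
  proof (intro exI conjI)
    show "(z has_real_derivative \<Gamma> * exp (- z x) * max ((y x)\<^sup>2 / 2 - \<epsilon>) 0) (at x)"
      using that assms by (intro z_deriv) simp
  qed (use pos in simp)
  show "continuous_on {s..t} z"
    using assms by (intro continuous_on_subset[OF z_cont]) auto
qed

lemma exp_z_deriv:
  assumes "0 < t"
  shows "((\<lambda>t. exp (z t)) has_real_derivative \<Gamma> * max (E t - \<epsilon>) 0) (at t)"
proof -
  have "((\<lambda>t. exp (z t)) has_real_derivative
      exp (z t) * (\<Gamma> * exp (- z t) * max ((y t)\<^sup>2 / 2 - \<epsilon>) 0)) (at t)"
    by (intro DERIV_fun_exp z_deriv assms)
  then show ?thesis by (simp add: E_def exp_minus field_simps)
qed

section \<open>Differential inequalities for E and V\<close>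

text \<open>Excess terms may be frozen at time 0 because z does not decrease. The prefactor is left
  at time t: its decay in z is what stops the adaptation.\<close>

lemma E_deriv_bound:
  "AE t in lebesgue. 0 < t \<longrightarrow> (\<exists>D. (E has_real_derivative D) (at t) \<and>
    D \<le> - 2 * C * E t + a / (\<kappa> + exp (z t)) * ((W t)\<^sup>2 / 2 + nd\<^sup>2 + gap n2 (z 0)
      + (gap n2 (z 0))\<^sup>2 + 2 * \<beta> * gap (1 / \<beta>) (z 0)))" (is "AE t in _. _ \<longrightarrow> ?Q t")
  using plant bounds
proof eventually_elim
  case (elim t)
  show ?case
  proof
    assume t: "0 < t"
    obtain D where D: "(y has_real_derivative D) (at t)" and
      le: "y t * D \<le> - C * (y t)\<^sup>2 + a / (\<kappa> + exp (z t)) * ((W t)\<^sup>2 / 2 + (d t)\<^sup>2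
          + gap \<bar>\<theta>2 t\<bar> (z t) + (gap \<bar>\<theta>2 t\<bar> (z t))\<^sup>2 + 2 * b t * gap (1 / b t) (z t))"
      using elim t by (auto simp: gap_def)
    have n: "\<bar>d t\<bar> \<le> nd" "\<bar>\<theta>2 t\<bar> \<le> n2" "\<beta> \<le> b t" using elim t by auto
    have z: "z 0 \<le> z t" using t by (intro z_mono) auto
    have "(E has_real_derivative y t * D) (at t)"
      unfolding E_def[abs_def] by (auto intro!: derivative_eq_intros D)
    moreover have "(W t)\<^sup>2 / 2 + (d t)\<^sup>2 + gap \<bar>\<theta>2 t\<bar> (z t) + (gap \<bar>\<theta>2 t\<bar> (z t))\<^sup>2 + 2 * b t * gap (1 / b t) (z t)
        \<le> (W t)\<^sup>2 / 2 + nd\<^sup>2 + gap n2 (z 0) + (gap n2 (z 0))\<^sup>2 + 2 * \<beta> * gap (1 / \<beta>) (z 0)"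
    proof (intro add_mono order_refl)
      show "(d t)\<^sup>2 \<le> nd\<^sup>2" using n(1) by (rule abs_le_imp_power2_le)
      show "gap \<bar>\<theta>2 t\<bar> (z t) \<le> gap n2 (z 0)" by (rule gap_mono[OF n(2) z])
      then show "(gap \<bar>\<theta>2 t\<bar> (z t))\<^sup>2 \<le> (gap n2 (z 0))\<^sup>2" by (intro power_mono gap_nonneg)
      show "2 * b t * gap (1 / b t) (z t) \<le> 2 * \<beta> * gap (1 / \<beta>) (z 0)"
        using gain_gap_mono[OF n(3) z \<beta>] by simp
    qed
    then have "a / (\<kappa> + exp (z t)) * ((W t)\<^sup>2 / 2 + (d t)\<^sup>2 + gap \<bar>\<theta>2 t\<bar> (z t) + (gap \<bar>\<theta>2 t\<bar> (z t))\<^sup>2 + 2 * b t * gap (1 / b t) (z t))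
        \<le> a / (\<kappa> + exp (z t)) * ((W t)\<^sup>2 / 2 + nd\<^sup>2 + gap n2 (z 0) + (gap n2 (z 0))\<^sup>2 + 2 * \<beta> * gap (1 / \<beta>) (z 0))"
      using pos by (intro mult_left_mono) (auto intro: add_nonneg_nonneg)
    moreover have "- 2 * C * E t = - C * (y t)\<^sup>2" by (simp add: E_def)
    ultimately show "?Q t" using le by (intro exI[of _ "y t * D"]) linarith
  qed
qed

text \<open>The wave term G \<theta>1^2 y^2 cancels against the reserve (R \<theta>1)^2 y^2 of the
  plant. The excess terms keep their current values, since the convergence proof needs their
  limits.\<close>

lemma V_deriv_bound:
  "AE t in lebesgue. 0 < t \<longrightarrow> (\<exists>D. (V has_real_derivative D) (at t) \<and>
    D \<le> G * (\<delta> t)\<^sup>2 + a / (\<kappa> + exp (z t)) * ((d t)\<^sup>2 + gap \<bar>\<theta>2 t\<bar> (z t) + (gap \<bar>\<theta>2 t\<bar> (z t))\<^sup>2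
      + 4 * (b t * gap (1 / b t) (z t)) + (gap (R * \<theta>1 t) (z t))\<^sup>2) - \<mu> * V t)" (is "AE t in _. _ \<longrightarrow> ?Q t")
  using plant wave
proof eventually_elim
  case (elim t)
  show ?case
  proof
    assume t: "0 < t"
    let ?S = "(d t)\<^sup>2 + gap \<bar>\<theta>2 t\<bar> (z t) + (gap \<bar>\<theta>2 t\<bar> (z t))\<^sup>2 + 4 * (b t * gap (1 / b t) (z t))
      + (gap (R * \<theta>1 t) (z t))\<^sup>2"
    let ?r = "\<kappa> + exp (z t)"
    obtain D where D: "(y has_real_derivative D) (at t)" and
      le: "y t * D + (R * \<theta>1 t)\<^sup>2 * (y t)\<^sup>2 \<le> - C * (y t)\<^sup>2 + a / ?r * ((W t)\<^sup>2 / 2 + ?S)"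
      using elim t by (auto simp: gap_def add_ac mult.assoc)
    obtain D' where D': "(P has_real_derivative D') (at t)" and
      le': "D' \<le> - (W t)\<^sup>2 + G * (\<theta>1 t)\<^sup>2 * (y t)\<^sup>2 + G * (\<delta> t)\<^sup>2"
      using elim t by blast
    have "(E has_real_derivative y t * D) (at t)"
      unfolding E_def[abs_def] by (auto intro!: derivative_eq_intros D)
    then have "(V has_real_derivative D' + y t * D) (at t)"
      unfolding V_def[abs_def] by (intro DERIV_add D')
    moreover have "D' + y t * D \<le> G * (\<delta> t)\<^sup>2 + a / ?r * ?S - \<mu> * V t"
    proof -
      \<comment> \<open>The W^2 budget: after paying a W^2/(2r), a fraction of at least (2\<kappa> -
        a)/(2\<kappa>) is left, and division by \<open>k2\<close> converts it into decay of
        \<open>P\<close>. This is the first entry of \<open>\<mu>\<close>; the second is the rate of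
        E.\<close>
      have "a / ?r * ((W t)\<^sup>2 / 2) \<le> a / \<kappa> * ((W t)\<^sup>2 / 2)"
        using pos r_pos by (intro mult_right_mono divide_left_mono mult_pos_pos) auto
      moreover have "\<mu> * P t \<le> (2 * \<kappa> - a) / (2 * \<kappa> * k2) * (k2 * (W t)\<^sup>2)"
        using pos P_nonneg P_bounds by (intro mult_mono) (auto simp: \<mu>)
      moreover have "(2 * \<kappa> - a) / (2 * \<kappa> * k2) * (k2 * (W t)\<^sup>2) = (W t)\<^sup>2 - a / \<kappa> * ((W t)\<^sup>2 / 2)"
        using pos by (simp add: field_simps)
      moreover have "\<mu> * E t \<le> 2 * C * E t"
        using E_nonneg by (intro mult_right_mono) (auto simp: \<mu>)
      moreover have "2 * C * E t = C * (y t)\<^sup>2" by (simp add: E_def)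
      moreover have "(R * \<theta>1 t)\<^sup>2 * (y t)\<^sup>2 = G * (\<theta>1 t)\<^sup>2 * (y t)\<^sup>2"
        by (simp add: power_mult_distrib R_square)
      moreover have "a / ?r * ((W t)\<^sup>2 / 2 + ?S) = a / ?r * ((W t)\<^sup>2 / 2) + a / ?r * ?S"
        by (rule distrib_left)
      moreover have "\<mu> * V t = \<mu> * P t + \<mu> * E t" by (simp add: V_def distrib_left)
      ultimately show ?thesis using le le' by linarith
    qed
    ultimately show "?Q t" by blast
  qed
qed

lemma V_deriv_bound_Z:
  "AE t in lebesgue. 0 < t \<longrightarrow> (\<exists>D. (V has_real_derivative D) (at t) \<and> D \<le> Z - \<mu> * V t)" (is "AE t in _. _ \<longrightarrow> ?Q t")
  using V_deriv_bound bounds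
proof eventually_elim
  case (elim t)
  show ?case
  proof
    assume t: "0 < t"
    let ?S = "(d t)\<^sup>2 + gap \<bar>\<theta>2 t\<bar> (z t) + (gap \<bar>\<theta>2 t\<bar> (z t))\<^sup>2 + 4 * (b t * gap (1 / b t) (z t))
      + (gap (R * \<theta>1 t) (z t))\<^sup>2"
    have n: "\<bar>d t\<bar> \<le> nd" "\<bar>\<theta>2 t\<bar> \<le> n2" "\<beta> \<le> b t" "R * \<theta>1 t \<le> R * n1" "\<bar>\<delta> t\<bar> \<le> n\<delta>"
      using elim t nonneg R_nonneg by (auto intro: mult_left_mono)
    have z: "z 0 \<le> z t" using t by (intro z_mono) auto
    have "?S \<le> nd\<^sup>2 + gap n2 (z 0) + (gap n2 (z 0))\<^sup>2 + 4 * \<beta> * gap (1 / \<beta>) (z 0)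
        + (gap (R * n1) (z 0))\<^sup>2"
    proof (intro add_mono)
      show "(d t)\<^sup>2 \<le> nd\<^sup>2" using n by (intro abs_le_imp_power2_le)
      show "gap \<bar>\<theta>2 t\<bar> (z t) \<le> gap n2 (z 0)" by (rule gap_mono[OF n(2) z])
      then show "(gap \<bar>\<theta>2 t\<bar> (z t))\<^sup>2 \<le> (gap n2 (z 0))\<^sup>2" by (intro power_mono gap_nonneg)
      show "4 * (b t * gap (1 / b t) (z t)) \<le> 4 * \<beta> * gap (1 / \<beta>) (z 0)"
        using gain_gap_mono[OF n(3) z \<beta>] by simp
      show "(gap (R * \<theta>1 t) (z t))\<^sup>2 \<le> (gap (R * n1) (z 0))\<^sup>2"
        by (intro power_mono gap_nonneg gap_mono n z)
    qed
    moreover have "a / (\<kappa> + exp (z t)) \<le> a / (\<kappa> + exp (z 0))"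
      using pos r_pos z by (intro divide_left_mono mult_pos_pos) auto
    moreover have "0 \<le> ?S" using gap_nonneg n(3) \<beta> by (auto intro!: add_nonneg_nonneg mult_nonneg_nonneg)
    moreover have "0 \<le> a / (\<kappa> + exp (z 0))"
      using pos r_pos[of "z 0"] by simp
    ultimately have "a / (\<kappa> + exp (z t)) * ?S \<le> a / (\<kappa> + exp (z 0)) *
        (nd\<^sup>2 + gap n2 (z 0) + (gap n2 (z 0))\<^sup>2 + 4 * \<beta> * gap (1 / \<beta>) (z 0) + (gap (R * n1) (z 0))\<^sup>2)"
      by (intro mult_mono[of "a / (\<kappa> + exp (z t))"])
    moreover have "G * (\<delta> t)\<^sup>2 \<le> G * n\<delta>\<^sup>2"
      using n pos by (intro mult_left_mono abs_le_imp_power2_le)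
    ultimately have "G * (\<delta> t)\<^sup>2 + a / (\<kappa> + exp (z t)) * ?S \<le> Z"
      unfolding Z_def by linarith
    then show "?Q t" using elim t by (meson diff_right_mono order_trans)
  qed
qed

section \<open>The exponential state estimate\<close>

lemma V_bound:
  assumes "0 \<le> t"
  shows "V t \<le> exp (- \<mu> * t) * (V 0 - Z / \<mu>) + Z / \<mu>"
proof -
  have "AE x in lebesgue. x \<in> {0<..<t} \<longrightarrow> (\<exists>D. (V has_real_derivative D) (at x) \<and> D \<le> Z - \<mu> * V x)"
    using V_deriv_bound_Z by eventually_elim auto
  then show ?thesis
    using gronwall_abs_continuous[OF loc_abs_continuousD[OF V_ac] assms \<mu>_pos] by simp
qed

lemma state_bound:
  assumes "0 \<le> t"
  shows "2 * k1 * (W t)\<^sup>2 + \<bar>y t\<bar>\<^sup>2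
    \<le> exp (- \<mu> * t) * (2 * k2 * (W 0)\<^sup>2 + \<bar>y 0\<bar>\<^sup>2) + 2 * (1 / \<mu>) * Z"
proof -
  have "exp (- \<mu> * t) * (V 0 - Z / \<mu>) \<le> exp (- \<mu> * t) * (k2 * (W 0)\<^sup>2 + (y 0)\<^sup>2 / 2)"
  proof (rule mult_left_mono)
    have "0 \<le> Z / \<mu>" using Z_nonneg \<mu>_pos by simp
    then show "V 0 - Z / \<mu> \<le> k2 * (W 0)\<^sup>2 + (y 0)\<^sup>2 / 2"
      using P_bounds(2)[of 0] by (simp add: V_def E_def)
  qed simp
  then have "V t \<le> exp (- \<mu> * t) * (k2 * (W 0)\<^sup>2 + (y 0)\<^sup>2 / 2) + Z / \<mu>"
    using V_bound[OF assms] by linarith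
  then have "2 * V t \<le> exp (- \<mu> * t) * (2 * k2 * (W 0)\<^sup>2 + \<bar>y 0\<bar>\<^sup>2) + 2 * (1 / \<mu>) * Z"
    by (simp add: algebra_simps)
  moreover have "2 * k1 * (W t)\<^sup>2 + \<bar>y t\<bar>\<^sup>2 \<le> 2 * V t"
    using P_bounds(1)[of t] by (simp add: V_def E_def)
  ultimately show ?thesis by linarith
qed

section \<open>Boundedness and convergence of z\<close>

text \<open>The state estimate bounds W^2/2 uniformly in time; that bound is the first summand of
  \<open>B\<close>.\<close>

lemma E_deriv_bound_B:
  "AE t in lebesgue. 0 < t \<longrightarrow> (\<exists>D. (E has_real_derivative D) (at t) \<and>
    D \<le> a * B / (\<kappa> + exp (z t)) - 2 * C * E t)" (is "AE t in _. _ \<longrightarrow> ?Q t")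
  using E_deriv_bound
proof eventually_elim
  case (elim t)
  show ?case
  proof
    assume t: "0 < t"
    have "0 \<le> \<bar>y t\<bar>\<^sup>2" by simp
    moreover have "exp (- \<mu> * t) * (2 * k2 * (W 0)\<^sup>2 + \<bar>y 0\<bar>\<^sup>2) \<le> 1 * (2 * k2 * (W 0)\<^sup>2 + \<bar>y 0\<bar>\<^sup>2)"
      using t \<mu>_pos pos by (intro mult_right_mono) auto
    ultimately have "2 * k1 * (W t)\<^sup>2 \<le> 2 * (k2 * (W 0)\<^sup>2 + 1 / 2 * \<bar>y 0\<bar>\<^sup>2 + 1 / \<mu> * Z)"
      using state_bound[OF less_imp_le[OF t]] by argo
    then have "(W t)\<^sup>2 / 2 \<le> 1 / (2 * k1) * (k2 * (W 0)\<^sup>2 + 1 / 2 * \<bar>y 0\<bar>\<^sup>2 + 1 / \<mu> * Z)"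
      using pos by (simp add: field_simps)
    then have "a / (\<kappa> + exp (z t)) * ((W t)\<^sup>2 / 2 + nd\<^sup>2 + gap n2 (z 0)
        + (gap n2 (z 0))\<^sup>2 + 2 * \<beta> * gap (1 / \<beta>) (z 0)) \<le> a / (\<kappa> + exp (z t)) * B"
      using pos by (intro mult_left_mono) (auto simp: B_def intro: add_nonneg_nonneg)
    then show "?Q t" using elim t by fastforce
  qed
qed

definition A :: real where "A = a * B / min 1 \<kappa>"

lemma A_nonneg: "0 \<le> A"
  using pos B_nonneg by (simp add: A_def)

text \<open>Both \<kappa> and exp l are bounded below with the factor min(1, \<kappa>), whence its
  place in the bound for z. The denominator 1 + exp l can be compared with thresholds
  directly.\<close>

lemma E_rate_le_A: "a * B / (\<kappa> + exp l) \<le> A / (1 + exp l)"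
proof -
  have "min 1 \<kappa> * (1 + exp l) \<le> \<kappa> + exp l"
    unfolding distrib_left using mult_right_mono[of "min 1 \<kappa>" 1 "exp l"] by (intro add_mono) auto
  moreover have "0 < min 1 \<kappa> * (1 + exp l)"
    using pos by (intro mult_pos_pos add_pos_pos) auto
  ultimately have "a * B / (\<kappa> + exp l) \<le> a * B / (min 1 \<kappa> * (1 + exp l))"
    using pos B_nonneg r_pos by (intro divide_left_mono mult_pos_pos[of "\<kappa> + exp l"]) auto
  then show ?thesis by (simp add: A_def)
qed

text \<open>The level \<open>h\<close> is left free: the rate at time s gives a global bound for E,
  while \<open>h\<close> = 2 C \<epsilon> makes \<epsilon> the equilibrium, so that E - \<epsilon>
  decays. Monotonicity of z keeps the rate below \<open>h\<close> after s.\<close>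

lemma E_gronwall:
  assumes "0 \<le> s" "s \<le> t" and h: "A / (1 + exp (z s)) \<le> h"
  shows "E t \<le> exp (- (2 * C) * (t - s)) * (E s - h / (2 * C)) + h / (2 * C)"
proof (rule gronwall_abs_continuous[OF loc_abs_continuousD[OF E_ac \<open>0 \<le> s\<close>] \<open>s \<le> t\<close>])
  show "AE x in lebesgue. x \<in> {s<..<t} \<longrightarrow>
      (\<exists>D. (E has_real_derivative D) (at x) \<and> D \<le> h - 2 * C * E x)"
    using E_deriv_bound_B
  proof eventually_elim
    case (elim x)
    show ?case
    proof
      assume x: "x \<in> {s<..<t}"
      then have "z s \<le> z x" using assms by (intro z_mono) auto
      then have "A / (1 + exp (z x)) \<le> A / (1 + exp (z s))"
        using A_nonneg by (intro divide_left_mono mult_pos_pos add_pos_pos) auto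
      then have "a * B / (\<kappa> + exp (z x)) \<le> h"
        using E_rate_le_A[of "z x"] h by linarith
      then show "\<exists>D. (E has_real_derivative D) (at x) \<and> D \<le> h - 2 * C * E x"
        using elim x assms by force
    qed
  qed
qed (use pos in simp)

lemma E_bound:
  assumes "0 \<le> t"
  shows "E t \<le> E 0 + A / (2 * C * (1 + exp (z 0)))"
proof -
  let ?h = "A / (1 + exp (z 0))"
  have h: "0 \<le> ?h / (2 * C)"
    using A_nonneg pos by (intro divide_nonneg_nonneg) (auto intro: add_nonneg_nonneg)
  have "exp (- (2 * C) * (t - 0)) * (E 0 - ?h / (2 * C)) \<le> exp (- (2 * C) * (t - 0)) * E 0"
    using h by (intro mult_left_mono) auto
  also have "\<dots> \<le> 1 * E 0"
    using pos assms E_nonneg by (intro mult_right_mono) auto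
  finally show ?thesis
    using E_gronwall[OF order_refl assms order_refl] by (simp add: mult.commute)
qed

text \<open>
  Once \<open>exp z\<close> is so large that the decay of \<open>E\<close> dominates at level \<open>\<epsilon>\<close>, the excess
  \<open>E - \<epsilon>\<close> decays exponentially, so its time integral, which drives \<open>exp z\<close>, is bounded.
\<close>

lemma exp_z_bound_after:
  assumes "0 \<le> s" "s \<le> t" and h: "A / (1 + exp (z s)) \<le> 2 * C * \<epsilon>"
  shows "exp (z t) \<le> exp (z s) + \<Gamma> / (2 * C) * max (E s - \<epsilon>) 0"
proof -
  define M where "M = max (E s - \<epsilon>) 0"
  \<comment> \<open>The second summand is the integral from x to infinity of the majorant of d(exp
    z)/dt, i.e. the growth that exp z may still undergo.\<close>
  define U where "U x = exp (z x) + \<Gamma> * M / (2 * C) * exp (- (2 * C) * (x - s))" for x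
  have "0 \<le> M" by (simp add: M_def)
  have excess: "max (E x - \<epsilon>) 0 \<le> exp (- (2 * C) * (x - s)) * M" if "s \<le> x" for x
  proof -
    have "2 * C * \<epsilon> / (2 * C) = \<epsilon>" using pos by simp
    then have "E x - \<epsilon> \<le> exp (- (2 * C) * (x - s)) * (E s - \<epsilon>)"
      using E_gronwall[OF \<open>0 \<le> s\<close> that h] by simp
    also have "\<dots> \<le> exp (- (2 * C) * (x - s)) * M"
      by (intro mult_left_mono) (auto simp: M_def)
    finally show ?thesis using \<open>0 \<le> M\<close> by simp
  qed
  have "U t \<le> U s"
  proof (rule DERIV_nonpos_imp_decreasing_open[OF \<open>s \<le> t\<close>])
    fix x assume x: "s < x" "x < t"
    have "(U has_real_derivative \<Gamma> * max (E x - \<epsilon>) 0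
        + \<Gamma> * M / (2 * C) * (exp (- (2 * C) * (x - s)) * (- (2 * C)))) (at x)"
      unfolding U_def
      by (intro DERIV_add exp_z_deriv DERIV_cmult) (use x \<open>0 \<le> s\<close> in \<open>auto intro!: derivative_eq_intros\<close>)
    moreover have "\<Gamma> * max (E x - \<epsilon>) 0 + \<Gamma> * M / (2 * C) * (exp (- (2 * C) * (x - s)) * (- (2 * C))) \<le> 0"
    proof -
      have "\<Gamma> * max (E x - \<epsilon>) 0 \<le> \<Gamma> * (exp (- (2 * C) * (x - s)) * M)"
        using excess[of x] x pos by (intro mult_left_mono) auto
      moreover have "\<Gamma> * M / (2 * C) * (exp (- (2 * C) * (x - s)) * (- (2 * C))) = - (\<Gamma> * (exp (- (2 * C) * (x - s)) * M))"
        using pos by (simp add: field_simps)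
      ultimately show ?thesis by linarith
    qed
    ultimately show "\<exists>D. (U has_real_derivative D) (at x) \<and> D \<le> 0" by blast
  next
    show "continuous_on {s..t} U"
      unfolding U_def using \<open>0 \<le> s\<close>
      by (intro continuous_intros continuous_on_subset[OF z_cont]) auto
  qed
  moreover have "0 \<le> \<Gamma> * M / (2 * C) * exp (- (2 * C) * (t - s))"
    using pos \<open>0 \<le> M\<close> by simp
  ultimately show ?thesis by (simp add: U_def M_def)
qed

text \<open>\<open>?q\<close> is the level of 1 + exp z beyond which the equilibrium of E is at most
  \<epsilon>. Either it is passed at time 0, or not before t, so that exp(z t) is below
  \<open>?q\<close>, or z crosses it at some s by continuity. After passing,
  \<open>exp_z_bound_after\<close> limits the growth by a constant, so the sum covers all
  cases.\<close>

lemma exp_z_upper: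
  assumes "0 \<le> t"
  shows "exp (z t) \<le> exp (z 0) + \<Gamma> / (2 * C) * (E 0 + A / (2 * C * (1 + exp (z 0)))) + A / (2 * C * \<epsilon>)"
proof -
  let ?q = "A / (2 * C * \<epsilon>)" and ?E = "E 0 + A / (2 * C * (1 + exp (z 0)))"
  have q: "0 \<le> ?q" using A_nonneg pos by simp
  have thr: "A / (1 + exp l) \<le> 2 * C * \<epsilon> \<longleftrightarrow> ?q \<le> 1 + exp l" for l
    using pos exp_gt_zero[of l] by (simp add: pos_divide_le_eq add_pos_pos mult_ac)
  have excess: "\<Gamma> / (2 * C) * max (E s - \<epsilon>) 0 \<le> \<Gamma> / (2 * C) * ?E" if "0 \<le> s" for s
    using E_bound[OF that] pos E_nonneg[of s] by (intro mult_left_mono) auto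
  have after: "exp (z t) \<le> exp (z s) + \<Gamma> / (2 * C) * ?E"
    if "0 \<le> s" "s \<le> t" "?q \<le> 1 + exp (z s)" for s
  proof -
    have "A / (1 + exp (z s)) \<le> 2 * C * \<epsilon>" using that(3) by (simp only: thr)
    from exp_z_bound_after[OF that(1,2) this] show ?thesis
      using excess[OF that(1)] by linarith
  qed
  have nn: "0 \<le> \<Gamma> / (2 * C) * ?E"
    using pos E_nonneg[of 0] E_bound[of 0] by simp
  consider "?q \<le> 1 + exp (z 0)" | "1 + exp (z t) \<le> ?q" | "1 + exp (z 0) \<le> ?q" "?q \<le> 1 + exp (z t)"
    by linarith
  then show ?thesis
  proof cases
    case 1
    then show ?thesis using after[of 0] assms q by simp
  next
    case 2
    then show ?thesis using nn exp_gt_zero[of "z 0"] by linarith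
  next
    case 3
    have "continuous_on {0..t} (\<lambda>x. 1 + exp (z x))"
      by (intro continuous_intros continuous_on_subset[OF z_cont]) auto
    then obtain s where s: "0 \<le> s" "s \<le> t" "1 + exp (z s) = ?q"
      using IVT'[of "\<lambda>x. 1 + exp (z x)" 0 ?q t] 3 assms by auto
    then show ?thesis using after[OF s(1,2)] exp_gt_zero[of "z 0"] by linarith
  qed
qed

lemma z_upper:
  assumes "0 \<le> t"
  shows "z t \<le> ln (exp (z 0) + \<Gamma> / (4 * C) * \<bar>y 0\<bar>\<^sup>2
        + a * B * ((2 * C * (1 + exp (z 0)) + \<epsilon> * \<Gamma>)
            / (4 * C\<^sup>2 * \<epsilon> * min 1 \<kappa> * (1 + exp (z 0)))))"
proof -
  have "(\<And>k e. k \<noteq> 0 \<Longrightarrow> e \<noteq> 0 \<Longrightarrow> a * B * ((2 * C * e + \<epsilon> * \<Gamma>) / (4 * C\<^sup>2 * \<epsilon> * k * e))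
      = \<Gamma> / (2 * C) * (a * B / k / (2 * C * e)) + a * B / k / (2 * C * \<epsilon>))"
    using pos by (simp add: field_simps power2_eq_square)
  from this[of "min 1 \<kappa>" "1 + exp (z 0)"]
  have "a * B * ((2 * C * (1 + exp (z 0)) + \<epsilon> * \<Gamma>) / (4 * C\<^sup>2 * \<epsilon> * min 1 \<kappa> * (1 + exp (z 0))))
      = \<Gamma> / (2 * C) * (A / (2 * C * (1 + exp (z 0)))) + A / (2 * C * \<epsilon>)"
    using pos add_pos_pos[OF zero_less_one exp_gt_zero[of "z 0"]] unfolding A_def by (simp add: min_def)
  moreover have "\<Gamma> / (2 * C) * (E 0 + A / (2 * C * (1 + exp (z 0))))
      = \<Gamma> / (4 * C) * \<bar>y 0\<bar>\<^sup>2 + \<Gamma> / (2 * C) * (A / (2 * C * (1 + exp (z 0))))"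
    unfolding distrib_left by (simp add: E_def)
  ultimately have "exp (z t) \<le> exp (z 0) + \<Gamma> / (4 * C) * \<bar>y 0\<bar>\<^sup>2
        + a * B * ((2 * C * (1 + exp (z 0)) + \<epsilon> * \<Gamma>)
            / (4 * C\<^sup>2 * \<epsilon> * min 1 \<kappa> * (1 + exp (z 0))))"
    using exp_z_upper[OF assms] by linarith
  then show ?thesis
    using ln_mono[of "exp (z t)"] ln_exp[of "z t"] by simp
qed

lemma z_converges: "\<exists>l. (z \<longlongrightarrow> l) at_top"
proof -
  obtain b' where b': "\<And>t. 0 \<le> t \<Longrightarrow> z t \<le> b'" using z_upper by blast
  have bdd: "bdd_above (z ` {0..})" using b' by (auto simp: bdd_above_def)
  have "(z \<longlongrightarrow> Sup (z ` {0..})) at_top"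
  proof (rule increasing_tendsto)
    show "\<forall>\<^sub>F t in at_top. z t \<le> Sup (z ` {0..})"
      using eventually_ge_at_top[of 0] by eventually_elim (auto intro: cSup_upper bdd)
    fix x assume "x < Sup (z ` {0..})"
    then obtain s where s: "0 \<le> s" "x < z s"
      using less_cSup_iff[OF _ bdd, of x] by auto
    show "\<forall>\<^sub>F t in at_top. x < z t"
      using eventually_ge_at_top[of s]
    proof eventually_elim
      case (elim t)
      then show ?case using z_mono[OF s(1) elim] s(2) by linarith
    qed
  qed
  then show ?thesis by blast
qed

text \<open>
  Barbalat's argument; since \<open>E\<close> can only grow at a bounded rate, an excess of \<open>E\<close> over \<open>\<epsilon>\<close> at
  time \<open>t\<close> persists on an interval of fixed length before \<open>t\<close> and forces \<open>exp z\<close> to grow.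
\<close>

lemma E_eventually_le:
  assumes "0 < e"
  shows "\<forall>\<^sub>F t in at_top. E t \<le> \<epsilon> + e"
proof -
  obtain l where l: "(z \<longlongrightarrow> l) at_top" using z_converges by blast
  \<comment> \<open>\<open>A\<close> bounds the growth rate of E; the 1 keeps the divisor positive
    when \<open>A\<close> is 0.\<close>
  define r where "r = A + 1"
  have "0 < r" using A_nonneg by (simp add: r_def)
  \<comment> \<open>Going back by at most h, E falls by at most e/2, so an excess above e leaves at
    least e/2 on the whole window.\<close>
  define h where "h = e / 2 / r"
  have h: "0 < h" "r * h = e / 2" using \<open>0 < e\<close> \<open>0 < r\<close> by (auto simp: h_def)
  have "((\<lambda>t. z (- h + t)) \<longlongrightarrow> l) at_top"
    by (rule filterlim_compose[OF l filterlim_tendsto_add_at_top[OF tendsto_const filterlim_ident]])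
  then have "((\<lambda>t. exp (z t) - exp (z (- h + t))) \<longlongrightarrow> exp l - exp l) at_top"
    by (intro tendsto_diff tendsto_exp l)
  then have "\<forall>\<^sub>F t in at_top. exp (z t) - exp (z (- h + t)) < \<Gamma> * (e / 2) * h"
    using pos \<open>0 < e\<close> h by (intro order_tendstoD) auto
  then show ?thesis
    using eventually_ge_at_top[of h]
  proof eventually_elim
    case (elim t)
    show ?case
    proof (rule ccontr)
      assume "\<not> E t \<le> \<epsilon> + e"
      have E: "\<epsilon> + e / 2 \<le> E s" if s: "t - h \<le> s" "s \<le> t" for s
      proof -
        have "0 \<le> s" using s elim by linarith
        have "AE x in lebesgue. x \<in> {s<..<t} \<longrightarrow> (\<exists>D. (E has_real_derivative D) (at x) \<and> D \<le> r)"
          using E_deriv_bound_B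
        proof eventually_elim
          case (elim x)
          have "A / (1 + exp (z x)) \<le> A / 1"
            using A_nonneg by (intro divide_left_mono) (auto intro: add_pos_pos)
          then have "a * B / (\<kappa> + exp (z x)) - 2 * C * E x \<le> r"
            using E_rate_le_A[of "z x"] mult_nonneg_nonneg[of "2 * C" "E x"] E_nonneg[of x] pos(3)
            unfolding r_def by linarith
          then show ?case using elim \<open>0 \<le> s\<close> by force
        qed
        from abs_continuous_on_increment_le[OF loc_abs_continuousD[OF E_ac \<open>0 \<le> s\<close>] s(2) this]
        have "E t - E s \<le> r * (t - s)" .
        also have "\<dots> \<le> r * h" using s \<open>0 < r\<close> by (intro mult_left_mono) auto
        finally show ?thesis using h \<open>\<not> E t \<le> \<epsilon> + e\<close> by linarith
      qed
      \<comment> \<open>On the window exp z grows at rate at least \<Gamma> e/2. The increment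
        \<Gamma> (e/2) h does not depend on t, against the convergence of exp z.\<close>
      define U where "U x = exp (z x) - \<Gamma> * (e / 2) * x" for x
      have "t - h \<le> t" using h by simp
      then have "U (t - h) \<le> U t"
      proof (rule DERIV_nonneg_imp_increasing_open)
        fix x assume x: "t - h < x" "x < t"
        have "(U has_real_derivative \<Gamma> * max (E x - \<epsilon>) 0 - \<Gamma> * (e / 2) * 1) (at x)"
          unfolding U_def using x elim
          by (intro DERIV_diff exp_z_deriv DERIV_cmult DERIV_ident) auto
        moreover have "\<Gamma> * (e / 2) \<le> \<Gamma> * max (E x - \<epsilon>) 0"
          using E[of x] x pos(5) by (intro mult_left_mono) linarith+
        ultimately show "\<exists>D. (U has_real_derivative D) (at x) \<and> 0 \<le> D" by force
      next
        show "continuous_on {t - h..t} U"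
          unfolding U_def using elim
          by (intro continuous_intros continuous_on_subset[OF z_cont]) auto
      qed
      then have "\<Gamma> * (e / 2) * h \<le> exp (z t) - exp (z (t - h))"
        unfolding U_def right_diff_distrib by linarith
      then show False using elim by (simp add: add.commute)
    qed
  qed
qed

section \<open>Asymptotic bounds for y and w\<close>

lemma y_limsup: "Limsup at_top (\<lambda>t. ereal \<bar>y t\<bar>) \<le> ereal (sqrt (2 * \<epsilon>))"
proof (rule Limsup_at_top_le_ereal)
  fix e :: real assume "0 < e"
  then have "0 < e\<^sup>2 / 2" by simp
  from E_eventually_le[OF this] show "\<forall>\<^sub>F t in at_top. \<bar>y t\<bar> \<le> sqrt (2 * \<epsilon>) + e"
  proof eventually_elim
    case (elim t)
    have "0 \<le> 2 * sqrt (2 * \<epsilon>) * e" using pos \<open>0 < e\<close> by simp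
    moreover have "(sqrt (2 * \<epsilon>) + e)\<^sup>2 = 2 * \<epsilon> + e\<^sup>2 + 2 * sqrt (2 * \<epsilon>) * e"
      using pos by (simp add: power2_sum)
    ultimately have "(y t)\<^sup>2 \<le> (sqrt (2 * \<epsilon>) + e)\<^sup>2"
      using elim unfolding E_def by linarith
    then show ?case
      using abs_le_square_iff[of "y t" "sqrt (2 * \<epsilon>) + e"] pos \<open>0 < e\<close> by simp
  qed
qed

text \<open>Only the wave inequality is needed once y^2 is eventually close to 2 \<epsilon>. As W^2
  is at least P/\<open>k2\<close>, Gronwall runs at rate 1/\<open>k2\<close>, and returning from P
  to W divides by \<open>k1\<close>.\<close>

lemma W_limsup:
  assumes lim: "\<And>e. 0 < e \<Longrightarrow> \<exists>T\<ge>0. AE t in lebesgue. T < t \<longrightarrow> \<theta>1 t \<le> p + e \<and> \<delta> t \<le> q + e"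
  shows "Limsup at_top (\<lambda>t. ereal (W t)) \<le> ereal (sqrt (k2 / k1 * (2 * \<epsilon> * R\<^sup>2 * p\<^sup>2 + G * q\<^sup>2)))"
proof (rule Limsup_at_top_le_ereal)
  fix e :: real assume "0 < e"
  define h where "h = 2 * \<epsilon> * R\<^sup>2 * p\<^sup>2 + G * q\<^sup>2"
  have h_nonneg: "0 \<le> h" using pos by (simp add: h_def)
  have mu: "0 < 1 / k2" using pos by simp
  have "\<forall>\<^sub>F t in at_top. P t \<le> h / (1 / k2) + k1 * e\<^sup>2"
  proof (rule gronwall_eventually[OF P_ac mu])
    fix e' :: real assume "0 < e'"
    \<comment> \<open>The forcing with every limsup exceeded by x; its value at x = 0 is
      \<open>h\<close>.\<close>
    define F where "F x = G * (p + x)\<^sup>2 * (2 * (\<epsilon> + x)) + G * (q + x)\<^sup>2" for x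
    have "isCont F 0"
      unfolding F_def[abs_def] by (intro continuous_intros)
    moreover have "F 0 < h + e'" using \<open>0 < e'\<close> by (simp add: F_def h_def R_square mult_ac)
    ultimately obtain x where x: "0 < x" "F x < h + e'"
      by (rule isCont_positive_argument_less)
    obtain T1 where T1: "0 \<le> T1" "AE t in lebesgue. T1 < t \<longrightarrow> \<theta>1 t \<le> p + x \<and> \<delta> t \<le> q + x"
      using lim[OF x(1)] by blast
    obtain T2 where T2: "\<And>t. T2 \<le> t \<Longrightarrow> E t \<le> \<epsilon> + x"
      using E_eventually_le[OF x(1)] by (auto simp: eventually_at_top_linorder)
    have "AE t in lebesgue. max T1 T2 < t \<longrightarrow>
        (\<exists>D. (P has_real_derivative D) (at t) \<and> D \<le> h + e' - 1 / k2 * P t)"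
      using T1(2) wave
    proof eventually_elim
      case (elim t)
      show ?case
      proof
        assume t: "max T1 T2 < t"
        then obtain D where D: "(P has_real_derivative D) (at t)"
          "D \<le> - (W t)\<^sup>2 + G * (\<theta>1 t)\<^sup>2 * (y t)\<^sup>2 + G * (\<delta> t)\<^sup>2"
          using elim T1(1) by auto
        have "(y t)\<^sup>2 = 2 * E t" by (simp add: E_def)
        also have "\<dots> \<le> 2 * (\<epsilon> + x)" using T2[of t] t by simp
        finally have "G * (\<theta>1 t)\<^sup>2 * (y t)\<^sup>2 \<le> G * (p + x)\<^sup>2 * (2 * (\<epsilon> + x))"
          using elim t pos nonneg by (intro mult_mono mult_left_mono power_mono) auto
        moreover have "G * (\<delta> t)\<^sup>2 \<le> G * (q + x)\<^sup>2"
          using elim t pos nonneg by (intro mult_left_mono power_mono) auto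
        moreover have "1 / k2 * P t \<le> (W t)\<^sup>2"
          using P_bounds(2)[of t] pos by (simp add: field_simps)
        ultimately show "\<exists>D. (P has_real_derivative D) (at t) \<and> D \<le> h + e' - 1 / k2 * P t"
          using D x(2) unfolding F_def by (intro exI[of _ D]) linarith
      qed
    qed
    then show "\<exists>T\<ge>0. AE t in lebesgue. T < t \<longrightarrow>
        (\<exists>D. (P has_real_derivative D) (at t) \<and> D \<le> h + e' - 1 / k2 * P t)"
      using T1(1) by (intro exI[of _ "max T1 T2"]) auto
  qed (use pos \<open>0 < e\<close> in simp)
  then show "\<forall>\<^sub>F t in at_top. W t \<le> sqrt (k2 / k1 * (2 * \<epsilon> * R\<^sup>2 * p\<^sup>2 + G * q\<^sup>2)) + e"
  proof eventually_elim
    case (elim t)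
    have "k1 * (W t)\<^sup>2 \<le> k1 * (k2 / k1 * h + e\<^sup>2)"
    proof -
      have "k1 * (k2 / k1 * h + e\<^sup>2) = h / (1 / k2) + k1 * e\<^sup>2"
        using pos by (simp add: distrib_left)
      then show ?thesis using elim P_bounds(1)[of t] by linarith
    qed
    then have "(W t)\<^sup>2 \<le> k2 / k1 * h + e\<^sup>2" using pos by simp
    then show ?case
      unfolding h_def[symmetric] using pos h_nonneg nonneg(1) \<open>0 < e\<close>
      by (intro sqrt_add_square_le) auto
  qed
qed

section \<open>Convergence to zero\<close>

lemma V_tendsto_zero:
  assumes z: "(z \<longlongrightarrow> l) at_top"
    and lim: "\<And>e. 0 < e \<Longrightarrow> \<exists>T\<ge>0. AE t in lebesgue. T < t \<longrightarrow> \<bar>d t\<bar> \<le> e \<and> \<delta> t \<le> e \<and>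
      R * \<theta>1 t \<le> \<kappa> + exp l + e \<and> \<bar>\<theta>2 t\<bar> \<le> \<kappa> + exp l + e"
    and gain: "\<And>e. 0 < e \<Longrightarrow> \<exists>T\<ge>0. AE t in lebesgue. T < t \<longrightarrow> 1 / \<kappa> - e \<le> b t"
  shows "(V \<longlongrightarrow> 0) at_top"
proof (rule tendstoI)
  fix e :: real assume "0 < e"
  \<comment> \<open>Then 1/\<kappa> - \<open>e0\<close> is the reciprocal of \<kappa> + exp l / 2.
    The liminf condition lets b stay slightly below 1/\<kappa>, but r tends to \<kappa> + exp l, so
    eventually 1/b < r and the gain gap is exactly 0.\<close>
  define e0 where "e0 = 1 / \<kappa> - 1 / (\<kappa> + exp l / 2)"
  have "1 / (\<kappa> + exp l / 2) < 1 / \<kappa>"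
    using pos by (intro divide_strict_left_mono mult_pos_pos add_pos_pos) auto
  then have "0 < e0" by (simp add: e0_def)
  then obtain T0 where T0: "0 \<le> T0" "AE t in lebesgue. T0 < t \<longrightarrow> 1 / \<kappa> - e0 \<le> b t"
    using gain by blast
  have "\<forall>\<^sub>F t in at_top. V t \<le> 0 / \<mu> + e / 2"
  proof (rule gronwall_eventually[OF V_ac \<mu>_pos])
    fix e' :: real assume "0 < e'"
    \<comment> \<open>Each excess is at most 2x: one x is the tolerance in the limsup, the other the
      distance of exp(z t) below exp l.\<close>
    define F where "F x = G * x\<^sup>2 + a / \<kappa> * (x\<^sup>2 + (2 * x)\<^sup>2 + ((2 * x)\<^sup>2)\<^sup>2 + ((2 * x)\<^sup>2)\<^sup>2)" for x
    have "isCont F 0"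
      unfolding F_def[abs_def] by (intro continuous_intros)
    moreover have "F 0 < e'" using \<open>0 < e'\<close> by (simp add: F_def)
    ultimately obtain x where x: "0 < x" "F x < e'"
      by (rule isCont_positive_argument_less)
    obtain T1 where T1: "0 \<le> T1" "AE t in lebesgue. T1 < t \<longrightarrow> \<bar>d t\<bar> \<le> x \<and> \<delta> t \<le> x \<and>
      R * \<theta>1 t \<le> \<kappa> + exp l + x \<and> \<bar>\<theta>2 t\<bar> \<le> \<kappa> + exp l + x"
      using lim[OF x(1)] by blast
    have "((\<lambda>t. exp (z t)) \<longlongrightarrow> exp l) at_top" by (intro tendsto_exp z)
    then have "\<forall>\<^sub>F t in at_top. max (exp l - x) (exp l / 2) < exp (z t)"
      using x by (intro order_tendstoD) auto
    then obtain T2 where T2: "\<forall>t\<ge>T2. max (exp l - x) (exp l / 2) < exp (z t)"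
      unfolding eventually_at_top_linorder by blast
    define T where "T = max T0 (max T1 T2)"
    have "AE t in lebesgue. T < t \<longrightarrow>
        (\<exists>D. (V has_real_derivative D) (at t) \<and> D \<le> 0 + e' - \<mu> * V t)"
      using T0(2) T1(2) V_deriv_bound
    proof eventually_elim
      case (elim t)
      show ?case
      proof
        assume "T < t"
        then have t: "T0 < t" "T1 < t" "T2 \<le> t" "0 < t" using T0 by (auto simp: T_def)
        let ?S = "(d t)\<^sup>2 + gap \<bar>\<theta>2 t\<bar> (z t) + (gap \<bar>\<theta>2 t\<bar> (z t))\<^sup>2 + 4 * (b t * gap (1 / b t) (z t))
          + (gap (R * \<theta>1 t) (z t))\<^sup>2"
        have ez: "exp l - x < exp (z t)" "exp l / 2 < exp (z t)" using T2[rule_format, OF t(3)] by simp_all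
        have le: "\<bar>d t\<bar> \<le> x" "\<delta> t \<le> x" "R * \<theta>1 t \<le> \<kappa> + exp l + x" "\<bar>\<theta>2 t\<bar> \<le> \<kappa> + exp l + x"
          using elim t by auto
        have g2: "gap \<bar>\<theta>2 t\<bar> (z t) \<le> (2 * x)\<^sup>2" and g1: "gap (R * \<theta>1 t) (z t) \<le> (2 * x)\<^sup>2"
          by (rule gap_le; use le ez x in linarith)+
        have "1 / (\<kappa> + exp l / 2) \<le> b t" using elim t by (simp add: e0_def)
        moreover have "0 < 1 / (\<kappa> + exp l / 2)" using pos by (auto intro: add_pos_pos)
        ultimately have "1 / b t \<le> \<kappa> + exp l / 2"
          using le_imp_inverse_le[of "1 / (\<kappa> + exp l / 2)" "b t"] by (simp add: inverse_eq_divide)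
        then have g3: "gap (1 / b t) (z t) = 0" using ez by (simp add: gap_def)
        have "?S \<le> x\<^sup>2 + (2 * x)\<^sup>2 + ((2 * x)\<^sup>2)\<^sup>2 + ((2 * x)\<^sup>2)\<^sup>2"
          unfolding g3 using elim t abs_le_imp_power2_le[of "d t" x] g1 g2
            power_mono[OF g1 gap_nonneg, of 2] power_mono[OF g2 gap_nonneg, of 2] by simp
        moreover have "a / (\<kappa> + exp (z t)) \<le> a / \<kappa>"
          using pos r_pos by (intro divide_left_mono mult_pos_pos) auto
        moreover have "0 \<le> ?S"
          unfolding g3 using gap_nonneg by (auto intro!: add_nonneg_nonneg)
        moreover have "0 \<le> a / \<kappa>" using pos by simp
        ultimately have "a / (\<kappa> + exp (z t)) * ?S \<le> a / \<kappa> * (x\<^sup>2 + (2 * x)\<^sup>2 + ((2 * x)\<^sup>2)\<^sup>2 + ((2 * x)\<^sup>2)\<^sup>2)"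
          by (intro mult_mono[of "a / (\<kappa> + exp (z t))"])
        moreover have "G * (\<delta> t)\<^sup>2 \<le> G * x\<^sup>2"
          using elim t pos nonneg by (intro mult_left_mono power_mono) auto
        moreover obtain D where "(V has_real_derivative D) (at t)"
          "D \<le> G * (\<delta> t)\<^sup>2 + a / (\<kappa> + exp (z t)) * ?S - \<mu> * V t"
          using elim t by blast
        ultimately show "\<exists>D. (V has_real_derivative D) (at t) \<and> D \<le> 0 + e' - \<mu> * V t"
          using x(2) unfolding F_def by (intro exI[of _ D]) linarith
      qed
    qed
    then show "\<exists>T\<ge>0. AE t in lebesgue. T < t \<longrightarrow>
        (\<exists>D. (V has_real_derivative D) (at t) \<and> D \<le> 0 + e' - \<mu> * V t)"
      using T0(1) by (intro exI[of _ T]) (auto simp: T_def)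
  qed (use \<open>0 < e\<close> in simp)
  then show "\<forall>\<^sub>F t in at_top. dist (V t) 0 < e"
  proof eventually_elim
    case (elim t)
    have "0 \<le> V t" using P_nonneg[of t] E_nonneg[of t] by (simp add: V_def)
    then show ?case using elim \<open>0 < e\<close> by (simp add: dist_real_def)
  qed
qed

lemma state_tendsto_zero:
  assumes "(V \<longlongrightarrow> 0) at_top"
  shows "((\<lambda>t. \<bar>y t\<bar>) \<longlongrightarrow> 0) at_top" "(W \<longlongrightarrow> 0) at_top"
proof -
  have "(E \<longlongrightarrow> 0) at_top"
    by (rule tendsto_sandwich[OF _ _ tendsto_const assms]) (simp_all add: E_nonneg V_def P_nonneg)
  then have "((\<lambda>t. sqrt (2 * E t)) \<longlongrightarrow> sqrt (2 * 0)) at_top"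
    by (intro tendsto_real_sqrt tendsto_mult_left)
  then show "((\<lambda>t. \<bar>y t\<bar>) \<longlongrightarrow> 0) at_top" by (simp add: E_def)
  have "((\<lambda>t. sqrt (1 / k1 * V t)) \<longlongrightarrow> sqrt (1 / k1 * 0)) at_top"
    by (intro tendsto_real_sqrt tendsto_mult_left assms)
  then have lim: "((\<lambda>t. sqrt (1 / k1 * V t)) \<longlongrightarrow> 0) at_top" by simp
  have le: "W t \<le> sqrt (1 / k1 * V t)" for t
  proof (rule real_le_rsqrt)
    have "k1 * (W t)\<^sup>2 \<le> V t" using P_bounds(1)[of t] E_nonneg[of t] by (simp add: V_def)
    then show "(W t)\<^sup>2 \<le> 1 / k1 * V t" using pos by (simp add: field_simps)
  qed
  show "(W \<longlongrightarrow> 0) at_top"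
    by (rule tendsto_sandwich[OF _ _ tendsto_const lim]; intro always_eventually allI nonneg le)
qed

end

section \<open>The closed loop\<close>

lemma AE_time_leb_iff: "(AE t in time_leb. P t) \<longleftrightarrow> (AE t in lebesgue. 0 \<le> t \<longrightarrow> P t)"
  by (simp add: AE_restrict_space_iff)

lemma L_infinity_AE_norm_le:
  assumes "L_infinity f"
  shows "AE t in lebesgue. 0 < t \<longrightarrow> norm (f t) \<le> L_infinity_norm f"
proof -
  have "esssup time_leb (\<lambda>t. ereal (norm (f t))) < \<infinity>"
    using assms by (simp add: L_infinity_def)
  have "AE t in time_leb. ereal (norm (f t)) \<le> esssup time_leb (\<lambda>t. ereal (norm (f t)))"
    by (rule esssup_AE)
  then have "AE t in time_leb. norm (f t) \<le> L_infinity_norm f"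
  proof eventually_elim
    case (elim t)
    then show ?case
      using \<open>esssup time_leb (\<lambda>t. ereal (norm (f t))) < \<infinity>\<close>
      unfolding L_infinity_norm_def
      by (cases "esssup time_leb (\<lambda>t. ereal (norm (f t)))") auto
  qed
  then show ?thesis
    unfolding AE_time_leb_iff by eventually_elim auto
qed

lemma ess_inf_AE_le:
  assumes "0 < ess_inf f"
  shows "AE t in lebesgue. 0 < t \<longrightarrow> ess_inf f \<le> f t"
proof -
  let ?L = "Liminf (ae_filter time_leb) (\<lambda>t. ereal (f t))"
  \<comment> \<open>\<open>real_of_ereal\<close> sends infinite values to 0, so positivity makes the
    Liminf finite. The bound is then reached through countably many strict ones.\<close>
  have L: "?L = ereal (ess_inf f)"
    using assms unfolding ess_inf_def by (cases ?L) auto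
  have "AE t in time_leb. ess_inf f - 1 / real (Suc n) < f t" for n
  proof -
    have "ereal (ess_inf f - 1 / real (Suc n)) < ?L" by (simp add: L)
    then have "AE t in time_leb. ereal (ess_inf f - 1 / real (Suc n)) < ereal (f t)"
      by (rule less_LiminfD)
    then show ?thesis by simp
  qed
  then have "AE t in time_leb. \<forall>n. ess_inf f - 1 / real (Suc n) < f t"
    by (intro AE_all_countable[THEN iffD2] allI)
  then have "AE t in time_leb. ess_inf f \<le> f t"
  proof eventually_elim
    case (elim t)
    show ?case
    proof (rule ccontr)
      assume "\<not> ess_inf f \<le> f t"
      then obtain n where "1 / real (Suc n) < ess_inf f - f t"
        using nat_approx_posE[of "ess_inf f - f t"] by auto
      then show False using elim[rule_format, of n] by linarith
    qed
  qed
  then show ?thesis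
    unfolding AE_time_leb_iff by eventually_elim auto
qed

lemma eventually_ess_at_top:
  "eventually P ess_at_top \<longleftrightarrow> (\<exists>T\<ge>0. AE t in lebesgue. T < t \<longrightarrow> P t)"
proof
  assume "eventually P ess_at_top"
  then obtain Q S where Q: "eventually Q at_top" and S: "AE t in lebesgue. S t"
    and P: "\<And>t. Q t \<Longrightarrow> S t \<Longrightarrow> P t"
    unfolding ess_at_top_def eventually_inf by blast
  obtain T where "\<forall>t\<ge>T. Q t" using Q unfolding eventually_at_top_linorder by blast
  then have "AE t in lebesgue. max T 0 < t \<longrightarrow> P t"
    using S by (auto elim!: eventually_mono intro: P)
  then show "\<exists>T\<ge>0. AE t in lebesgue. T < t \<longrightarrow> P t"
    by (intro exI[of _ "max T 0"]) simp
next
  assume "\<exists>T\<ge>0. AE t in lebesgue. T < t \<longrightarrow> P t"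
  then obtain T where "AE t in lebesgue. T < t \<longrightarrow> P t" by blast
  then show "eventually P ess_at_top"
    unfolding ess_at_top_def eventually_inf using eventually_gt_at_top[of T] by blast
qed

text \<open>The essential bound excludes the value infinity, which \<open>real_of_ereal\<close>
  would turn into 0.\<close>

lemma ess_limsup_eventually_le:
  assumes bound: "AE t in lebesgue. 0 < t \<longrightarrow> f t \<le> M" and "ess_limsup f \<le> l" "0 < e"
  shows "\<forall>\<^sub>F t in ess_at_top. f t \<le> l + e"
proof -
  let ?L = "Limsup ess_at_top (\<lambda>t. ereal (f t))"
  have "\<forall>\<^sub>F t in ess_at_top. ereal (f t) \<le> ereal M"
    unfolding eventually_ess_at_top using bound by auto
  then have "?L \<le> ereal M" by (rule Limsup_bounded)
  then have "?L < ereal (l + e)"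
    using assms(2,3) unfolding ess_limsup_def by (cases ?L) auto
  then have "\<forall>\<^sub>F t in ess_at_top. ereal (f t) < ereal (l + e)"
    by (rule Limsup_lessD)
  then show ?thesis by (rule eventually_mono) simp
qed

text \<open>Here positivity of \<open>l\<close> excludes infinite values of the Liminf, whose real
  counterpart is 0.\<close>

lemma ess_liminf_eventually_ge:
  assumes "l \<le> ess_liminf f" "0 < l" "0 < e"
  shows "\<forall>\<^sub>F t in ess_at_top. l - e \<le> f t"
proof -
  let ?L = "Liminf ess_at_top (\<lambda>t. ereal (f t))"
  have "ereal (l - e) < ?L"
    using assms unfolding ess_liminf_def by (cases ?L) auto
  then have "\<forall>\<^sub>F t in ess_at_top. ereal (l - e) < ereal (f t)"
    by (rule less_LiminfD)
  then show ?thesis by (rule eventually_mono) simp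
qed

lemma at_within_atLeast: "0 < t \<Longrightarrow> at t within {0..} = at t" for t :: real
  by (rule at_within_open_subset[of t "{0<..}"]) auto

text \<open>Two continuous functions agree on a closed set; if it contains almost every point of an
  open set, it contains all of them.\<close>

lemma C1_AE_deriv_imp_deriv:
  assumes "C1 z" and h: "continuous_on {0..} h"
    and ae: "AE t in lebesgue. 0 < t \<longrightarrow> (z has_real_derivative h t) (at t)" and "0 < t"
  shows "(z has_real_derivative h t) (at t)"
proof -
  obtain f' where f': "continuous_on {0..} f'"
    "\<And>t. 0 \<le> t \<Longrightarrow> (z has_real_derivative f' t) (at t within {0..})"
    using \<open>C1 z\<close> unfolding C1_def by blast
  have d: "(z has_real_derivative f' t) (at t)" if "0 < t" for t
    using f'(2)[of t] that by (simp add: at_within_atLeast)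
  have "t \<in> {t \<in> {0..}. f' t - h t = 0}"
  proof (rule mem_closed_if_AE_lebesgue_open[of "{0<..}"])
    show "closed {t \<in> {0..}. f' t - h t = 0}"
      by (intro continuous_closed_preimage_constant continuous_on_diff f' h closed_atLeast)
    show "AE x\<in>{0<..} in lebesgue. x \<in> {t \<in> {0..}. f' t - h t = 0}"
      using ae by eventually_elim (auto dest: DERIV_unique[OF d])
  qed (use \<open>0 < t\<close> in auto)
  then show ?thesis using d[OF \<open>0 < t\<close>] by simp
qed

lemma C1_imp_continuous_on: "C1 z \<Longrightarrow> continuous_on {0..} z"
  unfolding C1_def by (auto intro: DERIV_continuous_on)

theorem corollary4:
  fixes c \<sigma> \<kappa> a C \<epsilon> \<Gamma> k1 k2 G R \<mu> \<beta> Z B :: real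
    and K :: "real \<Rightarrow> real \<Rightarrow> real"
    and L :: "h2 \<times> h01 \<Rightarrow> real \<Rightarrow> real"
    and phi P1 P2 P3 :: "real \<Rightarrow> real"
    and b d \<theta>2 y z :: "real \<Rightarrow> real"
    and \<theta>1 \<delta> :: "real \<Rightarrow> l2"
    and w :: "real \<Rightarrow> h01 \<times> l2"
    and g :: "real \<Rightarrow> real \<Rightarrow> real"
  assumes "c > 0" "\<sigma> > 0"
    and "\<epsilon> > 0" "\<Gamma> > 0" "\<kappa> > 0" "a > 0" "C > 0" "2 * \<kappa> > a"
    and "smooth phi" "\<And>s. phi s \<ge> 0"
    and "smooth P1" "smooth P2" "smooth P3"
    and P1: "\<And>s. P1 s \<ge> 1 / (4 * a * \<kappa> ^ 6) *
        (\<kappa> + 4 * a * C + 4 * \<kappa> ^ 3 + 4 * a * \<kappa> * phi s + 8 * a * \<kappa>\<^sup>2)"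
    and P2: "\<And>s. P2 s \<ge> 1 / (4 * a ^ 3 * \<kappa> ^ 5) *
        (1 / (16 * \<kappa>) * (\<kappa> + 4 * a * C + 4 * \<kappa> ^ 3 + 4 * a * \<kappa> * phi s)\<^sup>2
          + \<kappa>\<^sup>2 + a\<^sup>2 * (phi s)\<^sup>2 + 4 * a\<^sup>2 * (\<kappa> ^ 3 + 1))"
    and P3: "\<And>s. P3 s \<ge> 1 / (64 * a ^ 7 * \<kappa> ^ 4) *
        ((\<kappa>\<^sup>2 + a\<^sup>2 * (phi s)\<^sup>2)\<^sup>2 + 16 * a ^ 4)"
    and L: "\<And>v \<phi> s. \<bar>L (v, \<phi>) s\<bar> \<le>
        sqrt ((norm (h01_dx (h2_h01 v)))\<^sup>2 + (norm (h01_l2 \<phi>))\<^sup>2) + phi s * \<bar>s\<bar>"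
    and K: "\<And>x s. x \<in> {0..1} \<Longrightarrow> \<bar>K x s\<bar> \<le> \<bar>s\<bar>"
    and "L_infinity d" "L_infinity \<theta>1" "L_infinity \<theta>2" "L_infinity \<delta>"
    and "L_infinity b" "AE t in time_leb. b t > 0" "ess_inf b > 0"
    and solution: "closed_loop_solution c \<sigma> \<kappa> \<Gamma> \<epsilon> P1 P2 P3 K L b d \<theta>1 \<theta>2 \<delta> w y z"
    and k1: "k1 = 1 / \<sigma>"
    and k2: "k2 = 1 / \<sigma> * max (c\<^sup>2 + 1 + 2 * \<sigma>\<^sup>2 / (c\<^sup>2 * pi\<^sup>2)) (1 + 2 / c\<^sup>2)"
    and G: "G = 2 * (((c\<^sup>2 + 1)\<^sup>2 * pi\<^sup>2 + \<sigma>\<^sup>2) / (\<sigma>\<^sup>2 * c ^ 4 * pi\<^sup>2))"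
    and R: "R = sqrt G"
    and \<mu>: "\<mu> = min ((2 * \<kappa> - a) / (2 * \<kappa> * k2)) (2 * C)"
    and \<beta>: "\<beta> = ess_inf b"
    and g: "g = (\<lambda>s l. (max (s - \<kappa> - exp l) 0)\<^sup>2)"
    and Z: "Z = G * (L_infinity_norm \<delta>)\<^sup>2 + a / (\<kappa> + exp (z 0)) *
        ((L_infinity_norm d)\<^sup>2 + g (L_infinity_norm \<theta>2) (z 0) + (g (L_infinity_norm \<theta>2) (z 0))\<^sup>2
          + 4 * \<beta> * g (1 / \<beta>) (z 0) + (g (R * L_infinity_norm \<theta>1) (z 0))\<^sup>2)"
    and B: "B = 1 / (2 * k1) * (k2 * (norm (w 0))\<^sup>2 + 1 / 2 * \<bar>y 0\<bar>\<^sup>2 + 1 / \<mu> * Z)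
        + g (L_infinity_norm \<theta>2) (z 0) + (L_infinity_norm d)\<^sup>2
        + (g (L_infinity_norm \<theta>2) (z 0))\<^sup>2 + 2 * \<beta> * g (1 / \<beta>) (z 0)"
  shows "(\<forall>t\<ge>0.
      2 * k1 * (norm (w t))\<^sup>2 + \<bar>y t\<bar>\<^sup>2
        \<le> exp (- \<mu> * t) * (2 * k2 * (norm (w 0))\<^sup>2 + \<bar>y 0\<bar>\<^sup>2) + 2 * (1 / \<mu>) * Z \<and>
      z 0 \<le> z t \<and>
      z t \<le> ln (exp (z 0) + \<Gamma> / (4 * C) * \<bar>y 0\<bar>\<^sup>2
        + a * B * ((2 * C * (1 + exp (z 0)) + \<epsilon> * \<Gamma>)
            / (4 * C\<^sup>2 * \<epsilon> * min 1 \<kappa> * (1 + exp (z 0)))))) \<and>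
    Limsup at_top (\<lambda>t. ereal (norm (w t)))
      \<le> ereal (sqrt (k2 / k1 * (2 * \<epsilon> * R\<^sup>2 * (ess_limsup (\<lambda>t. norm (\<theta>1 t)))\<^sup>2
          + G * (ess_limsup (\<lambda>t. norm (\<delta> t)))\<^sup>2))) \<and>
    Limsup at_top (\<lambda>t. ereal \<bar>y t\<bar>) \<le> ereal (sqrt (2 * \<epsilon>)) \<and>
    ((d \<longlongrightarrow> 0) ess_at_top \<and> (\<delta> \<longlongrightarrow> 0) ess_at_top \<and> ess_liminf b \<ge> 1 / \<kappa> \<longrightarrow>
      (((\<lambda>t. \<bar>y t\<bar>) \<longlongrightarrow> 0) at_top \<and>
        ((\<lambda>t. norm (h01_dx (fst (w t)))) \<longlongrightarrow> 0) at_top \<and>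
        ((\<lambda>t. norm (snd (w t))) \<longlongrightarrow> 0) at_top) \<or>
      (\<exists>z_lim. (z \<longlongrightarrow> z_lim) at_top \<and>
        \<kappa> + exp z_lim < ess_limsup (\<lambda>t. max
          (sqrt (2 * (((c\<^sup>2 + 1)\<^sup>2 * pi\<^sup>2 + \<sigma>\<^sup>2) / (\<sigma>\<^sup>2 * c ^ 4 * pi\<^sup>2))) * norm (\<theta>1 t))
          \<bar>\<theta>2 t\<bar>)))"
proof -
  note pos = assms(1-8)
  have G_eq: "G = wave_gain c \<sigma>" by (simp add: G wave_gain_def)
  obtain W where
    P_ac: "loc_abs_continuous (\<lambda>t. Phi c \<sigma> (w t))" and
    y_cont: "continuous_on {0..} y" and y_ac: "loc_abs_continuous y" and z_C1: "C1 z" and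
    W: "AE t in time_leb. w t = (h2_h01 (fst (W t)), h01_l2 (snd (W t)))" and
    eqs: "AE t in time_leb.
        (\<exists>w'. (w has_vector_derivative w') (at t within {0..}) \<and>
          wave_equation c \<sigma> K (\<theta>1 t) (\<delta> t) (fst (W t)) (snd (W t)) (y t) w') \<and>
        (y has_real_derivative
          b t * feedback \<kappa> P1 P2 P3 (y t) (z t) + \<theta>2 t * L (W t) (y t) + d t) (at t within {0..}) \<and>
        (z has_real_derivative
          \<Gamma> * exp (- z t) * max ((y t)\<^sup>2 / 2 - \<epsilon>) 0) (at t within {0..})"
    using solution unfolding closed_loop_solution_def by blast
  have W': "AE t in lebesgue. 0 < t \<longrightarrow> w t = (h2_h01 (fst (W t)), h01_l2 (snd (W t)))"
    using W unfolding AE_time_leb_iff by eventually_elim auto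
  \<comment> \<open>Time 0 is negligible, and at positive times the derivative within the half-line
    is two-sided.\<close>
  have eqs': "AE t in lebesgue. 0 < t \<longrightarrow>
        (\<exists>w'. (w has_vector_derivative w') (at t) \<and>
          wave_equation c \<sigma> K (\<theta>1 t) (\<delta> t) (fst (W t)) (snd (W t)) (y t) w') \<and>
        (y has_real_derivative
          b t * feedback \<kappa> P1 P2 P3 (y t) (z t) + \<theta>2 t * L (W t) (y t) + d t) (at t) \<and>
        (z has_real_derivative \<Gamma> * exp (- z t) * max ((y t)\<^sup>2 / 2 - \<epsilon>) 0) (at t)"
    using eqs unfolding AE_time_leb_iff
  proof eventually_elim
    case (elim t)
    then show ?case using at_within_atLeast[of t] by (cases "0 < t") simp_all
  qed
  note bnd = L_infinity_AE_norm_le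
  have b_lower: "AE t in lebesgue. 0 < t \<longrightarrow> \<beta> \<le> b t"
    using ess_inf_AE_le[OF \<open>ess_inf b > 0\<close>] by (simp only: \<beta>)
  have "0 < \<beta>" using \<open>ess_inf b > 0\<close> by (simp only: \<beta>)
  have G_nonneg: "0 \<le> G" by (simp add: G)
  have R_nonneg: "0 \<le> R" using G_nonneg by (simp add: R)
  have z_cont: "continuous_on {0..} z" by (rule C1_imp_continuous_on[OF z_C1])
  have k_pos: "0 < k1" "0 < k2"
  proof -
    have "0 < 1 + 2 / c\<^sup>2" using pos by (simp add: add_pos_nonneg)
    then show "0 < k1" "0 < k2" using pos by (simp_all add: k1 k2 less_max_iff_disj)
  qed
  interpret cl: closed_loop_estimates \<kappa> a C \<epsilon> \<Gamma> k1 k2 G R \<mu> \<beta>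
    "L_infinity_norm d" "L_infinity_norm \<theta>1" "L_infinity_norm \<theta>2" "L_infinity_norm \<delta>"
    "\<lambda>t. norm (w t)" "\<lambda>t. Phi c \<sigma> (w t)" y z d b "\<lambda>t. norm (\<theta>1 t)" \<theta>2 "\<lambda>t. norm (\<delta> t)"
  proof
    show "k1 * (norm (w t))\<^sup>2 \<le> Phi c \<sigma> (w t)" for t
      unfolding k1 using pos by (intro Phi_lower)
    show "Phi c \<sigma> (w t) \<le> k2 * (norm (w t))\<^sup>2" for t
      unfolding k2 using pos by (intro Phi_upper)
    show "(z has_real_derivative \<Gamma> * exp (- z t) * max ((y t)\<^sup>2 / 2 - \<epsilon>) 0) (at t)" if "0 < t" for t
    proof (rule C1_AE_deriv_imp_deriv[OF z_C1 _ _ that])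
      show "continuous_on {0..} (\<lambda>t. \<Gamma> * exp (- z t) * max ((y t)\<^sup>2 / 2 - \<epsilon>) 0)"
        by (intro continuous_intros y_cont z_cont) auto
      show "AE t in lebesgue. 0 < t \<longrightarrow>
          (z has_real_derivative \<Gamma> * exp (- z t) * max ((y t)\<^sup>2 / 2 - \<epsilon>) 0) (at t)"
        using eqs' by eventually_elim blast
    qed
    show "AE t in lebesgue. 0 < t \<longrightarrow> (\<exists>D. ((\<lambda>t. Phi c \<sigma> (w t)) has_real_derivative D) (at t) \<and>
        D \<le> - (norm (w t))\<^sup>2 + G * (norm (\<theta>1 t))\<^sup>2 * (y t)\<^sup>2 + G * (norm (\<delta> t))\<^sup>2)"
      using eqs' W'
    proof eventually_elim
      case (elim t)
      show ?case
      proof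
        assume "0 < t"
        with elim obtain w' where w': "(w has_vector_derivative w') (at t)"
          "wave_equation c \<sigma> K (\<theta>1 t) (\<delta> t) (fst (W t)) (snd (W t)) (y t) w'"
          "w t = (h2_h01 (fst (W t)), h01_l2 (snd (W t)))"
          by blast
        show "\<exists>D. ((\<lambda>t. Phi c \<sigma> (w t)) has_real_derivative D) (at t) \<and>
          D \<le> - (norm (w t))\<^sup>2 + G * (norm (\<theta>1 t))\<^sup>2 * (y t)\<^sup>2 + G * (norm (\<delta> t))\<^sup>2"
          unfolding G_eq by (rule Phi_dissipation[OF pos(2,1) w'(3,1,2) K])
      qed
    qed
    show "AE t in lebesgue. 0 < t \<longrightarrow> (\<exists>D. (y has_real_derivative D) (at t) \<and>
      y t * D \<le> - C * (y t)\<^sup>2 + a / (\<kappa> + exp (z t)) * ((norm (w t))\<^sup>2 / 2 + (d t)\<^sup>2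
        + (max (\<bar>\<theta>2 t\<bar> - \<kappa> - exp (z t)) 0)\<^sup>2 + ((max (\<bar>\<theta>2 t\<bar> - \<kappa> - exp (z t)) 0)\<^sup>2)\<^sup>2
        + 2 * b t * (max (1 / b t - \<kappa> - exp (z t)) 0)\<^sup>2) \<and>
      y t * D + (R * norm (\<theta>1 t))\<^sup>2 * (y t)\<^sup>2 \<le> - C * (y t)\<^sup>2 + a / (\<kappa> + exp (z t)) * ((norm (w t))\<^sup>2 / 2 + (d t)\<^sup>2
        + (max (\<bar>\<theta>2 t\<bar> - \<kappa> - exp (z t)) 0)\<^sup>2 + ((max (\<bar>\<theta>2 t\<bar> - \<kappa> - exp (z t)) 0)\<^sup>2)\<^sup>2
        + 4 * b t * (max (1 / b t - \<kappa> - exp (z t)) 0)\<^sup>2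
        + ((max (R * norm (\<theta>1 t) - \<kappa> - exp (z t)) 0)\<^sup>2)\<^sup>2))"
      using eqs' W' b_lower
    proof eventually_elim
      case (elim t)
      show ?case
      proof (intro impI exI conjI)
        assume t: "0 < t"
        show "(y has_real_derivative
            b t * feedback \<kappa> P1 P2 P3 (y t) (z t) + \<theta>2 t * L (W t) (y t) + d t) (at t)"
          using elim t by blast
        have b: "0 < b t" using elim t \<open>0 < \<beta>\<close> by simp
        have l: "\<bar>L (W t) (y t)\<bar> \<le> norm (w t) + phi (y t) * \<bar>y t\<bar>"
          using L[of "fst (W t)" "snd (W t)" "y t"] elim t by (simp add: norm_state)
        have T: "0 \<le> R * norm (\<theta>1 t)" using R_nonneg by simp
        note plant_estimate[where ?P1.0 = P1 and ?P2.0 = P2 and ?P3.0 = P3 and y = "y t",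
            OF pos(6,7,5) b assms(10) T P1 P2 P3 l]
        then show
          "y t * (b t * feedback \<kappa> P1 P2 P3 (y t) (z t) + \<theta>2 t * L (W t) (y t) + d t)
            \<le> - C * (y t)\<^sup>2 + a / (\<kappa> + exp (z t)) * ((norm (w t))\<^sup>2 / 2 + (d t)\<^sup>2
              + (max (\<bar>\<theta>2 t\<bar> - \<kappa> - exp (z t)) 0)\<^sup>2 + ((max (\<bar>\<theta>2 t\<bar> - \<kappa> - exp (z t)) 0)\<^sup>2)\<^sup>2
              + 2 * b t * (max (1 / b t - \<kappa> - exp (z t)) 0)\<^sup>2)"
          "y t * (b t * feedback \<kappa> P1 P2 P3 (y t) (z t) + \<theta>2 t * L (W t) (y t) + d t)
              + (R * norm (\<theta>1 t))\<^sup>2 * (y t)\<^sup>2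
            \<le> - C * (y t)\<^sup>2 + a / (\<kappa> + exp (z t)) * ((norm (w t))\<^sup>2 / 2 + (d t)\<^sup>2
              + (max (\<bar>\<theta>2 t\<bar> - \<kappa> - exp (z t)) 0)\<^sup>2 + ((max (\<bar>\<theta>2 t\<bar> - \<kappa> - exp (z t)) 0)\<^sup>2)\<^sup>2
              + 4 * b t * (max (1 / b t - \<kappa> - exp (z t)) 0)\<^sup>2
              + ((max (R * norm (\<theta>1 t) - \<kappa> - exp (z t)) 0)\<^sup>2)\<^sup>2)"
          by blast+
      qed
    qed
    show "AE t in lebesgue. 0 < t \<longrightarrow> \<bar>d t\<bar> \<le> L_infinity_norm d \<and> norm (\<theta>1 t) \<le> L_infinity_norm \<theta>1 \<and>
      \<bar>\<theta>2 t\<bar> \<le> L_infinity_norm \<theta>2 \<and> norm (\<delta> t) \<le> L_infinity_norm \<delta> \<and> \<beta> \<le> b t"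
      using bnd[OF \<open>L_infinity d\<close>] bnd[OF \<open>L_infinity \<theta>1\<close>] bnd[OF \<open>L_infinity \<theta>2\<close>]
        bnd[OF \<open>L_infinity \<delta>\<close>] b_lower
      by eventually_elim auto
  qed (use pos k_pos G_nonneg R \<mu> \<open>0 < \<beta>\<close> P_ac y_ac y_cont z_cont in auto)
  have g_eq: "g s l = cl.gap s l" for s l by (simp add: g cl.gap_def)
  have Z_eq: "Z = cl.Z" unfolding Z cl.Z_def g_eq ..
  have B_eq: "B = cl.B" unfolding B cl.B_def g_eq Z_eq ..
  obtain l where l: "(z \<longlongrightarrow> l) at_top" using cl.z_converges by blast
  let ?p = "ess_limsup (\<lambda>t. norm (\<theta>1 t))" and ?q = "ess_limsup (\<lambda>t. norm (\<delta> t))"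
  have Limsup_w: "Limsup at_top (\<lambda>t. ereal (norm (w t)))
      \<le> ereal (sqrt (k2 / k1 * (2 * \<epsilon> * R\<^sup>2 * ?p\<^sup>2 + G * ?q\<^sup>2)))"
  proof (rule cl.W_limsup)
    fix e :: real assume "0 < e"
    have "\<forall>\<^sub>F t in ess_at_top. norm (\<theta>1 t) \<le> ?p + e"
      by (rule ess_limsup_eventually_le[OF bnd[OF \<open>L_infinity \<theta>1\<close>] order_refl \<open>0 < e\<close>])
    moreover have "\<forall>\<^sub>F t in ess_at_top. norm (\<delta> t) \<le> ?q + e"
      by (rule ess_limsup_eventually_le[OF bnd[OF \<open>L_infinity \<delta>\<close>] order_refl \<open>0 < e\<close>])
    ultimately have "\<forall>\<^sub>F t in ess_at_top. norm (\<theta>1 t) \<le> ?p + e \<and> norm (\<delta> t) \<le> ?q + e"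
      by (rule eventually_conj)
    then show "\<exists>T\<ge>0. AE t in lebesgue. T < t \<longrightarrow> norm (\<theta>1 t) \<le> ?p + e \<and> norm (\<delta> t) \<le> ?q + e"
      unfolding eventually_ess_at_top .
  qed
  define m where "m t = max (R * norm (\<theta>1 t)) \<bar>\<theta>2 t\<bar>" for t
  \<comment> \<open>The dichotomy is decided by comparing the essential limsup of \<open>m\<close>
    with \<kappa> + exp l, where l is the limit of z; this is the case where the second alternative
    fails.\<close>
  have convergence: "((\<lambda>t. \<bar>y t\<bar>) \<longlongrightarrow> 0) at_top \<and> ((\<lambda>t. norm (w t)) \<longlongrightarrow> 0) at_top"
    if d0: "(d \<longlongrightarrow> 0) ess_at_top" and \<delta>0: "(\<delta> \<longlongrightarrow> 0) ess_at_top" and b0: "1 / \<kappa> \<le> ess_liminf b"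
      and m0: "ess_limsup m \<le> \<kappa> + exp l"
  proof -
    have m_bound: "AE t in lebesgue. 0 < t \<longrightarrow> m t \<le> max (R * L_infinity_norm \<theta>1) (L_infinity_norm \<theta>2)"
      using bnd[OF \<open>L_infinity \<theta>1\<close>] bnd[OF \<open>L_infinity \<theta>2\<close>]
    proof eventually_elim
      case (elim t)
      then show ?case
        unfolding m_def using R_nonneg by (intro impI max.mono mult_left_mono) auto
    qed
    have "((\<lambda>t. Phi c \<sigma> (w t) + cl.E t) \<longlongrightarrow> 0) at_top"
      unfolding cl.V_def[symmetric]
    proof (rule cl.V_tendsto_zero[OF l])
      fix e :: real assume "0 < e"
      have "\<forall>\<^sub>F t in ess_at_top. dist (d t) 0 < e" "\<forall>\<^sub>F t in ess_at_top. dist (\<delta> t) 0 < e"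
        using tendstoD[OF d0 \<open>0 < e\<close>] tendstoD[OF \<delta>0 \<open>0 < e\<close>] by blast+
      moreover have "\<forall>\<^sub>F t in ess_at_top. m t \<le> \<kappa> + exp l + e"
        by (rule ess_limsup_eventually_le[OF m_bound m0 \<open>0 < e\<close>])
      ultimately have "\<forall>\<^sub>F t in ess_at_top. \<bar>d t\<bar> \<le> e \<and> norm (\<delta> t) \<le> e \<and>
          R * norm (\<theta>1 t) \<le> \<kappa> + exp l + e \<and> \<bar>\<theta>2 t\<bar> \<le> \<kappa> + exp l + e"
        by eventually_elim (simp add: m_def)
      then show "\<exists>T\<ge>0. AE t in lebesgue. T < t \<longrightarrow> \<bar>d t\<bar> \<le> e \<and> norm (\<delta> t) \<le> e \<and>
          R * norm (\<theta>1 t) \<le> \<kappa> + exp l + e \<and> \<bar>\<theta>2 t\<bar> \<le> \<kappa> + exp l + e"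
        unfolding eventually_ess_at_top .
      have "\<forall>\<^sub>F t in ess_at_top. 1 / \<kappa> - e \<le> b t"
        using b0 pos \<open>0 < e\<close> by (intro ess_liminf_eventually_ge) auto
      then show "\<exists>T\<ge>0. AE t in lebesgue. T < t \<longrightarrow> 1 / \<kappa> - e \<le> b t"
        unfolding eventually_ess_at_top .
    qed
    then have "(cl.V \<longlongrightarrow> 0) at_top" unfolding cl.V_def[symmetric] .
    then show ?thesis using cl.state_tendsto_zero by blast
  qed
  have components: "((\<lambda>t. norm (h01_dx (fst (w t)))) \<longlongrightarrow> 0) at_top \<and> ((\<lambda>t. norm (snd (w t))) \<longlongrightarrow> 0) at_top"
    if lim: "((\<lambda>t. norm (w t)) \<longlongrightarrow> 0) at_top"
  proof
    have "norm (h01_dx (fst (w t))) \<le> norm (w t)" "norm (snd (w t)) \<le> norm (w t)" for t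
      using norm_fst_le[of "fst (w t)" "snd (w t)"] norm_snd_le[of "snd (w t)" "fst (w t)"]
      by (simp_all add: norm_h01_eq)
    then show "((\<lambda>t. norm (h01_dx (fst (w t)))) \<longlongrightarrow> 0) at_top" "((\<lambda>t. norm (snd (w t))) \<longlongrightarrow> 0) at_top"
      by (auto intro: tendsto_sandwich[OF _ _ tendsto_const lim])
  qed
  have m_eq: "(\<lambda>t. max (sqrt (2 * (((c\<^sup>2 + 1)\<^sup>2 * pi\<^sup>2 + \<sigma>\<^sup>2) / (\<sigma>\<^sup>2 * c ^ 4 * pi\<^sup>2))) * norm (\<theta>1 t)) \<bar>\<theta>2 t\<bar>) = m"
    unfolding m_def[abs_def] R G ..
  show ?thesis
    unfolding m_eq B_eq Z_eq
  proof (intro conjI allI impI)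
    fix t :: real assume "0 \<le> t"
    then show "2 * k1 * (norm (w t))\<^sup>2 + \<bar>y t\<bar>\<^sup>2
        \<le> exp (- \<mu> * t) * (2 * k2 * (norm (w 0))\<^sup>2 + \<bar>y 0\<bar>\<^sup>2) + 2 * (1 / \<mu>) * cl.Z"
      by (rule cl.state_bound)
    show "z 0 \<le> z t" by (rule cl.z_mono[OF order_refl \<open>0 \<le> t\<close>])
    show "z t \<le> ln (exp (z 0) + \<Gamma> / (4 * C) * \<bar>y 0\<bar>\<^sup>2
        + a * cl.B * ((2 * C * (1 + exp (z 0)) + \<epsilon> * \<Gamma>)
            / (4 * C\<^sup>2 * \<epsilon> * min 1 \<kappa> * (1 + exp (z 0)))))"
      by (rule cl.z_upper[OF \<open>0 \<le> t\<close>])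
  next
    assume "(d \<longlongrightarrow> 0) ess_at_top \<and> (\<delta> \<longlongrightarrow> 0) ess_at_top \<and> 1 / \<kappa> \<le> ess_liminf b"
    then show "((\<lambda>t. \<bar>y t\<bar>) \<longlongrightarrow> 0) at_top \<and>
        ((\<lambda>t. norm (h01_dx (fst (w t)))) \<longlongrightarrow> 0) at_top \<and> ((\<lambda>t. norm (snd (w t))) \<longlongrightarrow> 0) at_top \<or>
        (\<exists>z_lim. (z \<longlongrightarrow> z_lim) at_top \<and> \<kappa> + exp z_lim < ess_limsup m)"
      using convergence components l by (cases "ess_limsup m \<le> \<kappa> + exp l") (auto simp: not_le)
  qed (rule Limsup_w cl.y_limsup)+
qed

end
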